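(* Let $s>\frac32$ and $u_0\in H^s_+(\mathbb T)$. The solution $u$ of the focusing Calogero--Sutherland DNLS equation $i\partial_tu+\partial_x^2u+2D_+(|u|^2)u=0$ with $u(0)=u_0$ is given, for every $t$ in its interval of existence, by $$u(t,z)=\big\langle(\mathrm{Id}-z e^{-it}e^{-2itL_{u_0}}S^* )^{-1}u_0\,\big|\,1\big\rangle,\qquad \forall z\in\mathbb D.$$
   Context: $\mathbb T=\mathbb R/(2\pi\mathbb Z)$, $\mathbb D=\{z\in\mathbb C:|z|<1\}$. $\langle f|g\rangle=\int_0^{2\pi}f\bar g\,\frac{dx}{2\pi}$. $L^2_+(\mathbb T)=\{u\in L^2(\mathbb T):\hat u(n)=0\ \forall n\le -1\}$ and $H^s_+(\mathbb T)=H^s(\mathbb T)\cap L^2_+(\mathbb T)$. A function $u\in L^2_+(\mathbb T)$ is identified with the holomorphic function $u(z)=\sum_{k\ge0}\hat u(k)z^k$ on $\mathbb D$. $\Pi$ is the projector onto nonnegative Fourier modes, $D=-i\partial_x$, $D_+=D\Pi$. $S^*h=\Pi(e^{-ix}h)$ is the adjoint on $L^2_+(\mathbb T)$ of the shift $Sh=e^{ix}h$. $T_bf=\Pi(bf)$ is the Toeplitz operator with symbol $b$, and $L_u=D-T_uT_{\bar u}$ is the (self-adjoint) operator on $L^2_+(\mathbb T)$ with domain $H^1_+(\mathbb T)$. For $s>\frac32$ the equation is locally well-posed in $H^s_+(\mathbb T)$, and "the solution" is the corresponding maximal solution, continuous in time with values in $H^s_+(\mathbb T)$. *)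

theory Defs
  imports "HOL-Analysis.Analysis"
begin

section \<open>Functions on the circle modulo equality almost everywhere\<close>

text \<open>
  The circle is represented by the interval from 0 to \<open>2\<pi>\<close>.  The type \<open>circfun\<close> consists of all
  measurable functions on it modulo equality almost everywhere, so that it is closed under products;
  \<open>L\<^sup>2\<close> and the Sobolev spaces are subsets of it.
\<close>

abbreviation circ_measure :: "real measure" where
  "circ_measure \<equiv> lebesgue_on {0..2 * pi}"

definition ae_eq :: "(real \<Rightarrow> complex) \<Rightarrow> (real \<Rightarrow> complex) \<Rightarrow> bool" where
  "ae_eq f g \<longleftrightarrow> f \<in> borel_measurable circ_measure \<and> g \<in> borel_measurable circ_measure \<and>
     (AE x in circ_measure. f x = g x)"

quotient_type circfun = "real \<Rightarrow> complex" / partial: ae_eq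
  morphisms rep_circfun fun_class
proof (rule part_equivpI)
  show "\<exists>f. ae_eq f f"
    by (rule exI[of _ "\<lambda>_. 0"]) (simp add: ae_eq_def)
  show "symp ae_eq"
    by (auto simp: symp_def ae_eq_def elim: eventually_mono)
  show "transp ae_eq"
  proof (rule transpI)
    fix f g h assume "ae_eq f g" and "ae_eq g h"
    then have *: "AE x in circ_measure. f x = g x" "AE x in circ_measure. g x = h x"
      and m: "f \<in> borel_measurable circ_measure" "h \<in> borel_measurable circ_measure"
      by (auto simp: ae_eq_def)
    from * have "AE x in circ_measure. f x = h x"
      by eventually_elim simp
    with m show "ae_eq f h"
      by (simp add: ae_eq_def)
  qed
qed

lemma ae_eq_unop:
  assumes "ae_eq f f'" and "continuous_on UNIV op"
  shows "ae_eq (\<lambda>x. op (f x)) (\<lambda>x. op (f' x))"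
proof -
  have "(\<lambda>x. op (g x)) \<in> borel_measurable circ_measure"
    if "g \<in> borel_measurable circ_measure" for g
    using borel_measurable_continuous_on[OF assms(2) that] .
  then show ?thesis
    using assms(1) by (auto simp: ae_eq_def elim: eventually_mono)
qed

lemma ae_eq_binop:
  assumes "ae_eq f f'" and "ae_eq g g'"
    and "\<And>a b. a \<in> borel_measurable circ_measure \<Longrightarrow> b \<in> borel_measurable circ_measure \<Longrightarrow>
           (\<lambda>x. op (a x) (b x)) \<in> borel_measurable circ_measure"
  shows "ae_eq (\<lambda>x. op (f x) (g x)) (\<lambda>x. op (f' x) (g' x))"
proof -
  have "AE x in circ_measure. f x = f' x" "AE x in circ_measure. g x = g' x"
    using assms(1,2) by (auto simp: ae_eq_def)
  then have "AE x in circ_measure. op (f x) (g x) = op (f' x) (g' x)"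
    by eventually_elim simp
  then show ?thesis
    using assms by (simp add: ae_eq_def)
qed

instantiation circfun :: comm_ring_1
begin

lift_definition zero_circfun :: circfun is "\<lambda>_. 0"
  by (simp add: ae_eq_def)

lift_definition one_circfun :: circfun is "\<lambda>_. 1"
  by (simp add: ae_eq_def)

lift_definition plus_circfun :: "circfun \<Rightarrow> circfun \<Rightarrow> circfun" is "\<lambda>f g x. f x + g x"
  by (rule ae_eq_binop) auto

lift_definition minus_circfun :: "circfun \<Rightarrow> circfun \<Rightarrow> circfun" is "\<lambda>f g x. f x - g x"
  by (rule ae_eq_binop) auto

lift_definition uminus_circfun :: "circfun \<Rightarrow> circfun" is "\<lambda>f x. - f x"
  by (rule ae_eq_unop) (auto intro: continuous_intros)

lift_definition times_circfun :: "circfun \<Rightarrow> circfun \<Rightarrow> circfun" is "\<lambda>f g x. f x * g x"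
  by (rule ae_eq_binop) auto

instance
proof
  show "(0::circfun) \<noteq> 1"
  proof (transfer, rule notI)
    assume "ae_eq (\<lambda>_. 0) (\<lambda>_. 1)"
    then have "AE x in circ_measure. False"
      by (simp add: ae_eq_def)
    then obtain N where "space circ_measure \<subseteq> N" "emeasure circ_measure N = 0" "N \<in> sets circ_measure"
      by (rule AE_E) (auto simp: subset_iff)
    then have "emeasure circ_measure (space circ_measure) = 0"
      by (metis emeasure_mono le_zero_eq)
    then show False
      by (simp add: emeasure_restrict_space)
  qed
qed (transfer; simp add: ae_eq_def algebra_simps)+

end

lift_definition cnj_fun :: "circfun \<Rightarrow> circfun" is "\<lambda>f x. cnj (f x)"
  by (rule ae_eq_unop) (auto intro: continuous_intros)

text \<open>\<open>fun_class f\<close> is the class of the measurable function \<open>f\<close>.\<close>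

definition const_fun :: "complex \<Rightarrow> circfun" where
  "const_fun c = fun_class (\<lambda>_. c)"

definition exp_fun :: "int \<Rightarrow> circfun" where
  "exp_fun n = fun_class (\<lambda>x. exp (\<i> * of_int n * complex_of_real x))"

lift_definition inner_fun :: "circfun \<Rightarrow> circfun \<Rightarrow> complex"
  is "\<lambda>f g. integral\<^sup>L circ_measure (\<lambda>x. f x * cnj (g x)) / (2 * pi)"
proof -
  fix f f' g g' :: "real \<Rightarrow> complex"
  assume "ae_eq f f'" "ae_eq g g'"
  then have "ae_eq (\<lambda>x. f x * cnj (g x)) (\<lambda>x. f' x * cnj (g' x))"
    by (rule ae_eq_binop)
      (intro borel_measurable_times borel_measurable_continuous_on[where f = cnj] continuous_intros)
  then show "integral\<^sup>L circ_measure (\<lambda>x. f x * cnj (g x)) / (2 * pi) =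
             integral\<^sup>L circ_measure (\<lambda>x. f' x * cnj (g' x)) / (2 * pi)"
    by (simp add: ae_eq_def integral_cong_AE)
qed

lift_definition square_integrable :: "circfun \<Rightarrow> bool"
  is "\<lambda>f. integrable circ_measure (\<lambda>x. (cmod (f x))\<^sup>2)"
proof -
  fix f g :: "real \<Rightarrow> complex"
  assume "ae_eq f g"
  then have m: "f \<in> borel_measurable circ_measure" "g \<in> borel_measurable circ_measure"
    and "AE x in circ_measure. f x = g x"
    by (auto simp: ae_eq_def)
  from this(3) have "AE x in circ_measure. (cmod (f x))\<^sup>2 = (cmod (g x))\<^sup>2"
    by eventually_elim simp
  with m show "integrable circ_measure (\<lambda>x. (cmod (f x))\<^sup>2) =
               integrable circ_measure (\<lambda>x. (cmod (g x))\<^sup>2)"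
    by (intro integrable_cong_AE) auto
qed

section \<open>Hardy and Sobolev spaces\<close>

definition L2 :: "circfun set" where
  "L2 = {f. square_integrable f}"

definition L2_norm :: "circfun \<Rightarrow> real" where
  "L2_norm f = sqrt (Re (inner_fun f f))"

definition fourier :: "circfun \<Rightarrow> int \<Rightarrow> complex" where
  "fourier f n = inner_fun f (exp_fun n)"

definition L2_plus :: "circfun set" where
  "L2_plus = {f \<in> L2. \<forall>n \<le> -1. fourier f n = 0}"

definition Hs :: "real \<Rightarrow> circfun set" where
  "Hs s = {f \<in> L2. (\<lambda>n::int. (1 + (real_of_int n)\<^sup>2) powr s * (cmod (fourier f n))\<^sup>2) summable_on UNIV}"

definition Hs_norm :: "real \<Rightarrow> circfun \<Rightarrow> real" where
  "Hs_norm s f = sqrt (\<Sum>\<^sub>\<infinity>n::int. (1 + (real_of_int n)\<^sup>2) powr s * (cmod (fourier f n))\<^sup>2)"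

definition Hs_plus :: "real \<Rightarrow> circfun set" where
  "Hs_plus s = Hs s \<inter> L2_plus"

definition holo_ext :: "circfun \<Rightarrow> complex \<Rightarrow> complex" where
  "holo_ext u z = (\<Sum>k::nat. fourier u (int k) * z ^ k)"

section \<open>Operators\<close>

text \<open>An element of \<open>L\<^sup>2\<close> is determined by its Fourier coefficients, so the descriptions below
  are definite on the respective domains: \<open>L\<^sup>2\<close> for \<open>szego\<close>, and \<open>H\<^sup>1\<close> for \<open>D_op\<close>.\<close>

definition szego :: "circfun \<Rightarrow> circfun" where
  "szego f = (THE g. g \<in> L2 \<and> (\<forall>n. fourier g n = (if n \<ge> 0 then fourier f n else 0)))"

definition D_op :: "circfun \<Rightarrow> circfun" where
  "D_op f = (THE g. g \<in> L2 \<and> (\<forall>n. fourier g n = of_int n * fourier f n))"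

definition D_plus :: "circfun \<Rightarrow> circfun" where
  "D_plus f = D_op (szego f)"

definition toeplitz :: "circfun \<Rightarrow> circfun \<Rightarrow> circfun" where
  "toeplitz b f = szego (b * f)"

definition S_star :: "circfun \<Rightarrow> circfun" where
  "S_star h = szego (exp_fun (-1) * h)"

definition Lax_op :: "circfun \<Rightarrow> circfun \<Rightarrow> circfun" where
  "Lax_op u f = D_op f - toeplitz u (toeplitz (cnj_fun u) f)"

text \<open>For a self-adjoint operator \<open>A\<close> on \<open>L2_plus\<close> with domain \<open>Dom\<close>, Stone's theorem identifies
  the family of operators \<open>exp (i t A)\<close> as the unique strongly continuous one-parameter unitary
  group whose infinitesimal generator is \<open>i A\<close> with domain exactly \<open>Dom\<close>.\<close>

definition unitary_group_generated_by ::
    "(circfun \<Rightarrow> circfun) \<Rightarrow> circfun set \<Rightarrow> (real \<Rightarrow> circfun \<Rightarrow> circfun) \<Rightarrow> bool" where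
  "unitary_group_generated_by A Dom U \<longleftrightarrow>
     (\<forall>t. bij_betw (U t) L2_plus L2_plus) \<and>
     (\<forall>t. \<forall>f\<in>L2_plus. \<forall>g\<in>L2_plus. U t (f + g) = U t f + U t g) \<and>
     (\<forall>t c. \<forall>f\<in>L2_plus. U t (const_fun c * f) = const_fun c * U t f) \<and>
     (\<forall>t. \<forall>f\<in>L2_plus. \<forall>g\<in>L2_plus. inner_fun (U t f) (U t g) = inner_fun f g) \<and>
     (\<forall>f\<in>L2_plus. U 0 f = f) \<and>
     (\<forall>t r. \<forall>f\<in>L2_plus. U (t + r) f = U t (U r f)) \<and>
     (\<forall>t. \<forall>f\<in>L2_plus. ((\<lambda>r. L2_norm (U r f - U t f)) \<longlongrightarrow> 0) (at t)) \<and>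
     (\<forall>f\<in>L2_plus. \<forall>g\<in>L2_plus.
        (f \<in> Dom \<and> A f = g) \<longleftrightarrow>
        ((\<lambda>h. L2_norm (const_fun (1 / complex_of_real h) * (U h f - f) - const_fun \<i> * g))
           \<longlongrightarrow> 0) (at 0))"

definition exp_i_op :: "real \<Rightarrow> (circfun \<Rightarrow> circfun) \<Rightarrow> circfun set \<Rightarrow> circfun \<Rightarrow> circfun" where
  "exp_i_op t A Dom f = (THE g. \<exists>U. unitary_group_generated_by A Dom U \<and> g = U t f)"

definition op_inverse :: "(circfun \<Rightarrow> circfun) \<Rightarrow> circfun \<Rightarrow> circfun" where
  "op_inverse T = inv_into L2_plus T"

section \<open>The Calogero--Sutherland DNLS equation\<close>

definition vec_deriv :: "(real \<Rightarrow> complex) \<Rightarrow> real \<Rightarrow> complex" where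
  "vec_deriv f x = vector_derivative f (at x)"

definition test_function :: "(real \<Rightarrow> complex) \<Rightarrow> bool" where
  "test_function \<phi> \<longleftrightarrow> (\<forall>x. \<phi> (x + 2 * pi) = \<phi> x) \<and>
     (\<forall>k x. ((vec_deriv ^^ k) \<phi>) differentiable (at x))"

text \<open>For \<open>s < 2\<close> the term \<open>\<partial>\<^sub>x\<^sup>2 u\<close> is only a distribution, of class \<open>H\<^sup>s\<^sup>-\<^sup>2\<close>, so the equation
  is read in the sense of distributions in \<open>x\<close>.  The other terms are elements of \<open>L\<^sup>2\<close>.\<close>

definition CS_solution_on :: "real \<Rightarrow> circfun \<Rightarrow> real set \<Rightarrow> (real \<Rightarrow> circfun) \<Rightarrow> bool" where
  "CS_solution_on s u0 I u \<longleftrightarrow>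
     open I \<and> is_interval I \<and> 0 \<in> I \<and> u 0 = u0 \<and>
     (\<forall>t\<in>I. u t \<in> Hs_plus s) \<and>
     (\<forall>t\<in>I. ((\<lambda>r. Hs_norm s (u r - u t)) \<longlongrightarrow> 0) (at t)) \<and>
     (\<forall>t\<in>I. \<forall>\<phi>. test_function \<phi> \<longrightarrow>
        (\<exists>w. ((\<lambda>r. inner_fun (u r) (fun_class \<phi>)) has_vector_derivative w) (at t) \<and>
             \<i> * w + inner_fun (u t) (fun_class ((vec_deriv ^^ 2) \<phi>))
               + inner_fun (2 * D_plus (u t * cnj_fun (u t)) * u t) (fun_class \<phi>) = 0))"

definition CS_maximal_solution :: "real \<Rightarrow> circfun \<Rightarrow> real set \<Rightarrow> (real \<Rightarrow> circfun) \<Rightarrow> bool" where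
  "CS_maximal_solution s u0 I u \<longleftrightarrow> CS_solution_on s u0 I u \<and>
     (\<forall>J v. CS_solution_on s u0 J v \<and> I \<subseteq> J \<and> (\<forall>t\<in>I. v t = u t) \<longrightarrow> J = I)"

end

(*
  Put K(r) = exp (-i (t - r) (2 L_{u(r)} + 1)) S* and Phi(r) = <K(r)^n u(r) | 1>.  Then Phi(t) is the
  n-th Fourier coefficient of u(t), and Phi(0) is the n-th Taylor coefficient of the right-hand side,
  so the formula says that Phi(0) = Phi(t).  Formally Phi is constant: for the antisymmetric operator
  B = i d_x^2 + 2 T_u d_x T_{u bar} the equation reads u' = B u, and L_u' = [B, L_u],
  [S*, B] = -i (2 L_u + 1) S* and B 1 = 0, whence K' = [B, K] and Phi' = <B K^n u | 1> = 0.

  For s < 2 the function u is not regular enough for this, so all operators are compressed to the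
  Fourier modes 0, ..., N, where they are bounded.  These polynomials are invariant under S* and
  T_{u bar}; therefore the algebraic identities acquire only errors located near the mode N, which are
  O(1/N) when they are paired with vectors bounded in H^1.  The latter bounds are uniform in N, since
  exp (i tau L) commutes with L and L - D is bounded.  The same estimate shows that the compressed
  groups converge strongly; the limit is the unitary group generated by i L_u.
*)
theory Submission
  imports Defs
begin

section \<open>Bounded operators on a normed space as a Banach algebra\<close>

text \<open>The bound s > 3/2 enters through \<open>wbound\<close>: by Cauchy-Schwarz the sum of (1
  + k) |u_k| is finite, uniformly on compact time intervals. Hence u and its derivative have bounded
  Toeplitz operators, and L_u is a bounded perturbation of D. Sequences carry the real part of the
  Hermitian product. Complex scalars become operators \<open>cop z\<close>, complex linearity is
  commutation with them, and i A is skew when A is symmetric and complex linear. K(r) contains an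
  exponential whose generator varies with r, and this exponential is never differentiated in r.
  Instead, K at the times r and q is compared through the intertwiner 1 + (q - r) B, and the local
  errors o(q - r) + O(|q - r| / N) are summed by bisection. The o(q - r) is not uniform in N, since
  B grows with N; but N is fixed while the time interval is subdivided. In the Lax pair, the
  compression error is a commutator of D with a product of two operators leaving the modes up to N.
  Each of them gains 1/N on H^1, D costs one N, and one factor 1/N survives.\<close>

typedef (overloaded) 'a endo = "UNIV :: ('a::real_normed_vector \<Rightarrow>\<^sub>L 'a) set"
  morphisms blinfun_of endo_of_blinfun ..

setup_lifting type_definition_endo

text \<open>Multiplication is composition, so that \<open>exp\<close> of an operator and the product
  rule come from the theory of Banach algebras. The sort \<open>perfect_space\<close> excludes the
  zero space, on which the identity would have norm 0.\<close>

instantiation endo :: ("{real_normed_vector, perfect_space}") real_normed_algebra_1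
begin

lift_definition zero_endo :: "'a endo" is 0 .
lift_definition one_endo :: "'a endo" is id_blinfun .
lift_definition plus_endo :: "'a endo \<Rightarrow> 'a endo \<Rightarrow> 'a endo" is "(+)" .
lift_definition minus_endo :: "'a endo \<Rightarrow> 'a endo \<Rightarrow> 'a endo" is "(-)" .
lift_definition uminus_endo :: "'a endo \<Rightarrow> 'a endo" is uminus .
lift_definition times_endo :: "'a endo \<Rightarrow> 'a endo \<Rightarrow> 'a endo" is "blinfun_compose" .
lift_definition scaleR_endo :: "real \<Rightarrow> 'a endo \<Rightarrow> 'a endo" is "scaleR" .
lift_definition norm_endo :: "'a endo \<Rightarrow> real" is norm .
definition dist_endo :: "'a endo \<Rightarrow> 'a endo \<Rightarrow> real" where "dist_endo x y = norm (x - y)"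
definition sgn_endo :: "'a endo \<Rightarrow> 'a endo" where "sgn_endo x = inverse (norm x) *\<^sub>R x"
definition uniformity_endo :: "('a endo \<times> 'a endo) filter" where
  "uniformity_endo = (INF e\<in>{0 <..}. principal {(x, y). dist x y < e})"
definition open_endo :: "'a endo set \<Rightarrow> bool" where
  "open_endo U = (\<forall>x\<in>U. \<forall>\<^sub>F (x', y) in uniformity. x' = x \<longrightarrow> y \<in> U)"

instance
proof
  fix x y z :: "'a endo" and a b :: real
  show "dist x y = norm (x - y)" by (rule dist_endo_def)
  show "sgn x = inverse (norm x) *\<^sub>R x" by (rule sgn_endo_def)
  show "uniformity = (INF e\<in>{0 <..}. principal {(x, y :: 'a endo). dist x y < e})"
    by (rule uniformity_endo_def)
  show "open U = (\<forall>x\<in>U. \<forall>\<^sub>F (x', y) in uniformity. x' = x \<longrightarrow> y \<in> U)" for U :: "'a endo set"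
    by (rule open_endo_def)
  show "x + y + z = x + (y + z)" by transfer simp
  show "x + y = y + x" by transfer simp
  show "0 + x = x" by transfer simp
  show "- x + x = 0" by transfer simp
  show "x - y = x + - y" by transfer simp
  show "a *\<^sub>R (x + y) = a *\<^sub>R x + a *\<^sub>R y" by transfer (simp add: scaleR_right_distrib)
  show "(a + b) *\<^sub>R x = a *\<^sub>R x + b *\<^sub>R x" by transfer (simp add: scaleR_left_distrib)
  show "a *\<^sub>R b *\<^sub>R x = (a * b) *\<^sub>R x" by transfer simp
  show "1 *\<^sub>R x = x" by transfer simp
  show "norm x = 0 \<longleftrightarrow> x = 0" by transfer simp
  show "norm (x + y) \<le> norm x + norm y" by transfer (rule norm_triangle_ineq)
  show "norm (a *\<^sub>R x) = \<bar>a\<bar> * norm x" by transfer simp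
  show "x * y * z = x * (y * z)" by transfer (rule blinfun_eqI, simp)
  show "(x + y) * z = x * z + y * z"
    by transfer (rule bounded_bilinear.add_left[OF bounded_bilinear_blinfun_compose])
  show "x * (y + z) = x * y + x * z"
    by transfer (rule bounded_bilinear.add_right[OF bounded_bilinear_blinfun_compose])
  show "a *\<^sub>R x * y = a *\<^sub>R (x * y)"
    by transfer (rule bounded_bilinear.scaleR_left[OF bounded_bilinear_blinfun_compose])
  show "x * a *\<^sub>R y = a *\<^sub>R (x * y)"
    by transfer (rule bounded_bilinear.scaleR_right[OF bounded_bilinear_blinfun_compose])
  show "1 * x = x" by transfer (rule blinfun_eqI, simp)
  show "x * 1 = x" by transfer (rule blinfun_eqI, simp)
  show "norm (x * y) \<le> norm x * norm y" by transfer (rule norm_blinfun_compose)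
  show "norm (1 :: 'a endo) = 1" by transfer simp
  show "(0 :: 'a endo) \<noteq> 1"
    by transfer (metis norm_blinfun_id norm_zero zero_neq_one)
qed

end

instance endo :: ("{banach, perfect_space}") banach
proof
  fix X :: "nat \<Rightarrow> 'a endo"
  assume "Cauchy X"
  then have "Cauchy (\<lambda>n. blinfun_of (X n))"
    unfolding Cauchy_def dist_norm by (simp add: minus_endo.rep_eq[symmetric] norm_endo.rep_eq[symmetric])
  then obtain L where L: "(\<lambda>n. blinfun_of (X n)) \<longlonglongrightarrow> L"
    using Cauchy_convergent convergent_def by blast
  have "X \<longlonglongrightarrow> endo_of_blinfun L"
    using L unfolding LIMSEQ_def dist_norm
    by (simp add: norm_endo.rep_eq minus_endo.rep_eq endo_of_blinfun_inverse)
  then show "convergent X" by (auto simp: convergent_def)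
qed

lift_definition app :: "'a::real_normed_vector endo \<Rightarrow> 'a \<Rightarrow> 'a" (infixr "\<rhd>" 75)
  is blinfun_apply .

definition endo_of :: "('a::real_normed_vector \<Rightarrow> 'a) \<Rightarrow> 'a endo" where
  "endo_of f = endo_of_blinfun (Blinfun f)"

lemma app_endo_of: "bounded_linear f \<Longrightarrow> endo_of f \<rhd> x = f x"
  by (simp add: endo_of_def app.rep_eq endo_of_blinfun_inverse bounded_linear_Blinfun_apply)

lemma endo_eqI: "(\<And>x. X \<rhd> x = Y \<rhd> x) \<Longrightarrow> X = Y"
  by transfer (rule blinfun_eqI)

lemma app_one [simp]: "1 \<rhd> x = x" by transfer simp
lemma app_mult [simp]: "(X * Y) \<rhd> x = X \<rhd> Y \<rhd> x" by transfer simp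

lemma norm_app: "norm (X \<rhd> x) \<le> norm X * norm x"
  by transfer (rule norm_blinfun)

lemma bounded_bilinear_app:
  "bounded_bilinear ((\<rhd>) :: 'a::{real_normed_vector, perfect_space} endo \<Rightarrow> 'a \<Rightarrow> 'a)"
proof
  show "\<exists>K. \<forall>X x. norm (X \<rhd> x) \<le> norm (X :: 'a endo) * norm x * K"
    by (rule exI[of _ 1]) (simp add: norm_app)
qed (transfer; simp add: blinfun.bilinear_simps)+

interpretation app: bounded_bilinear "(\<rhd>) :: 'a::{real_normed_vector, perfect_space} endo \<Rightarrow> 'a \<Rightarrow> 'a"
  by (rule bounded_bilinear_app)

lemmas app_simps = app.add_left app.add_right app.diff_left app.diff_right app.minus_left
  app.minus_right app.scaleR_left app.scaleR_right

lemma norm_endo_le: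
  fixes X :: "'a::{real_normed_vector, perfect_space} endo"
  assumes "\<And>x. norm (X \<rhd> x) \<le> b * norm x" and "0 \<le> b"
  shows "norm X \<le> b"
  using assms by transfer (rule norm_blinfun_bound)

text \<open>A relation rather than a function: each adjoint is exhibited explicitly, and
  \<open>adj_unique\<close> turns two computations of the same adjoint into an operator identity.
  Several commutation rules below are obtained by transposing an easier one in this way.\<close>

definition adj :: "'a::{real_inner, perfect_space} endo \<Rightarrow> 'a endo \<Rightarrow> bool" where
  "adj X Y \<longleftrightarrow> (\<forall>x y. inner (X \<rhd> x) y = inner x (Y \<rhd> y))"

lemma adjD: "adj X Y \<Longrightarrow> inner (X \<rhd> x) y = inner x (Y \<rhd> y)"
  by (simp add: adj_def)

lemma adj_sym: "adj X Y \<Longrightarrow> adj Y X"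
  by (simp add: adj_def inner_commute)

lemma adj_unique:
  assumes "adj X Y" "adj X Z" shows "Y = Z"
proof (rule endo_eqI)
  fix x
  have "inner u (Y \<rhd> x) = inner u (Z \<rhd> x)" for u
    using assms by (metis adjD)
  then have "inner (Y \<rhd> x - Z \<rhd> x) (Y \<rhd> x - Z \<rhd> x) = 0"
    by (simp add: inner_diff_right)
  then show "Y \<rhd> x = Z \<rhd> x" by simp
qed

lemma adj_one: "adj 1 1" by (simp add: adj_def)
lemma adj_zero: "adj 0 0" by (simp add: adj_def app.zero_left)
lemma adj_add: "adj X Y \<Longrightarrow> adj X' Y' \<Longrightarrow> adj (X + X') (Y + Y')"
  by (simp add: adj_def app_simps inner_add_left inner_add_right)
lemma adj_diff: "adj X Y \<Longrightarrow> adj X' Y' \<Longrightarrow> adj (X - X') (Y - Y')"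
  by (simp add: adj_def app_simps inner_diff_left inner_diff_right)
lemma adj_minus: "adj X Y \<Longrightarrow> adj (- X) (- Y)"
  by (simp add: adj_def app_simps)
lemma adj_mult: "adj X Y \<Longrightarrow> adj X' Y' \<Longrightarrow> adj (X * X') (Y' * Y)"
  by (simp add: adj_def)
lemma adj_power: "adj X Y \<Longrightarrow> adj (X ^ n) (Y ^ n)"
proof (induction n)
  case (Suc n)
  then show ?case by (metis adj_mult power_Suc power_Suc2)
qed (simp add: adj_one)
lemma adj_sum: "(\<And>i. i \<in> I \<Longrightarrow> adj (X i) (Y i)) \<Longrightarrow> adj (sum X I) (sum Y I)"
  by (induction I rule: infinite_finite_induct) (simp_all add: adj_zero adj_add)
lemma adj_suminf:
  fixes X Y :: "nat \<Rightarrow> 'a::{real_inner, banach, perfect_space} endo"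
  assumes "\<And>i. adj (X i) (Y i)" "summable X" "summable Y"
  shows "adj (suminf X) (suminf Y)"
  unfolding adj_def
proof (intro allI)
  fix x y
  have "(\<lambda>i. inner (X i \<rhd> x) y) sums inner (suminf X \<rhd> x) y"
    by (rule bounded_linear.sums[OF bounded_linear_inner_left
        bounded_linear.sums[OF app.bounded_linear_left summable_sums[OF assms(2)]]])
  moreover have "(\<lambda>i. inner x (Y i \<rhd> y)) sums inner x (suminf Y \<rhd> y)"
    by (rule bounded_linear.sums[OF bounded_linear_inner_right
        bounded_linear.sums[OF app.bounded_linear_left summable_sums[OF assms(3)]]])
  moreover have "(\<lambda>i. inner (X i \<rhd> x) y) = (\<lambda>i. inner x (Y i \<rhd> y))"
    using adjD[OF assms(1)] by blast
  ultimately show "inner (suminf X \<rhd> x) y = inner x (suminf Y \<rhd> y)"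
    by (simp add: sums_unique2)
qed

text \<open>The squared norm along y = exp (s X) x has derivative 2 <X y, y>, which vanishes for
  antisymmetric X.\<close>

lemma norm_exp_antisym:
  fixes X :: "'a::{real_inner, banach, perfect_space} endo"
  assumes "adj X (- X)"
  shows "norm (exp (t *\<^sub>R X) \<rhd> x) = norm x"
proof -
  let ?f = "\<lambda>t. inner (exp (t *\<^sub>R X) \<rhd> x) (exp (t *\<^sub>R X) \<rhd> x)"
  have "(?f has_real_derivative 0) (at s)" for s
  proof -
    have d: "((\<lambda>t. exp (t *\<^sub>R X) \<rhd> x) has_vector_derivative X \<rhd> exp (s *\<^sub>R X) \<rhd> x) (at s)"
      using bounded_linear.has_vector_derivative[OF app.bounded_linear_left[of x]
        exp_scaleR_has_vector_derivative_left[of X s]] by simp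
    have "(?f has_vector_derivative
        (inner (exp (s *\<^sub>R X) \<rhd> x) (X \<rhd> exp (s *\<^sub>R X) \<rhd> x) + inner (X \<rhd> exp (s *\<^sub>R X) \<rhd> x) (exp (s *\<^sub>R X) \<rhd> x))) (at s)"
      by (rule bounded_bilinear.has_vector_derivative[OF bounded_bilinear_inner d d])
    moreover have "inner (X \<rhd> y) y = 0" for y
      using adjD[OF assms, of y y] by (simp add: app_simps inner_commute)
    ultimately show ?thesis
      by (simp add: inner_commute has_real_derivative_iff_has_vector_derivative)
  qed
  then have "?f t = ?f 0"
    by (meson DERIV_isconst_all)
  then show ?thesis
    by (simp add: norm_eq_sqrt_inner)
qed

lemma exp_scaleR_minus: "exp (t *\<^sub>R X) * exp (- t *\<^sub>R X) = (1 :: 'a::{real_normed_algebra_1, banach})"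
  using exp_minus_inverse[of "t *\<^sub>R X"] by simp

lemma exp_scaleR_add: "exp ((s + t) *\<^sub>R X) = exp (s *\<^sub>R X) * exp (t *\<^sub>R (X :: 'a::{real_normed_algebra_1, banach}))"
  by (simp add: exp_add_commuting scaleR_left_distrib)

text \<open>By polarization the isometry exp (t X) preserves inner products; its inverse exp (- t X)
  is therefore its adjoint.\<close>

lemma adj_exp_antisym:
  fixes X :: "'a::{real_inner, banach, perfect_space} endo"
  assumes "adj X (- X)"
  shows "adj (exp (t *\<^sub>R X)) (exp (- t *\<^sub>R X))"
  unfolding adj_def
proof (intro allI)
  fix x y
  let ?E = "exp (t *\<^sub>R X)"
  have pol: "inner u v = ((norm (u + v))\<^sup>2 - (norm (u - v))\<^sup>2) / 4" for u v :: 'a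
    by (simp add: power2_norm_eq_inner inner_add_left inner_add_right inner_diff_left
      inner_diff_right inner_commute)
  have "inner (?E \<rhd> u) (?E \<rhd> v) = inner u v" for u v
    unfolding pol by (simp add: app_simps[symmetric] norm_exp_antisym[OF assms])
  then have "inner (?E \<rhd> x) (?E \<rhd> exp (- t *\<^sub>R X) \<rhd> y) = inner x (exp (- t *\<^sub>R X) \<rhd> y)" .
  then show "inner (?E \<rhd> x) y = inner x (exp (- t *\<^sub>R X) \<rhd> y)"
    by (metis app_mult app_one exp_scaleR_minus)
qed

lemma commute_exp:
  fixes X Y :: "'a::{real_normed_algebra_1, banach}"
  assumes "X * Y = Y * X"
  shows "X * exp Y = exp Y * X"
proof -
  have p: "X * Y ^ n = Y ^ n * X" for n
    using power_commuting_commutes[OF assms[symmetric]] by simp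
  have "(\<lambda>n. X * (Y ^ n /\<^sub>R fact n)) sums (X * exp Y)"
    by (intro sums_mult exp_converges)
  moreover have "(\<lambda>n. (Y ^ n /\<^sub>R fact n) * X) sums (exp Y * X)"
    by (intro sums_mult2 exp_converges)
  ultimately show ?thesis
    using p by (simp add: sums_unique2)
qed

section \<open>Square-summable sequences\<close>

typedef ell2 = "{a :: nat \<Rightarrow> complex. summable (\<lambda>n. (cmod (a n))\<^sup>2)}"
  morphisms coef Abs_ell2
  by (rule exI[of _ "\<lambda>_. 0"]) simp

setup_lifting type_definition_ell2

lemma summable_coef: "summable (\<lambda>n. (cmod (coef x n))\<^sup>2)"
  using coef by auto

lemma ell2_eqI: "(\<And>n. coef x n = coef y n) \<Longrightarrow> x = y"
  by (simp add: coef_inject[symmetric] fun_eq_iff)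

lemma cmod_add_sq_le: "(cmod (a + b))\<^sup>2 \<le> 2 * (cmod a)\<^sup>2 + 2 * (cmod b)\<^sup>2"
proof -
  have "(cmod (a + b))\<^sup>2 \<le> (cmod a + cmod b)\<^sup>2"
    by (intro power_mono norm_triangle_ineq) simp
  also have "\<dots> \<le> 2 * (cmod a)\<^sup>2 + 2 * (cmod b)\<^sup>2"
    using sum_squares_bound[of "cmod a" "cmod b"] by (simp add: power2_eq_square algebra_simps)
  finally show ?thesis .
qed

lemma cmod_mult_le_sq: "cmod a * cmod b \<le> (cmod a)\<^sup>2 + (cmod b)\<^sup>2"
proof -
  have "0 \<le> cmod a * cmod b" by simp
  moreover have "2 * (cmod a * cmod b) \<le> (cmod a)\<^sup>2 + (cmod b)\<^sup>2"
    using sum_squares_bound[of "cmod a" "cmod b"] by (simp only: mult.assoc)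
  ultimately show ?thesis by linarith
qed

lemma summable_norm_add_sq:
  assumes "summable (\<lambda>n. (cmod (a n))\<^sup>2)" "summable (\<lambda>n. (cmod (b n))\<^sup>2)"
  shows "summable (\<lambda>n. (cmod (a n + b n))\<^sup>2)"
proof (rule summable_comparison_test')
  show "summable (\<lambda>n. 2 * (cmod (a n))\<^sup>2 + 2 * (cmod (b n))\<^sup>2)"
    using assms by (intro summable_add summable_mult)
  show "norm ((cmod (a n + b n))\<^sup>2) \<le> 2 * (cmod (a n))\<^sup>2 + 2 * (cmod (b n))\<^sup>2" for n
    using cmod_add_sq_le by simp
qed

lemma summable_prod_sq:
  assumes "summable (\<lambda>n. (cmod (a n))\<^sup>2)" "summable (\<lambda>n. (cmod (b n))\<^sup>2)"
  shows "summable (\<lambda>n. cmod (a n) * cmod (b n))"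
proof (rule summable_comparison_test')
  show "summable (\<lambda>n. (cmod (a n))\<^sup>2 + (cmod (b n))\<^sup>2)"
    using assms by (intro summable_add)
  show "norm (cmod (a n) * cmod (b n)) \<le> (cmod (a n))\<^sup>2 + (cmod (b n))\<^sup>2" for n
    using cmod_mult_le_sq[of "a n" "b n"] by simp
qed

lemma summable_inner_sq:
  assumes "summable (\<lambda>n. (cmod (a n))\<^sup>2)" "summable (\<lambda>n. (cmod (b n))\<^sup>2)"
  shows "summable (\<lambda>n. inner (a n) (b n))"
  by (rule summable_comparison_test'[OF summable_prod_sq[OF assms]])
    (simp add: Cauchy_Schwarz_ineq2)

text \<open>On \<open>complex\<close>, \<open>inner\<close> is the real dot product, so this is the
  real part of the Hermitian product. The imaginary part is recovered by pairing with i times a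
  vector.\<close>

instantiation ell2 :: real_inner
begin

lift_definition zero_ell2 :: ell2 is "\<lambda>_. 0" by simp
lift_definition plus_ell2 :: "ell2 \<Rightarrow> ell2 \<Rightarrow> ell2" is "\<lambda>a b n. a n + b n"
  by (rule summable_norm_add_sq)
lift_definition uminus_ell2 :: "ell2 \<Rightarrow> ell2" is "\<lambda>a n. - a n" by simp
lift_definition minus_ell2 :: "ell2 \<Rightarrow> ell2 \<Rightarrow> ell2" is "\<lambda>a b n. a n - b n"
  using summable_norm_add_sq[of _ "\<lambda>n. - _ n"] by simp
lift_definition scaleR_ell2 :: "real \<Rightarrow> ell2 \<Rightarrow> ell2" is "\<lambda>c a n. c *\<^sub>R a n"
  by (simp add: power_mult_distrib summable_mult)
lift_definition inner_ell2 :: "ell2 \<Rightarrow> ell2 \<Rightarrow> real" is "\<lambda>a b. \<Sum>n. inner (a n) (b n)" .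
definition norm_ell2 :: "ell2 \<Rightarrow> real" where "norm_ell2 x = sqrt (inner x x)"
definition dist_ell2 :: "ell2 \<Rightarrow> ell2 \<Rightarrow> real" where "dist_ell2 x y = norm (x - y)"
definition sgn_ell2 :: "ell2 \<Rightarrow> ell2" where "sgn_ell2 x = inverse (norm x) *\<^sub>R x"
definition uniformity_ell2 :: "(ell2 \<times> ell2) filter" where
  "uniformity_ell2 = (INF e\<in>{0 <..}. principal {(x, y). dist x y < e})"
definition open_ell2 :: "ell2 set \<Rightarrow> bool" where
  "open_ell2 U = (\<forall>x\<in>U. \<forall>\<^sub>F (x', y) in uniformity. x' = x \<longrightarrow> y \<in> U)"

instance
proof
  fix x y z :: ell2 and a b :: real
  show "dist x y = norm (x - y)" by (rule dist_ell2_def)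
  show "sgn x = inverse (norm x) *\<^sub>R x" by (rule sgn_ell2_def)
  show "uniformity = (INF e\<in>{0 <..}. principal {(x, y :: ell2). dist x y < e})"
    by (rule uniformity_ell2_def)
  show "open U = (\<forall>x\<in>U. \<forall>\<^sub>F (x', y) in uniformity. x' = x \<longrightarrow> y \<in> U)" for U :: "ell2 set"
    by (rule open_ell2_def)
  show "x + y + z = x + (y + z)" by transfer (simp add: add.assoc)
  show "x + y = y + x" by transfer (simp add: add.commute)
  show "0 + x = x" by transfer simp
  show "- x + x = 0" by transfer simp
  show "x - y = x + - y" by transfer simp
  show "a *\<^sub>R (x + y) = a *\<^sub>R x + a *\<^sub>R y" by transfer (simp add: scaleR_right_distrib)
  show "(a + b) *\<^sub>R x = a *\<^sub>R x + b *\<^sub>R x" by transfer (simp add: scaleR_left_distrib)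
  show "a *\<^sub>R b *\<^sub>R x = (a * b) *\<^sub>R x" by transfer simp
  show "1 *\<^sub>R x = x" by transfer simp
  show "inner x y = inner y x" by transfer (simp add: inner_commute)
  show "inner (x + y) z = inner x z + inner y z"
    by transfer (simp add: inner_add_left suminf_add summable_inner_sq)
  show "inner (a *\<^sub>R x) y = a * inner x y"
    by transfer (simp add: suminf_mult summable_inner_sq)
  show "0 \<le> inner x x"
    by transfer (simp add: suminf_nonneg summable_inner_sq)
  show "inner x x = 0 \<longleftrightarrow> x = 0"
  proof (transfer)
    fix a :: "nat \<Rightarrow> complex"
    assume "summable (\<lambda>n. (cmod (a n))\<^sup>2)"
    then show "((\<Sum>n. inner (a n) (a n)) = 0) = (a = (\<lambda>_. 0))"
      by (subst suminf_eq_zero_iff) (auto simp: summable_inner_sq fun_eq_iff)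
  qed
  show "norm x = sqrt (inner x x)" by (rule norm_ell2_def)
qed

end

lemma coef_simps [simp]:
  "coef 0 n = 0" "coef (x + y) n = coef x n + coef y n" "coef (- x) n = - coef x n"
  "coef (x - y) n = coef x n - coef y n" "coef (c *\<^sub>R x) n = c *\<^sub>R coef x n"
  by (transfer, simp)+

lemma inner_ell2_eq: "inner x y = (\<Sum>n. inner (coef x n) (coef y n))"
  by transfer simp

lemma inner_sums: "(\<lambda>n. inner (coef x n) (coef y n)) sums inner x y"
  unfolding inner_ell2_eq by (intro summable_sums summable_inner_sq summable_coef)

lemma norm_ell2_sums: "(\<lambda>n. (cmod (coef x n))\<^sup>2) sums (norm x)\<^sup>2"
  using inner_sums[of x x] by (simp add: power2_norm_eq_inner)

lemma norm_ell2_sq: "(norm x)\<^sup>2 = (\<Sum>n. (cmod (coef x n))\<^sup>2)"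
  using norm_ell2_sums sums_unique by blast

lemma norm_ell2_le:
  assumes "\<And>n. cmod (coef x n) \<le> cmod (coef y n)" shows "norm x \<le> norm y"
proof -
  have "(norm x)\<^sup>2 \<le> (norm y)\<^sup>2"
    unfolding norm_ell2_sq by (intro suminf_le summable_coef power_mono assms) simp
  then show ?thesis by (rule power2_le_imp_le) simp
qed

lemma cmod_coef_le: "cmod (coef x n) \<le> norm x"
proof -
  have "(\<Sum>i\<in>{n}. (cmod (coef x i))\<^sup>2) \<le> (norm x)\<^sup>2"
    unfolding norm_ell2_sq by (intro sum_le_suminf summable_coef) auto
  then have "(cmod (coef x n))\<^sup>2 \<le> (norm x)\<^sup>2" by simp
  then show ?thesis by (rule power2_le_imp_le) simp
qed

lemma bounded_linear_coef: "bounded_linear (\<lambda>x. coef x n)"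
  by (rule bounded_linear_intro[of _ 1]) (auto simp: cmod_coef_le)

instance ell2 :: banach
proof
  fix X :: "nat \<Rightarrow> ell2"
  assume C: "Cauchy X"
  have "\<exists>l. (\<lambda>i. coef (X i) n) \<longlonglongrightarrow> l" for n
    using bounded_linear.Cauchy[OF bounded_linear_coef C] Cauchy_convergent convergent_def by blast
  then obtain l where l: "\<And>n. (\<lambda>i. coef (X i) n) \<longlonglongrightarrow> l n" by metis
  \<comment> \<open>The Cauchy estimate is kept on finite sections, where j can go to infinity; the
    bound is uniform in the length m.\<close>
  have part: "(\<Sum>n<m. (cmod (coef (X i) n - l n))\<^sup>2) \<le> e\<^sup>2"
    if e: "0 < e" and N: "\<forall>i\<ge>N. \<forall>j\<ge>N. norm (X i - X j) < e" and i: "i \<ge> N" for e N i m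
  proof (rule LIMSEQ_le_const2)
    show "(\<lambda>j. \<Sum>n<m. (cmod (coef (X i) n - coef (X j) n))\<^sup>2) \<longlonglongrightarrow> (\<Sum>n<m. (cmod (coef (X i) n - l n))\<^sup>2)"
      by (intro tendsto_intros l)
    have "(\<Sum>n<m. (cmod (coef (X i) n - coef (X j) n))\<^sup>2) \<le> e\<^sup>2" if "j \<ge> N" for j
    proof -
      have "(\<Sum>n<m. (cmod (coef (X i - X j) n))\<^sup>2) \<le> (norm (X i - X j))\<^sup>2"
        unfolding norm_ell2_sq by (intro sum_le_suminf summable_coef) auto
      also have "\<dots> \<le> e\<^sup>2" using N i that by (intro power_mono) (auto intro: less_imp_le)
      finally show ?thesis by simp
    qed
    then show "\<exists>N. \<forall>j\<ge>N. (\<Sum>n<m. (cmod (coef (X i) n - coef (X j) n))\<^sup>2) \<le> e\<^sup>2" by blast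
  qed
  have cau: "\<exists>N. \<forall>i\<ge>N. \<forall>j\<ge>N. norm (X i - X j) < e" if "e > 0" for e
    using C that unfolding Cauchy_def dist_norm by blast
  obtain N where N: "\<forall>i\<ge>N. \<forall>j\<ge>N. norm (X i - X j) < 1" using cau[of 1] by auto
  have "summable (\<lambda>n. (cmod (coef (X N) n - l n))\<^sup>2)"
  proof (rule bounded_imp_summable)
    show "(\<Sum>n\<le>m. (cmod (coef (X N) n - l n))\<^sup>2) \<le> 1\<^sup>2" for m
      using part[OF _ N order_refl, of "Suc m"] by (simp only: lessThan_Suc_atMost zero_less_one)
  qed simp
  from summable_norm_add_sq[OF summable_coef[of "- X N"] this]
  have sl: "summable (\<lambda>n. (cmod (l n))\<^sup>2)" by simp
  define x where "x = Abs_ell2 l"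
  have x: "coef x n = l n" for n using sl by (simp add: x_def Abs_ell2_inverse)
  have "X \<longlonglongrightarrow> x"
  proof (rule LIMSEQ_I)
    fix r :: real assume r: "r > 0"
    then obtain N where N: "\<forall>i\<ge>N. \<forall>j\<ge>N. norm (X i - X j) < r / 2" using cau[of "r/2"] by auto
    have "norm (X i - x) < r" if "i \<ge> N" for i
    proof -
      have "(\<Sum>n. (cmod (coef (X i - x) n))\<^sup>2) \<le> (r / 2)\<^sup>2"
      proof (intro suminf_le_const summable_coef)
        show "(\<Sum>n<m. (cmod (coef (X i - x) n))\<^sup>2) \<le> (r / 2)\<^sup>2" for m
          using part[OF _ N that, of m] r by (simp add: x)
      qed
      then have "(norm (X i - x))\<^sup>2 \<le> (r / 2)\<^sup>2" by (simp add: norm_ell2_sq)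
      then have "norm (X i - x) \<le> r / 2" by (rule power2_le_imp_le) (use r in simp)
      then show ?thesis using r by simp
    qed
    then show "\<exists>N. \<forall>i\<ge>N. norm (X i - x) < r" by blast
  qed
  then show "convergent X" by (auto simp: convergent_def)
qed

lift_definition unit_vec :: "nat \<Rightarrow> complex \<Rightarrow> ell2" is "\<lambda>k c n. if n = k then c else 0"
proof -
  fix k :: nat and c :: complex
  show "summable (\<lambda>n. (cmod (if n = k then c else 0))\<^sup>2)"
    by (rule summable_finite[of "{k}"]) auto
qed

lemma coef_unit_vec: "coef (unit_vec k c) n = (if n = k then c else 0)"
  by transfer simp

lemma inner_unit_vec: "inner x (unit_vec k c) = inner (coef x k) c"
proof -
  have "(\<lambda>n. inner (coef x n) (coef (unit_vec k c) n)) sums (\<Sum>n\<in>{k}. inner (coef x n) (coef (unit_vec k c) n))"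
    by (rule sums_finite) (auto simp: coef_unit_vec)
  from sums_unique2[OF inner_sums this] show ?thesis
    by (simp add: coef_unit_vec)
qed

lemma norm_unit_vec [simp]: "norm (unit_vec k c) = cmod c"
  by (simp add: norm_eq_sqrt_inner inner_unit_vec coef_unit_vec)

text \<open>Makes the operators on \<open>ell2\<close> an algebra whose unit has norm 1.\<close>

instance ell2 :: perfect_space
proof
  fix x :: ell2
  show "\<not> open {x}"
  proof
    assume "open {x}"
    then obtain e where e: "e > 0" "ball x e \<subseteq> {x}" by (auto simp: open_contains_ball)
    have "x + unit_vec 0 (of_real (e / 2)) \<in> ball x e" using e by (simp add: dist_norm)
    then have "unit_vec 0 (of_real (e / 2)) = 0" using e by auto
    then show False using e norm_unit_vec[of 0 "of_real (e/2)"] by simp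
  qed
qed

section \<open>Shifts, diagonal operators and Toeplitz operators\<close>

text \<open>Common constructor for operators given by a formula F on coefficients: real linearity
  and a square-sum bound are all that remains to be checked for each of them.\<close>

lemma endo_of_coef:
  fixes F :: "(nat \<Rightarrow> complex) \<Rightarrow> nat \<Rightarrow> complex"
  assumes sq: "\<And>x. summable (\<lambda>n. (cmod (F (coef x) n))\<^sup>2)"
    and le: "\<And>x. (\<Sum>n. (cmod (F (coef x) n))\<^sup>2) \<le> (B * norm x)\<^sup>2"
    and add: "\<And>a b n. F (\<lambda>n. a n + b n) n = F a n + F b n"
    and scale: "\<And>c a n. F (\<lambda>n. c *\<^sub>R a n) n = c *\<^sub>R F a n"
    and "0 \<le> B"
  shows "coef (endo_of (\<lambda>x. Abs_ell2 (F (coef x))) \<rhd> x) n = F (coef x) n"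
    and "norm (endo_of (\<lambda>x. Abs_ell2 (F (coef x)))) \<le> B"
proof -
  let ?f = "\<lambda>x. Abs_ell2 (F (coef x))"
  have c: "coef (?f x) n = F (coef x) n" for x n
    using sq by (simp add: Abs_ell2_inverse)
  have nrm: "norm (?f x) \<le> B * norm x" for x
  proof -
    have "(norm (?f x))\<^sup>2 \<le> (B * norm x)\<^sup>2"
      using le[of x] by (simp add: norm_ell2_sq c)
    then show ?thesis by (rule power2_le_imp_le) (use \<open>0 \<le> B\<close> in simp)
  qed
  have bl: "bounded_linear ?f"
  proof (rule bounded_linear_intro[of _ B])
    show "?f (x + y) = ?f x + ?f y" for x y
    proof (rule ell2_eqI)
      fix n
      have "F (coef (x + y)) n = F (\<lambda>n. coef x n + coef y n) n"
        by (rule arg_cong[where f = "\<lambda>a. F a n"]) (simp add: fun_eq_iff)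
      then show "coef (?f (x + y)) n = coef (?f x + ?f y) n" by (simp add: c add)
    qed
    show "?f (r *\<^sub>R x) = r *\<^sub>R ?f x" for r x
    proof (rule ell2_eqI)
      fix n
      have "F (coef (r *\<^sub>R x)) n = F (\<lambda>n. r *\<^sub>R coef x n) n"
        by (rule arg_cong[where f = "\<lambda>a. F a n"]) (simp add: fun_eq_iff)
      then show "coef (?f (r *\<^sub>R x)) n = coef (r *\<^sub>R ?f x) n" by (simp add: c scale)
    qed
    show "norm (?f x) \<le> norm x * B" for x using nrm by (simp add: mult.commute)
  qed
  show "coef (endo_of ?f \<rhd> x) n = F (coef x) n"
    by (simp add: app_endo_of[OF bl] c)
  show "norm (endo_of ?f) \<le> B"
    by (rule norm_endo_le) (simp_all add: app_endo_of[OF bl] nrm \<open>0 \<le> B\<close>)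
qed

definition diag :: "(nat \<Rightarrow> complex) \<Rightarrow> ell2 endo" where
  "diag d = endo_of (\<lambda>x. Abs_ell2 (\<lambda>n. d n * coef x n))"

definition shift :: "ell2 endo" where
  "shift = endo_of (\<lambda>x. Abs_ell2 (\<lambda>n. if n = 0 then 0 else coef x (n - 1)))"

definition bshift :: "ell2 endo" where
  "bshift = endo_of (\<lambda>x. Abs_ell2 (\<lambda>n. coef x (Suc n)))"

lemma
  assumes d: "\<And>n. cmod (d n) \<le> B"
  shows coef_diag: "coef (diag d \<rhd> x) n = d n * coef x n"
    and norm_diag: "norm (diag d) \<le> B"
proof -
  have B: "0 \<le> B" using d[of 0] norm_ge_zero order_trans by blast
  have le: "(cmod (d n * coef x n))\<^sup>2 \<le> B\<^sup>2 * (cmod (coef x n))\<^sup>2" for x n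
    unfolding norm_mult power_mult_distrib by (intro mult_right_mono power_mono d) auto
  have sq: "summable (\<lambda>n. (cmod (d n * coef x n))\<^sup>2)" for x
    by (rule summable_comparison_test'[OF summable_mult[OF summable_coef]]) (use le in simp)
  have "(\<Sum>n. (cmod (d n * coef x n))\<^sup>2) \<le> (B * norm x)\<^sup>2" for x
  proof -
    have "(\<Sum>n. (cmod (d n * coef x n))\<^sup>2) \<le> (\<Sum>n. B\<^sup>2 * (cmod (coef x n))\<^sup>2)"
      by (intro suminf_le le sq summable_mult summable_coef)
    also have "\<dots> = B\<^sup>2 * (norm x)\<^sup>2"
      by (simp add: norm_ell2_sq suminf_mult summable_coef)
    finally show ?thesis by (simp add: power_mult_distrib)
  qed
  note * = endo_of_coef[of "\<lambda>a n. d n * a n", OF sq this _ _ B]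
  show "coef (diag d \<rhd> x) n = d n * coef x n"
    unfolding diag_def by (rule *) (simp_all add: algebra_simps)
  show "norm (diag d) \<le> B"
    unfolding diag_def by (rule *) (simp_all add: algebra_simps)
qed

lemma coef_shift: "coef (shift \<rhd> x) n = (if n = 0 then 0 else coef x (n - 1))"
  and norm_shift: "norm shift \<le> 1"
proof -
  let ?F = "\<lambda>a n. if n = 0 then 0 else a (n - 1) :: complex"
  have s: "(\<lambda>n. (cmod (?F (coef x) n))\<^sup>2) sums (1 * norm x)\<^sup>2" for x
    by (rule sums_Suc_imp) (use norm_ell2_sums[of x] in auto)
  note * = endo_of_coef[of ?F 1, OF sums_summable[OF s]]
  show "coef (shift \<rhd> x) n = (if n = 0 then 0 else coef x (n - 1))"
    unfolding shift_def by (rule *) (use sums_unique[OF s] in auto)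
  show "norm shift \<le> 1"
    unfolding shift_def by (rule *) (use sums_unique[OF s] in auto)
qed

lemma coef_bshift: "coef (bshift \<rhd> x) n = coef x (Suc n)"
  and norm_bshift: "norm bshift \<le> 1"
proof -
  let ?F = "\<lambda>a n. a (Suc n) :: complex"
  have s: "(\<lambda>n. (cmod (?F (coef x) n))\<^sup>2) sums ((norm x)\<^sup>2 - (cmod (coef x 0))\<^sup>2)" for x
    using norm_ell2_sums[of x] by (subst sums_Suc_iff) simp
  have le: "(\<Sum>n. (cmod (?F (coef x) n))\<^sup>2) \<le> (1 * norm x)\<^sup>2" for x
    unfolding sums_unique[OF s[of x], symmetric] by simp
  note * = endo_of_coef[of ?F 1, OF sums_summable[OF s] le]
  show "coef (bshift \<rhd> x) n = coef x (Suc n)"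
    unfolding bshift_def by (rule *) auto
  show "norm bshift \<le> 1"
    unfolding bshift_def by (rule *) auto
qed

lemma coef_shift_power: "coef ((shift ^ k) \<rhd> x) n = (if n < k then 0 else coef x (n - k))"
  by (induction k arbitrary: n) (auto simp: coef_shift)

lemma coef_bshift_power: "coef ((bshift ^ k) \<rhd> x) n = coef x (n + k)"
  by (induction k arbitrary: n) (auto simp: coef_bshift)

lemma norm_power_le_one:
  fixes X :: "'a::real_normed_algebra_1"
  assumes "norm X \<le> 1" shows "norm (X ^ n) \<le> 1"
  using norm_power_ineq[of X n] power_le_one[of "norm X" n] assms by simp

lemma adj_shift: "adj shift bshift"
  unfolding adj_def
proof (intro allI)
  fix x y
  have "(\<lambda>n. inner (coef (shift \<rhd> x) n) (coef y n)) sums inner x (bshift \<rhd> y)"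
    by (rule sums_Suc_imp) (use inner_sums[of x "bshift \<rhd> y"] in \<open>simp_all add: coef_shift coef_bshift\<close>)
  from sums_unique2[OF inner_sums this] show "inner (shift \<rhd> x) y = inner x (bshift \<rhd> y)" .
qed

lemma bshift_shift: "bshift * shift = 1"
  by (intro endo_eqI ell2_eqI) (simp add: coef_bshift coef_shift)

lemma adj_diag:
  assumes "\<And>n. cmod (d n) \<le> B"
  shows "adj (diag d) (diag (\<lambda>n. cnj (d n)))"
proof -
  have "inner (d n * z) w = inner z (cnj (d n) * w)" for n z w
    by (simp add: inner_complex_def algebra_simps)
  then show ?thesis
    unfolding adj_def inner_ell2_eq by (simp add: coef_diag[of _ B] assms)
qed

text \<open>Operators are only real linear a priori. Multiplication by z is itself an operator, and
  complex linearity of X is the identity \<open>cop z * X = X * cop z\<close>; \<open>jop\<close>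
  plays the part of i in the operator algebra.\<close>

definition cop :: "complex \<Rightarrow> ell2 endo" where
  "cop z = diag (\<lambda>_. z)"

abbreviation "jop \<equiv> cop \<i>"

lemma coef_cop: "coef (cop z \<rhd> x) n = z * coef x n"
  unfolding cop_def by (rule coef_diag[of _ "cmod z"]) simp

lemma norm_cop_le: "norm (cop z) \<le> cmod z"
  unfolding cop_def by (rule norm_diag) simp

lemma norm_cop_app: "norm (cop z \<rhd> x) = cmod z * norm x"
proof -
  have "(norm (cop z \<rhd> x))\<^sup>2 = (cmod z * norm x)\<^sup>2"
    by (simp add: norm_ell2_sq coef_cop norm_mult power_mult_distrib suminf_mult summable_coef)
  then show ?thesis by simp
qed

lemma adj_cop: "adj (cop z) (cop (cnj z))"
  unfolding cop_def by (rule adj_diag[of _ "cmod z"]) simp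

lemma adj_jop: "adj jop (- jop)"
proof -
  have "cop (cnj \<i>) = - jop"
    by (intro endo_eqI ell2_eqI) (simp add: coef_cop app_simps)
  then show ?thesis using adj_cop[of \<i>] by simp
qed

lemma bounded_linear_cop: "bounded_linear cop"
proof (rule bounded_linear_intro[of _ 1])
  show "cop (x + y) = cop x + cop y" for x y
    by (intro endo_eqI ell2_eqI) (simp add: coef_cop app_simps algebra_simps)
  show "cop (r *\<^sub>R x) = r *\<^sub>R cop x" for r x
    by (intro endo_eqI ell2_eqI) (simp add: coef_cop app_simps)
qed (simp add: norm_cop_le)

lemma cop_one: "cop 1 = 1"
  by (intro endo_eqI ell2_eqI) (simp add: coef_cop)

lemma cop_mult: "cop (z * w) = cop z * cop w"
  by (intro endo_eqI ell2_eqI) (simp add: coef_cop)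

lemma jop_jop: "jop * jop = - 1"
  by (intro endo_eqI ell2_eqI) (simp add: coef_cop app_simps)

lemma cop_of_real: "cop (of_real c) = c *\<^sub>R 1"
  by (intro endo_eqI ell2_eqI) (simp add: coef_cop app.scaleR_left, simp add: scaleR_conv_of_real)

lemma cop_commute_bshift: "cop z * bshift = bshift * cop z"
  by (intro endo_eqI ell2_eqI) (simp add: coef_cop coef_bshift)

text \<open>Turns the summand 1 in 2 L + 1 into the scalar factor e^{-i tau} when the limit of the
  compressed operators is taken.\<close>

lemma cop_exp: "cop (exp z) = exp (cop z)"
proof -
  have p: "cop (z ^ n) = cop z ^ n" for n
    by (induction n) (simp_all add: cop_one cop_mult)
  have "(\<lambda>n. cop (z ^ n /\<^sub>R fact n)) sums cop (exp z)"
    by (intro bounded_linear.sums[OF bounded_linear_cop] exp_converges)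
  then have "(\<lambda>n. cop z ^ n /\<^sub>R fact n) sums cop (exp z)"
    by (simp only: linear_scale[OF bounded_linear.linear[OF bounded_linear_cop]] p)
  then show ?thesis using exp_converges sums_unique2 by blast
qed

section \<open>Compression to the modes 0, ..., N\<close>

definition trunc :: "nat \<Rightarrow> ell2 endo" where
  "trunc N = diag (\<lambda>n. if n \<le> N then 1 else 0)"

text \<open>The cut makes D bounded, with norm at most N, so that every generator lies in the Banach
  algebra and has a norm-convergent exponential.\<close>

definition dop :: "nat \<Rightarrow> ell2 endo" where
  "dop N = diag (\<lambda>n. if n \<le> N then of_nat n else 0)"

lemma coef_trunc: "coef (trunc N \<rhd> x) n = (if n \<le> N then coef x n else 0)"
  unfolding trunc_def by (subst coef_diag[of _ 1]) auto

lemma norm_trunc: "norm (trunc N) \<le> 1"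
  unfolding trunc_def by (rule norm_diag) auto

lemma coef_dop: "coef (dop N \<rhd> x) n = (if n \<le> N then of_nat n * coef x n else 0)"
  unfolding dop_def by (subst coef_diag[of _ "real N"]) auto

lemma adj_trunc: "adj (trunc N) (trunc N)"
proof -
  have "(\<lambda>n. cnj (if n \<le> N then 1 else 0)) = (\<lambda>n. if n \<le> N then 1 else 0)" by auto
  with adj_diag[of "\<lambda>n. if n \<le> N then 1 else 0" 1] show ?thesis
    by (simp add: trunc_def)
qed

lemma adj_dop: "adj (dop N) (dop N)"
proof -
  have "(\<lambda>n. cnj (if n \<le> N then of_nat n else 0)) = (\<lambda>n. if n \<le> N then of_nat n else 0)" by auto
  with adj_diag[of "\<lambda>n. if n \<le> N then of_nat n else 0" "real N"] show ?thesis
    by (simp add: dop_def)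
qed

lemma cop_commute_trunc: "cop z * trunc N = trunc N * cop z"
  by (intro endo_eqI ell2_eqI) (simp add: coef_cop coef_trunc)

lemma cop_commute_dop: "cop z * dop N = dop N * cop z"
  by (intro endo_eqI ell2_eqI) (simp add: coef_cop coef_dop)

lemma trunc_trunc: "trunc N * trunc N = trunc N"
  by (intro endo_eqI ell2_eqI) (simp add: coef_trunc)

lemma trunc_dop: "trunc N * dop N = dop N"
  by (intro endo_eqI ell2_eqI) (simp add: coef_trunc coef_dop)

lemma dop_trunc: "dop N * trunc N = dop N"
  by (intro endo_eqI ell2_eqI) (simp add: coef_trunc coef_dop)

lemma norm_trunc_app: "norm (trunc N \<rhd> x) \<le> norm x"
  by (rule norm_ell2_le) (simp add: coef_trunc)

lemma trunc_tendsto: "(\<lambda>N. trunc N \<rhd> x) \<longlonglongrightarrow> x"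
proof (rule LIMSEQ_I)
  fix r :: real assume r: "0 < r"
  have "(\<lambda>N. \<Sum>n<N. (cmod (coef x n))\<^sup>2) \<longlonglongrightarrow> (norm x)\<^sup>2"
    using norm_ell2_sums by (simp add: sums_def)
  from LIMSEQ_D[OF this, of "r\<^sup>2"] r obtain N0 where
    N0: "\<And>N. N \<ge> N0 \<Longrightarrow> \<bar>(\<Sum>n<N. (cmod (coef x n))\<^sup>2) - (norm x)\<^sup>2\<bar> < r\<^sup>2" by auto
  have "norm (trunc N \<rhd> x - x) < r" if "N \<ge> N0" for N
  proof -
    have "(norm (trunc N \<rhd> x - x))\<^sup>2 = (norm x)\<^sup>2 - (\<Sum>n<Suc N. (cmod (coef x n))\<^sup>2)"
    proof -
      have "(\<lambda>n. (cmod (coef x n))\<^sup>2 - (if n \<in> {..<Suc N} then (cmod (coef x n))\<^sup>2 else 0))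
          sums ((norm x)\<^sup>2 - (\<Sum>n<Suc N. (cmod (coef x n))\<^sup>2))"
        by (intro sums_diff norm_ell2_sums sums_If_finite_set) simp
      also have "(\<lambda>n. (cmod (coef x n))\<^sup>2 - (if n \<in> {..<Suc N} then (cmod (coef x n))\<^sup>2 else 0))
          = (\<lambda>n. (cmod (coef (trunc N \<rhd> x - x) n))\<^sup>2)"
        by (auto simp: coef_trunc)
      finally show ?thesis using norm_ell2_sums sums_unique2 by blast
    qed
    also have "\<dots> < r\<^sup>2" using N0[of "Suc N"] that by linarith
    finally show ?thesis using r by (simp add: power2_less_imp_less)
  qed
  then show "\<exists>N0. \<forall>N\<ge>N0. norm (trunc N \<rhd> x - x) < r" by blast
qed

section \<open>Toeplitz operators with analytic symbols and their adjoints\<close>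

definition toep :: "(nat \<Rightarrow> complex) \<Rightarrow> ell2 endo" where
  "toep v = (\<Sum>k. cop (v k) * shift ^ k)"

definition toep_adj :: "(nat \<Rightarrow> complex) \<Rightarrow> ell2 endo" where
  "toep_adj v = (\<Sum>k. cop (cnj (v k)) * bshift ^ k)"

definition ttoep :: "nat \<Rightarrow> (nat \<Rightarrow> complex) \<Rightarrow> ell2 endo" where
  "ttoep N v = trunc N * (\<Sum>k\<le>N. cop (v k) * shift ^ k)"

definition ttoep_adj :: "nat \<Rightarrow> (nat \<Rightarrow> complex) \<Rightarrow> ell2 endo" where
  "ttoep_adj N v = (\<Sum>k\<le>N. cop (cnj (v k)) * bshift ^ k) * trunc N"

lemma norm_cop_power_le:
  assumes "norm X \<le> 1" shows "norm (cop z * X ^ k) \<le> cmod z"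
proof -
  have "norm (cop z * X ^ k) \<le> norm (cop z) * norm (X ^ k)" by (rule norm_mult_ineq)
  also have "\<dots> \<le> cmod z * 1"
    by (intro mult_mono norm_cop_le norm_power_le_one assms) auto
  finally show ?thesis by simp
qed

context
  fixes v :: "nat \<Rightarrow> complex"
  assumes v: "summable (\<lambda>k. cmod (v k))"
begin

lemma summable_toep: "summable (\<lambda>k. cop (v k) * shift ^ k)"
  by (rule summable_comparison_test'[OF v norm_cop_power_le[OF norm_shift]])

lemma summable_toep_adj: "summable (\<lambda>k. cop (cnj (v k)) * bshift ^ k)"
proof (rule summable_comparison_test'[OF v])
  show "norm (cop (cnj (v k)) * bshift ^ k) \<le> cmod (v k)" for k
    using norm_cop_power_le[OF norm_bshift, of "cnj (v k)" k] by simp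
qed

lemma norm_toep: "norm (toep v) \<le> (\<Sum>k. cmod (v k))"
proof -
  have s: "summable (\<lambda>k. norm (cop (v k) * shift ^ k))"
    by (rule summable_comparison_test'[OF v]) (simp add: norm_cop_power_le[OF norm_shift])
  show ?thesis unfolding toep_def
    by (rule order_trans[OF summable_norm[OF s] suminf_le[OF norm_cop_power_le[OF norm_shift] s v]])
qed

lemma adj_toep: "adj (toep v) (toep_adj v)"
  unfolding toep_def toep_adj_def
proof (rule adj_suminf[OF _ summable_toep summable_toep_adj])
  fix k
  have "bshift ^ k * cop (cnj (v k)) = cop (cnj (v k)) * bshift ^ k"
    using power_commuting_commutes[OF cop_commute_bshift[symmetric]] by simp
  with adj_mult[OF adj_cop[of "v k"] adj_power[OF adj_shift, of k]]
  show "adj (cop (v k) * shift ^ k) (cop (cnj (v k)) * bshift ^ k)" by simp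
qed

lemma coef_toep: "coef (toep v \<rhd> x) n = (\<Sum>k\<le>n. v k * coef x (n - k))"
proof -
  have "(\<lambda>k. coef ((cop (v k) * shift ^ k) \<rhd> x) n) sums coef (toep v \<rhd> x) n"
    unfolding toep_def
    by (intro bounded_linear.sums[OF bounded_linear_coef]
        bounded_linear.sums[OF app.bounded_linear_left] summable_sums summable_toep)
  moreover have "(\<lambda>k. coef ((cop (v k) * shift ^ k) \<rhd> x) n) sums
      (\<Sum>k\<le>n. coef ((cop (v k) * shift ^ k) \<rhd> x) n)"
    by (rule sums_finite) (auto simp: coef_cop coef_shift_power)
  ultimately show ?thesis
    using sums_unique2 by (fastforce simp: coef_cop coef_shift_power)
qed

lemma coef_toep_adj: "(\<lambda>k. cnj (v k) * coef x (n + k)) sums coef (toep_adj v \<rhd> x) n"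
proof -
  have "(\<lambda>k. coef ((cop (cnj (v k)) * bshift ^ k) \<rhd> x) n) sums coef (toep_adj v \<rhd> x) n"
    unfolding toep_adj_def
    by (intro bounded_linear.sums[OF bounded_linear_coef]
        bounded_linear.sums[OF app.bounded_linear_left] summable_sums summable_toep_adj)
  then show ?thesis by (simp add: coef_cop coef_bshift_power)
qed

lemma toep_commute_shift: "toep v * shift = shift * toep v"
  by (intro endo_eqI ell2_eqI)
    (auto simp: coef_toep coef_shift intro!: sum.mono_neutral_cong_right split: if_splits)

lemma cop_commute_toep: "cop c * toep v = toep v * cop c"
  by (intro endo_eqI ell2_eqI) (simp add: coef_toep coef_cop sum_distrib_left mult_ac)

lemma cop_commute_toep_adj: "cop c * toep_adj v = toep_adj v * cop c"
  using adj_mult[OF adj_toep adj_cop[of "cnj c"]] adj_mult[OF adj_cop[of "cnj c"] adj_toep]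
    cop_commute_toep[of "cnj c"] adj_unique by (metis complex_cnj_cnj)

end

lemma norm_adj:
  assumes "adj X Y" shows "norm Y = norm X"
proof -
  have *: "norm Y \<le> norm X" if a: "adj X Y" for X Y :: "'a endo"
  proof (rule norm_endo_le)
    fix y
    have "(norm (Y \<rhd> y))\<^sup>2 = inner (X \<rhd> Y \<rhd> y) y"
      by (simp add: power2_norm_eq_inner adjD[OF a])
    also have "\<dots> \<le> norm (X \<rhd> Y \<rhd> y) * norm y" by (rule norm_cauchy_schwarz)
    also have "\<dots> \<le> (norm X * norm (Y \<rhd> y)) * norm y" by (intro mult_right_mono norm_app) simp
    finally have "norm (Y \<rhd> y) * norm (Y \<rhd> y) \<le> norm (Y \<rhd> y) * (norm X * norm y)"
      by (simp add: power2_eq_square mult_ac)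
    then show "norm (Y \<rhd> y) \<le> norm X * norm y"
      by (cases "norm (Y \<rhd> y) = 0") (auto simp: mult_le_cancel_left)
  qed simp
  show ?thesis using *[OF assms] *[OF adj_sym[OF assms]] by simp
qed

lemma coef_sum: "coef (\<Sum>i\<in>I. x i) n = (\<Sum>i\<in>I. coef (x i) n)"
  by (induction I rule: infinite_finite_induct) simp_all

lemma coef_ttoep:
  "coef (ttoep N v \<rhd> x) n = (if n \<le> N then \<Sum>k\<le>n. v k * coef x (n - k) else 0)"
  by (auto simp: ttoep_def coef_trunc app.sum_left coef_sum coef_cop coef_shift_power
      intro!: sum.mono_neutral_cong_right split: if_splits)

lemma adj_ttoep: "adj (ttoep N v) (ttoep_adj N v)"
  unfolding ttoep_def ttoep_adj_def
proof (rule adj_mult[OF adj_trunc], rule adj_sum)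
  fix k assume "k \<in> {..N}"
  have "bshift ^ k * cop (cnj (v k)) = cop (cnj (v k)) * bshift ^ k"
    using power_commuting_commutes[OF cop_commute_bshift[symmetric]] by simp
  with adj_mult[OF adj_cop[of "v k"] adj_power[OF adj_shift, of k]]
  show "adj (cop (v k) * shift ^ k) (cop (cnj (v k)) * bshift ^ k)" by simp
qed

lemma norm_ttoep: "norm (ttoep N v) \<le> (\<Sum>k\<le>N. cmod (v k))"
proof -
  have "norm (ttoep N v) \<le> norm (trunc N) * norm (\<Sum>k\<le>N. cop (v k) * shift ^ k)"
    unfolding ttoep_def by (rule norm_mult_ineq)
  also have "\<dots> \<le> 1 * (\<Sum>k\<le>N. cmod (v k))"
    by (intro mult_mono norm_trunc sum_norm_le norm_cop_power_le[OF norm_shift]) auto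
  finally show ?thesis by simp
qed

lemma ttoep_eq: "summable (\<lambda>k. cmod (v k)) \<Longrightarrow> ttoep N v = trunc N * toep v"
  by (intro endo_eqI ell2_eqI) (simp add: coef_ttoep coef_trunc coef_toep)

lemma ttoep_adj_eq: "summable (\<lambda>k. cmod (v k)) \<Longrightarrow> ttoep_adj N v = toep_adj v * trunc N"
  using adj_unique[OF adj_ttoep] adj_mult[OF adj_trunc adj_toep] ttoep_eq by metis

text \<open>An analytic symbol only raises modes, so modes above N never return below. For the
  adjoint this says that T_{u bar} leaves the polynomials of degree at most N invariant.\<close>

lemma ttoep_trunc: "ttoep N v * trunc N = ttoep N v"
  by (intro endo_eqI ell2_eqI) (auto simp: coef_ttoep coef_trunc intro!: sum.cong)

lemma trunc_ttoep: "trunc N * ttoep N v = ttoep N v"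
  by (intro endo_eqI ell2_eqI) (auto simp: coef_ttoep coef_trunc)

lemma ttoep_add: "ttoep N (\<lambda>k. v k + w k) = ttoep N v + ttoep N w"
  by (intro endo_eqI ell2_eqI) (simp add: coef_ttoep app_simps algebra_simps sum.distrib)

lemma ttoep_scale: "ttoep N (\<lambda>k. c * v k) = cop c * ttoep N v"
  by (intro endo_eqI ell2_eqI) (simp add: coef_ttoep coef_cop sum_distrib_left mult.assoc)

lemma cop_commute_ttoep: "cop c * ttoep N v = ttoep N v * cop c"
  by (intro endo_eqI ell2_eqI) (simp add: coef_ttoep coef_cop sum_distrib_left mult_ac)

text \<open>Compressions of lower triangular operators multiply without error. In coordinates this
  is associativity of the Cauchy product, imported from formal power series.\<close>

lemma ttoep_conv: "ttoep N (\<lambda>n. \<Sum>k\<le>n. v k * w (n - k)) = ttoep N v * ttoep N w"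
proof (intro endo_eqI ell2_eqI)
  fix x n
  show "coef (ttoep N (\<lambda>n. \<Sum>k\<le>n. v k * w (n - k)) \<rhd> x) n = coef ((ttoep N v * ttoep N w) \<rhd> x) n"
  proof (cases "n \<le> N")
    case True
    have "(Abs_fps v * Abs_fps w) * Abs_fps (coef x) = Abs_fps v * (Abs_fps w * Abs_fps (coef x))"
      by (simp only: mult.assoc)
    then have "fps_nth ((Abs_fps v * Abs_fps w) * Abs_fps (coef x)) n
        = fps_nth (Abs_fps v * (Abs_fps w * Abs_fps (coef x))) n" by (rule arg_cong)
    with True show ?thesis
      by (auto simp: coef_ttoep fps_mult_nth atLeast0AtMost intro!: sum.cong)
  qed (simp add: coef_ttoep)
qed

text \<open>Leibniz rule, from n = (n - k) + k in each term of the convolution; it survives the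
  compression exactly.\<close>

lemma dop_ttoep: "dop N * ttoep N v = ttoep N v * dop N + ttoep N (\<lambda>k. of_nat k * v k)"
proof (intro endo_eqI ell2_eqI)
  fix x n
  have "of_nat n * (v k * coef x (n - k)) =
      v k * (of_nat (n - k) * coef x (n - k)) + of_nat k * v k * coef x (n - k)" if "k \<le> n" for k
    using that by (simp add: of_nat_diff algebra_simps)
  then show "coef ((dop N * ttoep N v) \<rhd> x) n
      = coef ((ttoep N v * dop N + ttoep N (\<lambda>k. of_nat k * v k)) \<rhd> x) n"
    by (auto simp: coef_ttoep coef_dop app_simps sum_distrib_left sum.distrib[symmetric]
      intro!: sum.cong)
qed

lemma ttoep_adj_dop:
  "ttoep_adj N v * dop N = dop N * ttoep_adj N v + ttoep_adj N (\<lambda>k. of_nat k * v k)"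
  by (rule adj_unique[OF adj_mult[OF adj_dop adj_ttoep]])
    (unfold dop_ttoep, intro adj_add adj_mult adj_dop adj_ttoep)

section \<open>The compressed backward shift\<close>

definition tbshift :: "nat \<Rightarrow> ell2 endo" where
  "tbshift N = bshift * trunc N"

lemma coef_tbshift: "coef (tbshift N \<rhd> x) n = (if n < N then coef x (Suc n) else 0)"
  by (simp add: tbshift_def coef_bshift coef_trunc Suc_le_eq)

lemma coef_trunc_shift: "coef (trunc N \<rhd> shift \<rhd> x) n = (if 0 < n \<and> n \<le> N then coef x (n - 1) else 0)"
  by (simp add: coef_shift coef_trunc)

lemma adj_tbshift: "adj (tbshift N) (trunc N * shift)"
  unfolding tbshift_def by (intro adj_mult adj_trunc adj_sym[OF adj_shift])

lemma norm_tbshift: "norm (tbshift N) \<le> 1"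
  unfolding tbshift_def using norm_mult_ineq[of bshift "trunc N"]
  by (rule order_trans) (intro mult_le_one norm_bshift norm_trunc norm_ge_zero)

text \<open>The extra summand is the origin of the 1 in 2 L + 1, and so of the factor e^{-it} in the
  formula.\<close>

lemma tbshift_dop: "tbshift N * dop N = dop N * tbshift N + tbshift N"
  by (intro endo_eqI ell2_eqI) (simp add: coef_tbshift coef_dop app_simps algebra_simps)

lemma cop_commute_tbshift: "cop z * tbshift N = tbshift N * cop z"
  by (intro endo_eqI ell2_eqI) (simp add: coef_cop coef_tbshift)

text \<open>Proved for the adjoints, which are both convolutions cut at N, and then
  transposed.\<close>

lemma ttoep_adj_tbshift: "ttoep_adj N v * tbshift N = tbshift N * ttoep_adj N v"
proof -
  have "ttoep N v * (trunc N * shift) = (trunc N * shift) * ttoep N v"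
  proof (intro endo_eqI ell2_eqI)
    fix x n
    have "(\<Sum>k\<le>n. v k * (if 0 < n - k \<and> n - k \<le> N then coef x (n - k - 1) else 0))
        = (\<Sum>k\<le>n - 1. v k * coef x (n - 1 - k))" if "0 < n" "n \<le> N"
      using that by (intro sum.mono_neutral_cong_right) (auto simp: not_le not_less intro!: arg_cong[where f = "coef x"])
    then show "coef ((ttoep N v * (trunc N * shift)) \<rhd> x) n = coef ((trunc N * shift * ttoep N v) \<rhd> x) n"
      by (auto simp: coef_ttoep coef_trunc_shift)
  qed
  with adj_mult[OF adj_sym[OF adj_tbshift] adj_ttoep] adj_mult[OF adj_ttoep adj_sym[OF adj_tbshift]]
  show ?thesis using adj_unique by metis
qed

text \<open>Without compression, S* T_v f - T_v S* f equals f_0 times S* v, and f_0 = 0 for f in the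
  range of D. What remains is the top mode N, which \<open>tbshift N\<close> sets to 0 while the
  product in the other order does not.\<close>

lemma tbshift_ttoep_dop:
  "coef ((tbshift N * ttoep N v * dop N - ttoep N v * tbshift N * dop N) \<rhd> x) n =
     (if n = N then - coef ((ttoep N v * tbshift N * dop N) \<rhd> x) N else 0)"
proof -
  let ?y = "dop N \<rhd> x"
  have y: "coef ?y 0 = 0" by (simp add: coef_dop)
  have "(\<Sum>k\<le>Suc n. v k * coef ?y (Suc n - k)) = (\<Sum>k\<le>n. v k * (if n - k < N then coef ?y (Suc (n - k)) else 0))"
    if "n < N"
    using that by (auto simp: y Suc_diff_le intro!: sum.cong)
  then show ?thesis
    by (auto simp: app_simps coef_tbshift coef_ttoep)
qed

section \<open>The truncated Lax pair\<close>

definition lax :: "nat \<Rightarrow> (nat \<Rightarrow> complex) \<Rightarrow> ell2 endo" where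
  "lax N v = dop N - ttoep N v * ttoep_adj N v"

text \<open>This is - i (2 L + 1). Doubling is written as a sum, which the distributive laws treat
  like any other term.\<close>

definition gen :: "nat \<Rightarrow> (nat \<Rightarrow> complex) \<Rightarrow> ell2 endo" where
  "gen N v = - (jop * (lax N v + lax N v + 1))"

text \<open>With d_x = i D, the operator B becomes i (2 T_u D T_{u bar} - D^2).\<close>

definition bop :: "nat \<Rightarrow> (nat \<Rightarrow> complex) \<Rightarrow> ell2 endo" where
  "bop N v = jop * (ttoep N v * dop N * ttoep_adj N v + ttoep N v * dop N * ttoep_adj N v - dop N * dop N)"

definition autocorr :: "(nat \<Rightarrow> complex) \<Rightarrow> nat \<Rightarrow> complex" where
  "autocorr v i = (\<Sum>k. cnj (v k) * v (k + i))"

text \<open>If \<open>v\<close> is the sequence of Fourier coefficients of \<open>u\<close>, then \<open>autocorr v\<close> is that of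
  \<open>\<Pi>(|u|\<^sup>2)\<close>, and the equation says that \<open>cs_field v\<close> is that of \<open>\<partial>\<^sub>t u\<close>.\<close>

definition cs_field :: "(nat \<Rightarrow> complex) \<Rightarrow> nat \<Rightarrow> complex" where
  "cs_field v n = - \<i> * (of_nat n * (of_nat n * v n))
     + 2 * \<i> * (\<Sum>j\<le>n. v j * (of_nat (n - j) * autocorr v (n - j)))"

text \<open>Controls the absolute sums of the Fourier coefficients of u and of its derivative by one
  constant M, hence the norms of both Toeplitz operators.\<close>

definition wbound :: "real \<Rightarrow> (nat \<Rightarrow> complex) \<Rightarrow> bool" where
  "wbound M v \<longleftrightarrow> summable (\<lambda>k. (1 + real k) * cmod (v k)) \<and> (\<Sum>k. (1 + real k) * cmod (v k)) \<le> M"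

lemma wbound_summable:
  assumes "wbound M v"
  shows "summable (\<lambda>k. cmod (v k))" "summable (\<lambda>k. cmod (of_nat k * v k))"
    "(\<Sum>k. cmod (v k)) \<le> M" "(\<Sum>k. cmod (of_nat k * v k)) \<le> M" "0 \<le> M"
    "(\<Sum>k\<le>N. cmod (v k)) \<le> M"
proof -
  have s: "summable (\<lambda>k. (1 + real k) * cmod (v k))" and le: "(\<Sum>k. (1 + real k) * cmod (v k)) \<le> M"
    using assms by (auto simp: wbound_def)
  have 1: "cmod (v k) \<le> (1 + real k) * cmod (v k)" for k
    by (simp add: algebra_simps)
  have 2: "cmod (of_nat k * v k) \<le> (1 + real k) * cmod (v k)" for k
    by (simp add: norm_mult algebra_simps)
  show s1: "summable (\<lambda>k. cmod (v k))"
    by (rule summable_comparison_test'[OF s]) (use 1 in simp)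
  show s2: "summable (\<lambda>k. cmod (of_nat k * v k))"
    by (rule summable_comparison_test'[OF s]) (use 2 in simp)
  show *: "(\<Sum>k. cmod (v k)) \<le> M" using suminf_le[OF 1 s1 s] le by simp
  show "(\<Sum>k. cmod (of_nat k * v k)) \<le> M" using suminf_le[OF 2 s2 s] le by simp
  show "0 \<le> M" using suminf_nonneg[OF s1] * by simp
  have "(\<Sum>k\<le>N. cmod (v k)) \<le> (\<Sum>k. cmod (v k))"
    by (rule sum_le_suminf[OF s1]) auto
  then show "(\<Sum>k\<le>N. cmod (v k)) \<le> M" using * by simp
qed

lemma norm_ttoep_wbound: "wbound M v \<Longrightarrow> norm (ttoep N v) \<le> M"
  using norm_ttoep wbound_summable(6) order_trans by blast

lemma norm_ttoep_deriv_wbound: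
  assumes v: "wbound M v" shows "norm (ttoep N (\<lambda>k. of_nat k * v k)) \<le> M"
proof -
  have "(\<Sum>k\<le>N. cmod (of_nat k * v k)) \<le> (\<Sum>k. cmod (of_nat k * v k))"
    by (rule sum_le_suminf) (auto simp del: norm_mult intro: wbound_summable(2)[OF v])
  then show ?thesis
    using norm_ttoep[of N "\<lambda>k. of_nat k * v k"] wbound_summable(4)[OF v] by linarith
qed

lemma norm_ttoep_adj_wbound: "wbound M v \<Longrightarrow> norm (ttoep_adj N v) \<le> M"
  using norm_adj[OF adj_ttoep] norm_ttoep_wbound by metis

lemma norm_toep_wbound:
  assumes "wbound M v"
  shows "norm (toep v) \<le> M" "norm (toep (\<lambda>k. of_nat k * v k)) \<le> M"
  using norm_toep[OF wbound_summable(1)[OF assms]] norm_toep[OF wbound_summable(2)[OF assms]]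
    wbound_summable(3,4)[OF assms] by linarith+

lemma norm_app_le: "norm X \<le> b \<Longrightarrow> norm (X \<rhd> x) \<le> b * norm x"
  by (rule order_trans[OF norm_app mult_right_mono]) auto

lemma cop_commute_ttoep_adj: "cop c * ttoep_adj N v = ttoep_adj N v * cop c"
proof -
  have "adj (ttoep N v * cop (cnj c)) (cop c * ttoep_adj N v)"
    using adj_mult[OF adj_ttoep adj_cop[of "cnj c"]] by simp
  moreover have "adj (cop (cnj c) * ttoep N v) (ttoep_adj N v * cop c)"
    using adj_mult[OF adj_cop[of "cnj c"] adj_ttoep] by simp
  ultimately show ?thesis using cop_commute_ttoep adj_unique by metis
qed

lemma cop_commute_lax: "cop c * lax N v = lax N v * cop c"
proof -
  have "cop c * (ttoep N v * ttoep_adj N v) = (ttoep N v * ttoep_adj N v) * cop c"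
    by (metis cop_commute_ttoep cop_commute_ttoep_adj mult.assoc)
  then show ?thesis unfolding lax_def by (simp add: algebra_simps cop_commute_dop)
qed

lemma adj_lax: "adj (lax N v) (lax N v)"
  unfolding lax_def by (intro adj_diff adj_dop adj_mult adj_ttoep adj_sym[OF adj_ttoep])

lemma adj_jop_lax: "adj (jop * lax N v) (- (jop * lax N v))"
  using adj_mult[OF adj_jop adj_lax[of N v]] by (simp add: cop_commute_lax)

lemma adj_gen: "adj (gen N v) (- gen N v)"
proof -
  have "adj (- (jop * (lax N v + lax N v + 1))) (- ((lax N v + lax N v + 1) * (- jop)))"
    by (intro adj_minus adj_mult adj_jop adj_add adj_one adj_lax)
  then show ?thesis unfolding gen_def by (simp add: algebra_simps cop_commute_lax)
qed

lemma gen_commute_lax: "gen N v * lax N v = lax N v * gen N v"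
  unfolding gen_def by (simp add: algebra_simps) (metis cop_commute_lax mult.assoc)

lemma adj_bop: "adj (bop N v) (- bop N v)"
proof -
  let ?A = "ttoep N v" and ?A' = "ttoep_adj N v"
  have a: "adj (?A * dop N * ?A') (?A * (dop N * ?A'))"
    by (intro adj_mult adj_dop adj_ttoep adj_sym[OF adj_ttoep])
  have "adj (bop N v) ((?A * (dop N * ?A') + ?A * (dop N * ?A') - dop N * dop N) * (- jop))"
    unfolding bop_def by (intro adj_mult adj_jop adj_add adj_diff adj_dop a)
  moreover have "?A * (dop N * ?A') * jop = jop * (?A * dop N * ?A')"
    by (metis cop_commute_dop cop_commute_ttoep cop_commute_ttoep_adj mult.assoc)
  moreover have "dop N * dop N * jop = jop * (dop N * dop N)"
    by (metis cop_commute_dop mult.assoc)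
  ultimately show ?thesis
    unfolding bop_def by (simp add: left_diff_distrib right_diff_distrib distrib_left distrib_right)
qed

text \<open>T_{u bar} maps constants to constants, and D annihilates them. This is what later
  removes the intertwiner from pairings with the constant function.\<close>

lemma bop_unit_vec: "bop N v \<rhd> unit_vec 0 c = 0"
proof -
  have "dop N \<rhd> ttoep_adj N v \<rhd> unit_vec 0 c = 0"
  proof (rule ell2_eqI)
    fix n
    show "coef (dop N \<rhd> ttoep_adj N v \<rhd> unit_vec 0 c) n = coef 0 n"
      by (cases n) (auto simp: coef_dop ttoep_adj_def app.sum_left coef_sum coef_cop coef_bshift_power
          coef_trunc coef_unit_vec intro!: sum.neutral)
  qed
  moreover have "dop N \<rhd> unit_vec 0 c = 0"
    by (rule ell2_eqI) (auto simp: coef_dop coef_unit_vec)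
  ultimately show ?thesis
    by (simp add: bop_def app_simps app.zero_right)
qed

lemma dop_unit_vec: "dop N \<rhd> unit_vec 0 c = 0"
  by (rule ell2_eqI) (auto simp: coef_dop coef_unit_vec)

subsection \<open>Autocorrelation of a symbol\<close>

lemma coef_toep_unit: "summable (\<lambda>k. cmod (v k)) \<Longrightarrow> coef (toep v \<rhd> unit_vec 0 1) n = v n"
proof -
  have "(\<Sum>k\<le>n. v k * (if n - k = 0 then 1 else 0)) = (\<Sum>k\<in>{n}. v k)"
    by (rule sum.mono_neutral_cong_right) auto
  then show "summable (\<lambda>k. cmod (v k)) \<Longrightarrow> coef (toep v \<rhd> unit_vec 0 1) n = v n"
    by (simp add: coef_toep coef_unit_vec)
qed

lemma autocorr_sums:
  assumes v: "summable (\<lambda>k. cmod (v k))"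
  shows "(\<lambda>k. cnj (v k) * v (k + i)) sums coef (toep_adj v \<rhd> toep v \<rhd> unit_vec 0 1) i"
  using coef_toep_adj[OF v, of "toep v \<rhd> unit_vec 0 1" i] by (simp add: coef_toep_unit v add.commute)

lemma autocorr_eq:
  "summable (\<lambda>k. cmod (v k)) \<Longrightarrow> autocorr v i = coef (toep_adj v \<rhd> toep v \<rhd> unit_vec 0 1) i"
  unfolding autocorr_def by (rule sums_unique[OF autocorr_sums, symmetric])

lemma autocorr_zero_cnj: 
  assumes v: "summable (\<lambda>k. cmod (v k))"
  shows "cnj (autocorr v 0) = autocorr v 0"
proof -
  have "(\<lambda>k. cnj (v k) * v (k + 0)) sums autocorr v 0"
    using autocorr_sums[OF v, of 0] autocorr_eq[OF v, of 0] by simp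
  moreover from bounded_linear.sums[OF bounded_linear_cnj this]
  have "(\<lambda>k. cnj (v k) * v (k + 0)) sums cnj (autocorr v 0)" by (simp add: mult.commute)
  ultimately show ?thesis using sums_unique2 by blast
qed

text \<open>A monotone weight can be shifted from i to k + i, onto the second factor of the
  correlation; exchanging the sums then gives a product. It is used with the weights 1 and k, the
  latter for D applied to the projection of |u|^2.\<close>

lemma sum_cmod_autocorr_le:
  fixes w :: "nat \<Rightarrow> real"
  assumes v: "summable (\<lambda>k. cmod (v k))" and w: "summable (\<lambda>k. w k * cmod (v k))"
    and w0: "\<And>k. 0 \<le> w k" and mono: "\<And>i k. w i \<le> w (k + i)"
  shows "summable (\<lambda>i. w i * cmod (autocorr v i))"
    "(\<Sum>i. w i * cmod (autocorr v i)) \<le> (\<Sum>k. cmod (v k)) * (\<Sum>k. w k * cmod (v k))"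
proof -
  let ?W = "\<Sum>k. w k * cmod (v k)"
  have sk: "summable (\<lambda>k. cmod (v k) * (w (k + i) * cmod (v (k + i))))" for i
  proof (rule summable_comparison_test'[OF summable_mult2[OF v, of ?W]])
    fix k
    have "w (k + i) * cmod (v (k + i)) \<le> ?W"
      using sum_le_suminf[OF w, of "{k + i}"] w0 by auto
    then show "norm (cmod (v k) * (w (k + i) * cmod (v (k + i)))) \<le> cmod (v k) * ?W"
      using w0 by (auto simp: abs_mult intro!: mult_left_mono)
  qed
  have one: "w i * cmod (autocorr v i) \<le> (\<Sum>k. cmod (v k) * (w (k + i) * cmod (v (k + i))))" for i
  proof -
    have le: "w i * cmod (cnj (v k) * v (k + i)) \<le> cmod (v k) * (w (k + i) * cmod (v (k + i)))" for k
    proof -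
      have "w i * (cmod (v k) * cmod (v (k + i))) \<le> w (k + i) * (cmod (v k) * cmod (v (k + i)))"
        by (intro mult_right_mono mono) auto
      then show ?thesis by (simp add: norm_mult mult_ac)
    qed
    have s: "(\<lambda>k. w i *\<^sub>R (cnj (v k) * v (k + i))) sums (w i *\<^sub>R autocorr v i)"
      using autocorr_sums[OF v, of i] autocorr_eq[OF v, of i] by (intro sums_scaleR_right) simp
    have "norm (w i *\<^sub>R autocorr v i) \<le> (\<Sum>k. cmod (v k) * (w (k + i) * cmod (v (k + i))))"
      unfolding sums_unique[OF s]
      by (rule norm_suminf_le[OF _ sk]) (use le w0 in simp)
    then show ?thesis using w0 by simp
  qed
  have part: "(\<Sum>i<m. w i * cmod (autocorr v i)) \<le> (\<Sum>k. cmod (v k)) * ?W" for m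
  proof -
    have "(\<Sum>i<m. w i * cmod (autocorr v i)) \<le> (\<Sum>i<m. \<Sum>k. cmod (v k) * (w (k + i) * cmod (v (k + i))))"
      by (intro sum_mono one)
    also have "\<dots> = (\<Sum>k. \<Sum>i<m. cmod (v k) * (w (k + i) * cmod (v (k + i))))"
      by (rule suminf_sum[symmetric]) (rule sk)
    also have "\<dots> \<le> (\<Sum>k. cmod (v k) * ?W)"
    proof (intro suminf_le summable_sum sk summable_mult2 v)
      fix k
      have "(\<Sum>i<m. w (k + i) * cmod (v (k + i))) = (\<Sum>i\<in>(+) k ` {..<m}. w i * cmod (v i))"
        by (simp add: sum.reindex)
      also have "\<dots> \<le> ?W" by (intro sum_le_suminf w) (auto simp: w0)
      finally show "(\<Sum>i<m. cmod (v k) * (w (k + i) * cmod (v (k + i)))) \<le> cmod (v k) * ?W"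
        by (simp add: sum_distrib_left[symmetric] mult_left_mono)
    qed
    also have "\<dots> = (\<Sum>k. cmod (v k)) * ?W" by (rule suminf_mult2[symmetric, OF v])
    finally show ?thesis .
  qed
  show s: "summable (\<lambda>i. w i * cmod (autocorr v i))"
  proof (rule bounded_imp_summable)
    show "(\<Sum>k\<le>n. w k * cmod (autocorr v k)) \<le> (\<Sum>k. cmod (v k)) * ?W" for n
      using part[of "Suc n"] by (simp only: lessThan_Suc_atMost)
  qed (simp add: w0)
  show "(\<Sum>i. w i * cmod (autocorr v i)) \<le> (\<Sum>k. cmod (v k)) * ?W"
    by (rule suminf_le_const[OF s part])
qed

lemma summable_autocorr: "summable (\<lambda>k. cmod (v k)) \<Longrightarrow> summable (\<lambda>i. cmod (autocorr v i))"
  using sum_cmod_autocorr_le(1)[of v "\<lambda>_. 1"] by simp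

text \<open>Finitely supported vectors are dense. Since Y is only real linear, all complex multiples
  c of the basis vectors are tested.\<close>

lemma endo_eq_zero:
  assumes "\<And>j k c. coef (Y \<rhd> unit_vec k c) j = 0" shows "Y = 0"
proof (rule endo_eqI)
  fix x
  have "trunc N \<rhd> x = (\<Sum>k\<le>N. unit_vec k (coef x k))" for N
    by (rule ell2_eqI) (simp add: coef_trunc coef_sum coef_unit_vec)
  then have "Y \<rhd> trunc N \<rhd> x = 0" for N
    using assms by (auto simp: app.sum_right coef_sum intro!: sum.neutral ell2_eqI)
  moreover have "(\<lambda>N. Y \<rhd> trunc N \<rhd> x) \<longlonglongrightarrow> Y \<rhd> x"
    by (intro bounded_linear.tendsto[OF app.bounded_linear_right] trunc_tendsto)
  ultimately show "Y \<rhd> x = 0 \<rhd> x" by (simp add: app.zero_left LIMSEQ_const_iff)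
qed

text \<open>Both sides are invariant under conjugation by the shift, and they have the same first row
  and column.\<close>

lemma toep_adj_toep:
  assumes v: "summable (\<lambda>k. cmod (v k))"
  shows "toep_adj v * toep v = toep (autocorr v) + toep_adj (autocorr v) - cop (autocorr v 0)"
proof -
  let ?b = "autocorr v"
  have b: "summable (\<lambda>i. cmod (?b i))" by (rule summable_autocorr[OF v])
  define Y where "Y = toep_adj v * toep v - toep ?b - toep_adj ?b + cop (?b 0)"
  have adjY: "adj Y Y"
  proof -
    have "adj Y (toep_adj v * toep v - toep_adj ?b - toep ?b + cop (cnj (?b 0)))"
      unfolding Y_def
      by (intro adj_add adj_diff adj_mult adj_cop adj_toep adj_sym[OF adj_toep] v b)
    then show ?thesis by (simp add: autocorr_zero_cnj[OF v] Y_def algebra_simps)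
  qed
  have bs: "bshift * toep_adj w = toep_adj w * bshift" if "summable (\<lambda>k. cmod (w k))" for w
    using adj_mult[OF adj_toep[OF that] adj_shift] adj_mult[OF adj_shift adj_toep[OF that]]
      toep_commute_shift[OF that] adj_unique by metis
  \<comment> \<open>Analytic Toeplitz operators commute with the shift and their adjoints with
    \<open>bshift\<close>, and then \<open>bshift * shift = 1\<close> applies; so conjugation fixes
    each summand of Y.\<close>
  have "bshift * Y * shift = Y"
  proof -
    have 1: "bshift * (toep_adj v * toep v) * shift = toep_adj v * toep v"
      by (metis bs[OF v] bshift_shift mult.assoc mult_1 mult_1_right toep_commute_shift[OF v])
    have 2: "bshift * toep ?b * shift = toep ?b"
      by (metis bshift_shift mult.assoc mult_1 toep_commute_shift[OF b])
    have 3: "bshift * toep_adj ?b * shift = toep_adj ?b"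
      by (metis bshift_shift bs[OF b] mult.assoc mult_1_right)
    have 4: "bshift * cop (?b 0) * shift = cop (?b 0)"
      by (metis bshift_shift cop_commute_bshift mult.assoc mult_1_right)
    show ?thesis
      unfolding Y_def by (simp only: right_diff_distrib left_diff_distrib distrib_left distrib_right 1 2 3 4)
  qed
  then have shiftY: "coef (Y \<rhd> shift \<rhd> x) (Suc n) = coef (Y \<rhd> x) n" for x n
    by (metis app_mult coef_bshift)
  have Y1: "Y \<rhd> unit_vec 0 1 = 0"
  proof (rule ell2_eqI)
    fix n
    have "(\<lambda>k. cnj (?b k) * coef (unit_vec 0 1) (n + k)) sums (if n = 0 then cnj (?b 0) else 0)"
      using sums_finite[of "{0}" "\<lambda>k. cnj (?b k) * coef (unit_vec 0 1) (n + k)"]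
      by (cases "n = 0") (auto simp: coef_unit_vec)
    then have "coef (toep_adj ?b \<rhd> unit_vec 0 1) n = (if n = 0 then cnj (?b 0) else 0)"
      using coef_toep_adj[OF b] sums_unique2 by blast
    then show "coef (Y \<rhd> unit_vec 0 1) n = coef 0 n"
      by (simp add: Y_def app_simps coef_toep_unit[OF b] autocorr_eq[OF v, symmetric] coef_cop
          coef_unit_vec autocorr_zero_cnj[OF v])
  qed
  have Yc: "Y \<rhd> cop c \<rhd> x = cop c \<rhd> Y \<rhd> x" for c x
  proof -
    note t = cop_commute_toep and ta = cop_commute_toep_adj
    have 1: "cop c * (toep_adj v * toep v) = toep_adj v * toep v * cop c"
      by (metis t[OF v] ta[OF v] mult.assoc)
    have 2: "cop c * cop (?b 0) = cop (?b 0) * cop c"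
      by (metis cop_mult mult.commute)
    have "Y * cop c = cop c * Y"
      unfolding Y_def
      by (simp only: right_diff_distrib left_diff_distrib distrib_left distrib_right
          t[OF b] ta[OF b] 1 2)
    then show ?thesis by (metis app_mult)
  qed
  \<comment> \<open>Column k + 1 is column k moved down by one; only its first entry is new, and the
    symmetry of Y reads it off the first column.\<close>
  have "coef (Y \<rhd> unit_vec k c) j = 0" for j k c
  proof (induction k arbitrary: j c)
    case 0
    have "unit_vec 0 c = cop c \<rhd> unit_vec 0 1"
      by (rule ell2_eqI) (simp add: coef_cop coef_unit_vec)
    then show ?case using Y1 by (simp add: Yc app.zero_right)
  next
    case (Suc k)
    have u: "unit_vec (Suc k) c = shift \<rhd> unit_vec k c"
      by (rule ell2_eqI) (auto simp: coef_shift coef_unit_vec)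
    show ?case
    proof (cases j)
      case 0
      have "inner (coef (Y \<rhd> unit_vec (Suc k) c) 0) d = inner (unit_vec (Suc k) c) (Y \<rhd> unit_vec 0 d)" for d
        using adjD[OF adjY] by (simp add: inner_unit_vec[symmetric])
      moreover have "Y \<rhd> unit_vec 0 d = 0" for d
      proof -
        have "unit_vec 0 d = cop d \<rhd> unit_vec 0 1"
          by (rule ell2_eqI) (simp add: coef_cop coef_unit_vec)
        then show ?thesis using Y1 by (simp add: Yc app.zero_right)
      qed
      ultimately show ?thesis using 0 by (metis inner_eq_zero_iff inner_zero_right)
    next
      case (Suc i)
      then show ?thesis using u shiftY Suc.IH by simp
    qed
  qed
  then have "Y = 0" by (rule endo_eq_zero)
  then show ?thesis by (simp add: Y_def algebra_simps)
qed

subsection \<open>Commutator errors of the truncated Lax pair\<close>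

text \<open>Here J is i, D the derivative, A and A' are T_u and T_{u bar}, A1 and A2 are the
  Toeplitz operators of D u and D^2 u, and Ab is that of D applied to the projection of |u|^2. The
  rules move J to the left and each D between A and A', where everything cancels except the
  displayed defect. Without compression A' A is the Toeplitz operator of |u|^2, and the defect is
  zero by the Leibniz rule.\<close>

lemma lax_pair_identity:
  fixes J D A A' :: "'a::ring_1"
  assumes J: "J * J = - 1" "D * J = J * D" "A * J = J * A" "A' * J = J * A'"
    and D: "D * A = A * D + A1" "D * A1 = A1 * D + A2" "A' * D = D * A' + A1'" "A1' * D = D * A1' + A2'"
    and dA: "dA = - (J * A2) + (J * A * Ab + J * A * Ab)"
    and dA': "dA' = J * A2' - (J * Ab' * A' + J * Ab' * A')"
    and L: "L = D - A * A'" and X: "X = - (J * (L + L + 1))"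
    and B: "B = J * (A * D * A' + A * D * A' - D * D)"
  shows "B * X - X * B - (J * (dA * A' + A * dA') + J * (dA * A' + A * dA'))
    = - (4 * (A * (D * (A' * A) - A' * A * D - Ab + Ab') * A'))"
proof -
  \<comment> \<open>Each rule is repeated with a trailing factor x, so that it also fires inside
    products associated to the right.\<close>
  have J': "J * (J * x) = - x" "D * (J * x) = J * (D * x)" "A * (J * x) = J * (A * x)"
    "A' * (J * x) = J * (A' * x)" for x
    using J by (metis mult.assoc mult_minus1, metis mult.assoc, metis mult.assoc, metis mult.assoc)
  have D': "D * (A * x) = A * (D * x) + A1 * x" "D * (A1 * x) = A1 * (D * x) + A2 * x"
    "A' * (D * x) = D * (A' * x) + A1' * x" "A1' * (D * x) = D * (A1' * x) + A2' * x" for x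
    using D by (metis mult.assoc distrib_right)+
  have four: "4 * y = y + y + y + y" for y :: 'a
  proof -
    have "(4 :: 'a) = 1 + 1 + 1 + 1" by simp
    then show ?thesis by (simp only: distrib_right mult_1)
  qed
  show ?thesis
    unfolding B X L dA dA' four
    by (simp add: distrib_left distrib_right left_diff_distrib right_diff_distrib mult.assoc J J' D D')
qed

text \<open>With C for S*, the left side vanishes exactly when [S*, B] = - i (2 L + 1) S* holds. The
  defect is the commutator of S* with T_u on the range of D, which \<open>tbshift_ttoep_dop\<close>
  confines to mode N.\<close>

lemma shift_identity:
  fixes J D A A' :: "'a::ring_1"
  assumes J: "D * J = J * D" "C * J = J * C" "A * J = J * A"
    and C: "C * D = D * C + C" "A' * C = C * A'"
    and L: "L = D - A * A'" and X: "X = - (J * (L + L + 1))"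
    and B: "B = J * (A * D * A' + A * D * A' - D * D)"
  shows "B * C + X * C - C * B = J * ((A * C * D - C * A * D) * A') + J * ((A * C * D - C * A * D) * A')"
proof -
  have J': "D * (J * x) = J * (D * x)" "C * (J * x) = J * (C * x)" "A * (J * x) = J * (A * x)" for x
    using J by (metis mult.assoc)+
  have C': "C * (D * x) = D * (C * x) + C * x" "A' * (C * x) = C * (A' * x)" for x
    using C by (metis mult.assoc distrib_right)+
  show ?thesis
    unfolding B X L
    by (simp add: distrib_left distrib_right left_diff_distrib right_diff_distrib mult.assoc J J' C C')
qed

text \<open>An H^1 norm in which only the modes up to N are differentiated; for a fixed vector of
  H^1 it is bounded uniformly in N.\<close>

definition hnorm :: "nat \<Rightarrow> ell2 \<Rightarrow> real" where
  "hnorm N x = norm x + norm (dop N \<rhd> x)"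

lemma hnorm_nonneg: "0 \<le> hnorm N x"
  and norm_le_hnorm: "norm x \<le> hnorm N x" and norm_dop_le_hnorm: "norm (dop N \<rhd> x) \<le> hnorm N x"
  by (simp_all add: hnorm_def)

text \<open>The part of T_v that leaves the modes up to N; products through it are what the
  compression of T_{u bar} T_u loses.\<close>

definition wtail :: "nat \<Rightarrow> (nat \<Rightarrow> complex) \<Rightarrow> ell2 endo" where
  "wtail N v = (1 - trunc N) * toep v * trunc N"

lemma norm_wtail_le: "wbound M v \<Longrightarrow> norm (wtail N v \<rhd> x) \<le> M * norm x"
proof -
  assume v: "wbound M v"
  have "norm (wtail N v \<rhd> x) \<le> norm (toep v \<rhd> trunc N \<rhd> x)"
    by (rule norm_ell2_le) (simp add: wtail_def app_simps coef_trunc)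
  also have "\<dots> \<le> M * norm (trunc N \<rhd> x)" by (rule norm_app_le[OF norm_toep_wbound(1)[OF v]])
  also have "\<dots> \<le> M * norm x"
    by (intro mult_left_mono norm_trunc_app wbound_summable(5)[OF v])
  finally show ?thesis .
qed

text \<open>The range lies in the modes above N, where D is at least N + 1. The Leibniz rule lets
  this D fall on v or on x, and both cost a factor M.\<close>

lemma norm_wtail_hnorm:
  assumes v: "wbound M v"
  shows "real (Suc N) * norm (wtail N v \<rhd> x) \<le> M * hnorm N x"
proof -
  let ?y = "toep (\<lambda>k. of_nat k * v k) \<rhd> trunc N \<rhd> x + toep v \<rhd> dop N \<rhd> x"
  have "norm (real (Suc N) *\<^sub>R (wtail N v \<rhd> x)) \<le> norm ?y"
  proof (rule norm_ell2_le)
    fix m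
    let ?z = "\<Sum>k\<le>m. v k * coef (trunc N \<rhd> x) (m - k)"
    have "of_nat m * ?z = coef ?y m"
    proof -
      have "of_nat m * (v k * coef (trunc N \<rhd> x) (m - k)) =
          of_nat k * v k * coef (trunc N \<rhd> x) (m - k) + v k * coef (dop N \<rhd> x) (m - k)" if "k \<le> m" for k
        using that by (auto simp: coef_trunc coef_dop of_nat_diff algebra_simps)
      then show ?thesis
        by (simp add: coef_toep wbound_summable[OF v] sum_distrib_left sum.distrib[symmetric])
    qed
    then have eq: "real m * cmod ?z = cmod (coef ?y m)"
      by (metis norm_mult norm_of_nat)
    show "cmod (coef (real (Suc N) *\<^sub>R (wtail N v \<rhd> x)) m) \<le> cmod (coef ?y m)"
    proof (cases "m \<le> N")
      case False
      then have "real (Suc N) * cmod ?z \<le> real m * cmod ?z"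
        by (intro mult_right_mono) auto
      with False show ?thesis
        unfolding eq[symmetric]
        by (simp add: wtail_def app_simps coef_trunc coef_toep wbound_summable[OF v] norm_mult del: of_nat_Suc)
    qed (simp add: wtail_def app_simps coef_trunc)
  qed
  also have "norm ?y \<le> M * norm (trunc N \<rhd> x) + M * norm (dop N \<rhd> x)"
    by (intro order_trans[OF norm_triangle_ineq] add_mono norm_app_le norm_toep_wbound[OF v])
  also have "\<dots> \<le> M * norm x + M * norm (dop N \<rhd> x)"
    by (intro add_mono mult_left_mono norm_trunc_app order_refl wbound_summable(5)[OF v])
  finally show ?thesis by (simp add: hnorm_def distrib_left del: of_nat_Suc)
qed

lemma trunc_ttoep_adj: "trunc N * ttoep_adj N v = ttoep_adj N v"
  using adj_unique[OF adj_mult[OF adj_ttoep adj_trunc]] ttoep_trunc adj_ttoep by metis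

text \<open>Q collects the products of T_{u bar} T_u that pass through modes above N. The rest of
  the compressed product is given by \<open>toep_adj_toep\<close>; its commutator with D is
  cancelled by the two terms with k b_k, and a constant symbol commutes with D.\<close>

lemma autocorr_commutator:
  fixes N :: nat
  assumes v: "wbound M v"
  defines "Q \<equiv> trunc N * toep_adj v * (1 - trunc N) * toep v * trunc N"
  shows "dop N * (ttoep_adj N v * ttoep N v) - ttoep_adj N v * ttoep N v * dop N
      - ttoep N (\<lambda>k. of_nat k * autocorr v k) + ttoep_adj N (\<lambda>k. of_nat k * autocorr v k)
    = Q * dop N - dop N * Q"
proof -
  let ?P = "trunc N" and ?b = "autocorr v"
  note sv = wbound_summable(1)[OF v]
  have sb: "summable (\<lambda>k. cmod (?b k))" by (rule summable_autocorr[OF sv])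
  have PPx: "?P * (?P * x) = ?P * x" for x by (metis mult.assoc trunc_trunc)
  have "ttoep_adj N v * ttoep N v = ?P * (ttoep_adj N v * ttoep N v) * ?P"
    by (metis mult.assoc ttoep_trunc trunc_ttoep_adj)
  also have "\<dots> = ?P * (toep_adj v * ?P * toep v) * ?P"
    by (simp add: ttoep_eq[OF sv] ttoep_adj_eq[OF sv] mult.assoc PPx)
  also have "\<dots> = ?P * (toep_adj v * toep v) * ?P - Q"
    by (simp add: Q_def algebra_simps)
  also have "?P * (toep_adj v * toep v) * ?P = ttoep N ?b + ttoep_adj N ?b - cop (?b 0) * ?P"
  proof -
    have "?P * toep ?b * ?P = ttoep N ?b" by (metis ttoep_eq[OF sb] ttoep_trunc)
    moreover have "?P * (toep_adj ?b * ?P) = ttoep_adj N ?b" by (metis ttoep_adj_eq[OF sb] trunc_ttoep_adj)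
    moreover have "?P * (cop (?b 0) * ?P) = cop (?b 0) * ?P"
      by (metis cop_commute_trunc mult.assoc trunc_trunc)
    ultimately show ?thesis
      unfolding toep_adj_toep[OF sv] by (simp add: left_diff_distrib right_diff_distrib distrib_left distrib_right mult.assoc)
  qed
  finally have AA: "ttoep_adj N v * ttoep N v = ttoep N ?b + ttoep_adj N ?b - cop (?b 0) * ?P - Q" .
  have c: "dop N * (cop (?b 0) * ?P) = cop (?b 0) * (?P * dop N)"
    by (metis cop_commute_dop dop_trunc mult.assoc trunc_dop)
  show ?thesis
    unfolding AA
    by (simp add: left_diff_distrib right_diff_distrib distrib_left distrib_right mult.assoc c dop_ttoep ttoep_adj_dop)
qed

text \<open>As a form, Q is the square of \<open>wtail N v\<close>. In each of the two terms D
  spoils the gain of one factor, which then stays bounded, and the other factor contributes 1 / (N +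
  1).\<close>

lemma autocorr_commutator_bound:
  assumes v: "wbound M v"
  shows "\<bar>inner ((dop N * (ttoep_adj N v * ttoep N v) - ttoep_adj N v * ttoep N v * dop N
      - ttoep N (\<lambda>k. of_nat k * autocorr v k) + ttoep_adj N (\<lambda>k. of_nat k * autocorr v k)) \<rhd> x) y\<bar>
    \<le> 2 * M\<^sup>2 / real (Suc N) * hnorm N x * hnorm N y"
proof -
  let ?Q = "trunc N * toep_adj v * (1 - trunc N) * toep v * trunc N"
  have M: "0 \<le> M" by (rule wbound_summable(5)[OF v])
  have Q: "inner (?Q \<rhd> x) y = inner (wtail N v \<rhd> x) (wtail N v \<rhd> y)" for x y
  proof -
    have "adj (wtail N v) (trunc N * (toep_adj v * (1 - trunc N)))"
      unfolding wtail_def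
      by (intro adj_mult adj_diff adj_one adj_trunc adj_toep wbound_summable(1)[OF v])
    from adjD[OF adj_sym[OF this]]
    have "inner ((trunc N * (toep_adj v * (1 - trunc N))) \<rhd> wtail N v \<rhd> x) y = inner (wtail N v \<rhd> x) (wtail N v \<rhd> y)" .
    moreover have "(trunc N * (toep_adj v * (1 - trunc N))) \<rhd> wtail N v \<rhd> x = ?Q \<rhd> x"
    proof -
      have "(1 - trunc N) * (1 - trunc N) = 1 - trunc N"
        by (simp add: algebra_simps trunc_trunc)
      then have "(trunc N * (toep_adj v * (1 - trunc N))) * wtail N v = ?Q"
        unfolding wtail_def by (metis mult.assoc)
      then show ?thesis by (metis app_mult)
    qed
    ultimately show ?thesis by simp
  qed
  have w: "norm (wtail N v \<rhd> x) \<le> M / real (Suc N) * hnorm N x" for x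
    using norm_wtail_hnorm[OF v, of N x] by (simp add: field_simps)
  have wd: "norm (wtail N v \<rhd> dop N \<rhd> x) \<le> M * hnorm N x" for x
    by (rule order_trans[OF norm_wtail_le[OF v] mult_left_mono[OF norm_dop_le_hnorm M]])
  have "inner ((?Q * dop N - dop N * ?Q) \<rhd> x) y
      = inner (wtail N v \<rhd> dop N \<rhd> x) (wtail N v \<rhd> y) - inner (wtail N v \<rhd> x) (wtail N v \<rhd> dop N \<rhd> y)"
    using Q[of "dop N \<rhd> x" y] Q[of x "dop N \<rhd> y"] adjD[OF adj_dop, of N "?Q \<rhd> x" y]
    by (simp add: app.diff_left inner_diff_left)
  also have "\<bar>\<dots>\<bar> \<le> norm (wtail N v \<rhd> dop N \<rhd> x) * norm (wtail N v \<rhd> y)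
      + norm (wtail N v \<rhd> x) * norm (wtail N v \<rhd> dop N \<rhd> y)"
    using Cauchy_Schwarz_ineq2[of "wtail N v \<rhd> dop N \<rhd> x" "wtail N v \<rhd> y"]
      Cauchy_Schwarz_ineq2[of "wtail N v \<rhd> x" "wtail N v \<rhd> dop N \<rhd> y"] by linarith
  also have "\<dots> \<le> (M * hnorm N x) * (M / real (Suc N) * hnorm N y)
      + (M / real (Suc N) * hnorm N x) * (M * hnorm N y)"
    by (intro add_mono mult_mono w wd) (auto simp: M hnorm_nonneg)
  also have "\<dots> = 2 * M\<^sup>2 / real (Suc N) * hnorm N x * hnorm N y"
    by (simp only: power2_eq_square times_divide_eq_left times_divide_eq_right
        add_divide_distrib[symmetric]) (simp add: algebra_simps)
  finally show ?thesis unfolding autocorr_commutator[OF v] .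
qed

lemma hnorm_ttoep_adj:
  assumes v: "wbound M v" shows "hnorm N (ttoep_adj N v \<rhd> x) \<le> 2 * M * hnorm N x"
proof -
  have M: "0 \<le> M" by (rule wbound_summable(5)[OF v])
  have n1: "norm (ttoep_adj N (\<lambda>k. of_nat k * v k)) \<le> M"
    using norm_adj[OF adj_ttoep] norm_ttoep_deriv_wbound[OF v] by metis
  have "dop N \<rhd> ttoep_adj N v \<rhd> x = ttoep_adj N v \<rhd> dop N \<rhd> x - ttoep_adj N (\<lambda>k. of_nat k * v k) \<rhd> x"
    using arg_cong[OF ttoep_adj_dop[of N v], of "\<lambda>X. X \<rhd> x"] by (simp add: app.add_left)
  then have "norm (dop N \<rhd> ttoep_adj N v \<rhd> x) \<le> M * norm (dop N \<rhd> x) + M * norm x"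
    using norm_app_le[OF norm_ttoep_adj_wbound[OF v], of N "dop N \<rhd> x"] norm_app_le[OF n1, of x]
    by (smt (verit) norm_triangle_ineq4)
  moreover have "norm (ttoep_adj N v \<rhd> x) \<le> M * norm x"
    by (rule norm_app_le[OF norm_ttoep_adj_wbound[OF v]])
  moreover have "0 \<le> M * norm (dop N \<rhd> x)" using M by simp
  ultimately show ?thesis unfolding hnorm_def by (simp add: algebra_simps)
qed

lemma hnorm_cop: "hnorm N (cop z \<rhd> x) = cmod z * hnorm N x"
proof -
  have "dop N \<rhd> cop z \<rhd> x = cop z \<rhd> dop N \<rhd> x" by (metis app_mult cop_commute_dop)
  then show ?thesis by (simp add: hnorm_def norm_cop_app algebra_simps)
qed

text \<open>The equation solved for the time derivative, as an identity of symbols. By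
  \<open>ttoep_conv\<close> the compression of the nonlinear term is exact.\<close>

lemma ttoep_cs_field:
  "ttoep N (cs_field v) = - (jop * ttoep N (\<lambda>k. of_nat k * (of_nat k * v k)))
     + (jop * ttoep N v * ttoep N (\<lambda>k. of_nat k * autocorr v k)
      + jop * ttoep N v * ttoep N (\<lambda>k. of_nat k * autocorr v k))"
proof -
  have n: "cop (- \<i>) = - jop" "cop (2 * \<i>) = jop + jop"
    by (intro endo_eqI ell2_eqI, simp add: coef_cop app_simps)+
  have "ttoep N (cs_field v) = cop (- \<i>) * ttoep N (\<lambda>k. of_nat k * (of_nat k * v k))
     + cop (2 * \<i>) * (ttoep N v * ttoep N (\<lambda>k. of_nat k * autocorr v k))"
    unfolding ttoep_conv[symmetric] ttoep_scale[symmetric] ttoep_add[symmetric]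
    by (rule arg_cong[where f = "ttoep N"]) (simp add: fun_eq_iff cs_field_def)
  then show ?thesis by (simp add: n distrib_right mult.assoc)
qed

lemma ttoep_adj_cs_field:
  "ttoep_adj N (cs_field v) = jop * ttoep_adj N (\<lambda>k. of_nat k * (of_nat k * v k))
     - (jop * ttoep_adj N (\<lambda>k. of_nat k * autocorr v k) * ttoep_adj N v
      + jop * ttoep_adj N (\<lambda>k. of_nat k * autocorr v k) * ttoep_adj N v)"
proof -
  let ?w = "\<lambda>k. of_nat k * autocorr v k"
  have "adj (ttoep N (cs_field v)) (- (ttoep_adj N (\<lambda>k. of_nat k * (of_nat k * v k)) * (- jop))
     + (ttoep_adj N ?w * (ttoep_adj N v * (- jop)) + ttoep_adj N ?w * (ttoep_adj N v * (- jop))))"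
    unfolding ttoep_cs_field
    by (intro adj_add adj_minus adj_mult adj_jop adj_ttoep)
  moreover have "ttoep_adj N ?w * (ttoep_adj N v * jop) = jop * ttoep_adj N ?w * ttoep_adj N v"
    by (metis cop_commute_ttoep_adj mult.assoc)
  ultimately show ?thesis
    using adj_unique[OF adj_ttoep] by (simp add: cop_commute_ttoep_adj)
qed

text \<open>The derivative of \<open>gen N\<close> at v in the direction w.\<close>

definition gen_deriv :: "nat \<Rightarrow> (nat \<Rightarrow> complex) \<Rightarrow> (nat \<Rightarrow> complex) \<Rightarrow> ell2 endo" where
  "gen_deriv N v w = jop * (ttoep N w * ttoep_adj N v + ttoep N v * ttoep_adj N w)
     + jop * (ttoep N w * ttoep_adj N v + ttoep N v * ttoep_adj N w)"

text \<open>The constant is 4 from the algebraic identity, 2 M^2 from the commutator, and (2 M)^2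
  from passing the outer T_u and T_{u bar} to the test vectors in H^1.\<close>

lemma lax_pair_bound:
  assumes v: "wbound M v"
  shows "\<bar>inner ((bop N v * gen N v - gen N v * bop N v - gen_deriv N v (cs_field v)) \<rhd> x) y\<bar>
    \<le> 32 * M ^ 4 / real (Suc N) * hnorm N x * hnorm N y"
proof -
  let ?Th = "dop N * (ttoep_adj N v * ttoep N v) - ttoep_adj N v * ttoep N v * dop N
      - ttoep N (\<lambda>k. of_nat k * autocorr v k) + ttoep_adj N (\<lambda>k. of_nat k * autocorr v k)"
  have eq: "bop N v * gen N v - gen N v * bop N v - gen_deriv N v (cs_field v)
      = - (4 * (ttoep N v * ?Th * ttoep_adj N v))"
    unfolding gen_deriv_def
    by (rule lax_pair_identity[OF jop_jop cop_commute_dop[symmetric] cop_commute_ttoep[symmetric]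
      cop_commute_ttoep_adj[symmetric] dop_ttoep dop_ttoep ttoep_adj_dop ttoep_adj_dop
      ttoep_cs_field ttoep_adj_cs_field lax_def gen_def bop_def])
  have M: "0 \<le> M" by (rule wbound_summable(5)[OF v])
  have four: "(4 * Y) \<rhd> x = 4 *\<^sub>R (Y \<rhd> x)" for Y :: "ell2 endo"
  proof -
    have "4 * Y = 4 *\<^sub>R Y" by (metis mult_scaleR_left mult_1 of_real_def of_real_numeral)
    then show ?thesis by (simp add: app.scaleR_left)
  qed
  have "\<bar>inner ((- (4 * (ttoep N v * ?Th * ttoep_adj N v))) \<rhd> x) y\<bar>
      = 4 * \<bar>inner (?Th \<rhd> ttoep_adj N v \<rhd> x) (ttoep_adj N v \<rhd> y)\<bar>"
    unfolding app.minus_left four by (simp add: adjD[OF adj_ttoep] abs_mult)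
  also have "\<dots> \<le> 4 * (2 * M\<^sup>2 / real (Suc N) * hnorm N (ttoep_adj N v \<rhd> x) * hnorm N (ttoep_adj N v \<rhd> y))"
    by (intro mult_left_mono autocorr_commutator_bound[OF v]) simp
  also have "\<dots> \<le> 4 * (2 * M\<^sup>2 / real (Suc N) * (2 * M * hnorm N x) * (2 * M * hnorm N y))"
    by (intro mult_left_mono mult_mono hnorm_ttoep_adj[OF v]) (auto simp: hnorm_nonneg M)
  also have "\<dots> = 32 * M ^ 4 / real (Suc N) * hnorm N x * hnorm N y"
    by (simp add: power2_eq_square power4_eq_xxxx field_simps)
  finally show ?thesis unfolding eq .
qed

lemma trunc_tail_coef:
  "real N * cmod (coef x N) \<le> norm (dop N \<rhd> x)"
  using cmod_coef_le[of "dop N \<rhd> x" N] by (simp add: coef_dop norm_mult)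

text \<open>The defect is a multiple of a basis vector of mode N, and a vector bounded in H^1 has a
  coefficient of size 1 / N there. One factor \<open>hnorm\<close> bounds the multiple, the other
  this coefficient.\<close>

lemma shift_error_bound:
  assumes v: "wbound M v" and N: "0 < N"
  shows "\<bar>inner ((bop N v * tbshift N + gen N v * tbshift N - tbshift N * bop N v) \<rhd> x) y\<bar>
    \<le> 4 * M\<^sup>2 / real N * hnorm N x * hnorm N y"
proof -
  let ?A = "ttoep N v" and ?A' = "ttoep_adj N v" and ?C = "tbshift N" and ?D = "dop N"
  let ?R = "?A * ?C * ?D - ?C * ?A * ?D"
  have M: "0 \<le> M" by (rule wbound_summable(5)[OF v])
  have eq: "bop N v * ?C + gen N v * ?C - ?C * bop N v = jop * (?R * ?A') + jop * (?R * ?A')"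
    by (rule shift_identity[OF cop_commute_dop[symmetric] cop_commute_tbshift[symmetric]
      cop_commute_ttoep[symmetric] tbshift_dop ttoep_adj_tbshift lax_def gen_def bop_def])
  let ?z = "?A' \<rhd> x"
  let ?r = "coef ((?A * ?C * ?D) \<rhd> ?z) N"
  have R: "?R \<rhd> ?z = unit_vec N ?r"
  proof (rule ell2_eqI)
    fix n
    have "coef (?R \<rhd> ?z) n = - coef ((?C * ?A * ?D - ?A * ?C * ?D) \<rhd> ?z) n"
      by (simp add: app.diff_left)
    then show "coef (?R \<rhd> ?z) n = coef (unit_vec N ?r) n"
      unfolding tbshift_ttoep_dop by (simp add: coef_unit_vec)
  qed
  have r: "cmod ?r \<le> 2 * M\<^sup>2 * hnorm N x"
  proof -
    have "cmod ?r \<le> norm ((?A * ?C * ?D) \<rhd> ?z)" by (rule cmod_coef_le)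
    also have "\<dots> \<le> M * (1 * norm (?D \<rhd> ?z))"
      unfolding app_mult
      by (intro order_trans[OF norm_app_le[OF norm_ttoep_wbound[OF v]]] mult_left_mono
          norm_app_le[OF norm_tbshift] M)
    also have "\<dots> \<le> M * (1 * (2 * M * hnorm N x))"
      by (intro mult_left_mono M order_trans[OF norm_dop_le_hnorm hnorm_ttoep_adj[OF v]]) auto
    finally show ?thesis by (simp add: power2_eq_square mult_ac)
  qed
  have "\<bar>inner ((jop * (?R * ?A') + jop * (?R * ?A')) \<rhd> x) y\<bar> = 2 * \<bar>inner (?R \<rhd> ?z) (jop \<rhd> y)\<bar>"
    using adjD[OF adj_jop, of "?R \<rhd> ?z" y] by (simp add: app.add_left inner_add_left app.minus_left)
  also have "\<dots> = 2 * \<bar>inner (coef (jop \<rhd> y) N) ?r\<bar>"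
    unfolding R by (subst inner_commute) (simp add: inner_unit_vec)
  also have "\<dots> \<le> 2 * (cmod (coef (jop \<rhd> y) N) * cmod ?r)"
    by (intro mult_left_mono Cauchy_Schwarz_ineq2) simp
  also have "\<dots> = 2 * (cmod (coef y N) * cmod ?r)"
    by (simp add: coef_cop norm_mult)
  also have "\<dots> \<le> 2 * ((hnorm N y / real N) * (2 * M\<^sup>2 * hnorm N x))"
  proof (intro mult_left_mono mult_mono r)
    show "cmod (coef y N) \<le> hnorm N y / real N"
      using order_trans[OF trunc_tail_coef norm_dop_le_hnorm, of N y] N by (simp add: field_simps)
  qed (auto simp: hnorm_nonneg)
  also have "\<dots> = 4 * M\<^sup>2 / real N * hnorm N x * hnorm N y" by (simp add: field_simps)
  finally show ?thesis unfolding eq .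
qed

text \<open>The equation is u' = B u because T_{u bar} u is the projection of |u|^2. The compressed
  T_{u bar} misses the modes of u above N, that is, \<open>wtail N v\<close> applied to 1, whose
  norm is at most M / (N + 1) because D 1 = 0. The remaining D is moved to y by duality.\<close>

lemma field_error_bound:
  assumes v: "wbound M v"
  shows "\<bar>inner (ttoep N (cs_field v) \<rhd> unit_vec 0 1 - bop N v \<rhd> ttoep N v \<rhd> unit_vec 0 1) y\<bar>
    \<le> 4 * M ^ 3 / real (Suc N) * hnorm N y"
proof -
  let ?A = "ttoep N v" and ?A' = "ttoep_adj N v" and ?D = "dop N" and ?e = "unit_vec 0 1"
  let ?b = "autocorr v"
  note sv = wbound_summable(1)[OF v]
  have M: "0 \<le> M" by (rule wbound_summable(5)[OF v])
  have De: "?D \<rhd> ?e = 0" by (rule dop_unit_vec)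
  have Pe: "trunc N \<rhd> ?e = ?e" by (rule ell2_eqI) (simp add: coef_trunc coef_unit_vec)
  have DDA: "?D \<rhd> ?D \<rhd> ?A \<rhd> ?e = ttoep N (\<lambda>k. of_nat k * (of_nat k * v k)) \<rhd> ?e"
    by (rule ell2_eqI) (simp add: coef_dop coef_ttoep coef_unit_vec if_distrib sum.delta
        mult.assoc cong: if_cong)
  have DAb: "ttoep N (\<lambda>k. of_nat k * ?b k) \<rhd> ?e = ?D \<rhd> toep_adj v \<rhd> toep v \<rhd> ?e"
  proof (rule ell2_eqI)
    fix n
    have "(\<Sum>k\<le>n. of_nat k * ?b k * (if n - k = 0 then 1 else 0)) = (\<Sum>k\<in>{n}. of_nat k * ?b k)"
      by (rule sum.mono_neutral_cong_right) auto
    then show "coef (ttoep N (\<lambda>k. of_nat k * ?b k) \<rhd> ?e) n = coef (?D \<rhd> toep_adj v \<rhd> toep v \<rhd> ?e) n"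
      by (simp add: coef_ttoep coef_dop coef_unit_vec autocorr_eq[OF sv, symmetric])
  qed
  let ?w = "wtail N v \<rhd> ?e"
  have w: "?A' \<rhd> ?A \<rhd> ?e = toep_adj v \<rhd> toep v \<rhd> ?e - toep_adj v \<rhd> ?w"
  proof -
    have "trunc N \<rhd> trunc N \<rhd> z = trunc N \<rhd> z" for z by (metis app_mult trunc_trunc)
    then show ?thesis
      by (simp add: ttoep_eq[OF sv] ttoep_adj_eq[OF sv] wtail_def Pe app_simps)
  qed
  have eq: "ttoep N (cs_field v) \<rhd> ?e - bop N v \<rhd> ?A \<rhd> ?e
      = jop \<rhd> ?A \<rhd> ?D \<rhd> toep_adj v \<rhd> ?w + jop \<rhd> ?A \<rhd> ?D \<rhd> toep_adj v \<rhd> ?w"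
    by (simp add: ttoep_cs_field bop_def app_simps DAb w DDA)
  have "inner (jop \<rhd> ?A \<rhd> ?D \<rhd> toep_adj v \<rhd> ?w) y = - inner ?w (toep v \<rhd> ?D \<rhd> ?A' \<rhd> jop \<rhd> y)"
    by (simp add: adjD[OF adj_jop] adjD[OF adj_ttoep] adjD[OF adj_dop] adjD[OF adj_sym[OF adj_toep[OF sv]]] app_simps)
  then have "\<bar>inner (jop \<rhd> ?A \<rhd> ?D \<rhd> toep_adj v \<rhd> ?w + jop \<rhd> ?A \<rhd> ?D \<rhd> toep_adj v \<rhd> ?w) y\<bar>
      = 2 * \<bar>inner ?w (toep v \<rhd> ?D \<rhd> ?A' \<rhd> jop \<rhd> y)\<bar>"
    by (simp add: inner_add_left)
  also have "\<dots> \<le> 2 * (norm ?w * norm (toep v \<rhd> ?D \<rhd> ?A' \<rhd> jop \<rhd> y))"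
    by (intro mult_left_mono Cauchy_Schwarz_ineq2) simp
  also have "\<dots> \<le> 2 * ((M / real (Suc N)) * (M * (2 * M * hnorm N y)))"
  proof (intro mult_left_mono mult_mono)
    show "norm ?w \<le> M / real (Suc N)"
      using norm_wtail_hnorm[OF v, of N ?e] by (simp add: hnorm_def De field_simps)
    have "norm (toep v \<rhd> ?D \<rhd> ?A' \<rhd> jop \<rhd> y) \<le> M * norm (?D \<rhd> ?A' \<rhd> jop \<rhd> y)"
      by (rule norm_app_le[OF norm_toep_wbound(1)[OF v]])
    also have "\<dots> \<le> M * (2 * M * hnorm N (jop \<rhd> y))"
      by (intro mult_left_mono M order_trans[OF norm_dop_le_hnorm hnorm_ttoep_adj[OF v]])
    finally show "norm (toep v \<rhd> ?D \<rhd> ?A' \<rhd> jop \<rhd> y) \<le> M * (2 * M * hnorm N y)"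
      by (simp add: hnorm_cop)
  qed (auto simp: M)
  also have "\<dots> = 4 * M ^ 3 / real (Suc N) * hnorm N y" by (simp add: power3_eq_cube field_simps)
  finally show ?thesis unfolding eq .
qed

subsection \<open>Approximate conservation along the flow\<close>

lemma vector_mean_value_bound:
  fixes f :: "real \<Rightarrow> 'a::real_normed_vector"
  assumes "convex S" "\<And>s. s \<in> S \<Longrightarrow> (f has_vector_derivative f' s) (at s within S)"
    and "\<And>s. s \<in> S \<Longrightarrow> norm (f' s) \<le> B" and "x \<in> S" "y \<in> S"
  shows "norm (f x - f y) \<le> B * \<bar>x - y\<bar>"
proof -
  have "norm (f x - f y) \<le> B * norm (x - y)"
  proof (rule differentiable_bound[OF assms(1) _ _ assms(4,5)])
    show "(f has_derivative (\<lambda>h. h *\<^sub>R f' s)) (at s within S)" if "s \<in> S" for s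
      using assms(2)[OF that] by (simp add: has_vector_derivative_def)
    show "onorm (\<lambda>h. h *\<^sub>R f' s) \<le> B" if "s \<in> S" for s
      by (rule onorm_le) (use mult_right_mono[OF assms(3)[OF that] abs_ge_zero] in \<open>simp add: mult.commute\<close>)
  qed
  then show ?thesis by simp
qed

lemma has_vector_derivative_scaleR_diff:
  "((\<lambda>q. (q - r) *\<^sub>R y) has_vector_derivative y) (at x within S)"
proof -
  have "((\<lambda>q. q - r) has_real_derivative 1 - 0) (at x within S)"
    by (intro DERIV_diff DERIV_ident DERIV_const)
  then show ?thesis
    using has_vector_derivative_scaleR[OF _ has_vector_derivative_const, of "\<lambda>q. q - r" 1 x S y] by simp
qed

text \<open>Near each point the bound may hold in a neighbourhood that depends on the point and on
  epsilon; bisection of the interval makes it global. This local growth condition takes the place of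
  a derivative.\<close>

lemma dini_bound:
  fixes f :: "real \<Rightarrow> real"
  assumes "p \<le> q"
    and loc: "\<And>x \<epsilon>. x \<in> {p..q} \<Longrightarrow> 0 < \<epsilon> \<Longrightarrow>
      \<forall>\<^sub>F y in at x within {p..q}. \<bar>f y - f x\<bar> \<le> (K + \<epsilon>) * \<bar>y - x\<bar>"
  shows "\<bar>f q - f p\<bar> \<le> K * (q - p)"
proof (rule field_le_epsilon)
  fix e :: real assume e: "0 < e"
  \<comment> \<open>The + 1 covers the case p = q.\<close>
  define \<epsilon> where "\<epsilon> = e / (q - p + 1)"
  have \<epsilon>: "0 < \<epsilon>" using e \<open>p \<le> q\<close> by (simp add: \<epsilon>_def)
  \<comment> \<open>The guards make P trivial outside [p, q]; it passes from adjacent intervals to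
    their union, as bisection requires.\<close>
  define P where "P a b \<longleftrightarrow> (p \<le> a \<longrightarrow> b \<le> q \<longrightarrow> \<bar>f b - f a\<bar> \<le> (K + \<epsilon>) * (b - a))" for a b
  have "P p q"
    using \<open>p \<le> q\<close>
  proof (rule Bolzano)
    fix a b c assume "P a b" "P b c" "a \<le> b" "b \<le> c"
    then show "P a c" by (auto simp: P_def algebra_simps)
  next
    fix x assume "p \<le> x" "x \<le> q"
    then have x: "x \<in> {p..q}" by simp
    from loc[OF x \<epsilon>] obtain d where d: "d > 0"
      and D: "\<And>y. y \<in> {p..q} \<Longrightarrow> y \<noteq> x \<Longrightarrow> dist y x < d \<Longrightarrow> \<bar>f y - f x\<bar> \<le> (K + \<epsilon>) * \<bar>y - x\<bar>"
      by (auto simp: eventually_at)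
    have D': "\<bar>f y - f x\<bar> \<le> (K + \<epsilon>) * \<bar>y - x\<bar>" if "y \<in> {p..q}" "\<bar>y - x\<bar> < d" for y
      using D[of y] that by (cases "y = x") (auto simp: dist_real_def)
    show "\<exists>d>0. \<forall>a b. a \<le> x \<and> x \<le> b \<and> b - a < d \<longrightarrow> P a b"
    proof (intro exI[of _ d] conjI d allI impI, unfold P_def, intro impI)
      fix a b assume ab: "a \<le> x \<and> x \<le> b \<and> b - a < d" "p \<le> a" "b \<le> q"
      then have "\<bar>f a - f x\<bar> \<le> (K + \<epsilon>) * (x - a)" "\<bar>f b - f x\<bar> \<le> (K + \<epsilon>) * (b - x)"
        using D'[of a] D'[of b] x by auto
      then show "\<bar>f b - f a\<bar> \<le> (K + \<epsilon>) * (b - a)" by (auto simp: algebra_simps)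
    qed
  qed
  then have "\<bar>f q - f p\<bar> \<le> K * (q - p) + \<epsilon> * (q - p)" by (simp add: P_def algebra_simps)
  also have "\<epsilon> * (q - p) \<le> e"
    using e \<open>p \<le> q\<close> by (simp add: \<epsilon>_def field_simps)
  finally show "\<bar>f q - f p\<bar> \<le> K * (q - p) + e" by simp
qed

text \<open>Puts o(q - r) into the form in which it enters the step estimates.\<close>

lemma vanishing_derivative_bound:
  fixes f :: "real \<Rightarrow> 'a::real_normed_vector"
  assumes "(f has_vector_derivative 0) (at r within S)" "f r = 0" "0 < \<eta>"
  shows "\<forall>\<^sub>F q in at r within S. norm (f q) \<le> \<eta> * \<bar>q - r\<bar>"
proof -
  have "((\<lambda>q. (1 / norm (q - r)) *\<^sub>R f q) \<longlongrightarrow> 0) (at r within S)"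
    using assms(1,2) by (simp add: has_vector_derivative_def has_derivative_within)
  then have "\<forall>\<^sub>F q in at r within S. norm ((1 / norm (q - r)) *\<^sub>R f q) < \<eta>"
    using assms(3) tendstoD by fastforce
  moreover have "\<forall>\<^sub>F q in at r within S. q \<noteq> r"
    by (simp add: eventually_at_filter)
  ultimately show ?thesis
    by eventually_elim (simp add: field_simps less_imp_le)
qed

text \<open>The graph norm of \<^term>\<open>lax N v\<close> is conserved, and \<^term>\<open>lax N v\<close> differs from
  \<^term>\<open>dop N\<close> by an operator that is bounded independently of \<open>N\<close>.\<close>

lemma hnorm_exp_commuting:
  assumes v: "wbound M v" and X: "adj X (- X)" and c: "X * lax N v = lax N v * X"
  shows "hnorm N (exp (s *\<^sub>R X) \<rhd> x) \<le> (1 + 2 * M\<^sup>2) * hnorm N x"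
proof -
  let ?E = "exp (s *\<^sub>R X)" and ?T = "ttoep N v * ttoep_adj N v"
  have M: "0 \<le> M" by (rule wbound_summable(5)[OF v])
  have "lax N v * ?E = ?E * lax N v"
    by (rule commute_exp) (simp add: c)
  then have le: "lax N v \<rhd> ?E \<rhd> x = ?E \<rhd> lax N v \<rhd> x" by (metis app_mult)
  have D: "dop N \<rhd> y = lax N v \<rhd> y + ?T \<rhd> y" for y
    by (simp add: lax_def app.diff_left)
  have T: "norm (?T \<rhd> y) \<le> M\<^sup>2 * norm y" for y
    using order_trans[OF norm_app_le[OF norm_ttoep_wbound[OF v, of N], of "ttoep_adj N v \<rhd> y"]
        mult_left_mono[OF norm_app_le[OF norm_ttoep_adj_wbound[OF v, of N], of y] M]]
    by (simp add: power2_eq_square mult.assoc)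
  \<comment> \<open>D is replaced by L on the evolved vector, the norm of L is conserved, and D is
    restored on x; each exchange costs M^2 times the norm of x.\<close>
  have "norm (dop N \<rhd> ?E \<rhd> x) \<le> norm (lax N v \<rhd> x) + M\<^sup>2 * norm x"
    using norm_triangle_ineq[of "lax N v \<rhd> ?E \<rhd> x" "?T \<rhd> ?E \<rhd> x"] T[of "?E \<rhd> x"]
    by (simp add: D le norm_exp_antisym[OF X])
  moreover have "norm (lax N v \<rhd> x) \<le> norm (dop N \<rhd> x) + M\<^sup>2 * norm x"
    using norm_triangle_ineq4[of "dop N \<rhd> x" "?T \<rhd> x"] T[of x] by (simp add: D)
  moreover have "0 \<le> M\<^sup>2 * norm (dop N \<rhd> x)" by simp
  ultimately have "norm (dop N \<rhd> ?E \<rhd> x) \<le> norm (dop N \<rhd> x) + 2 * (M\<^sup>2 * norm x) + 2 * (M\<^sup>2 * norm (dop N \<rhd> x))"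
    by linarith
  then show ?thesis
    by (simp add: hnorm_def norm_exp_antisym[OF X] algebra_simps)
qed

lemma hnorm_exp_gen: "wbound M v \<Longrightarrow> hnorm N (exp (s *\<^sub>R gen N v) \<rhd> x) \<le> (1 + 2 * M\<^sup>2) * hnorm N x"
  by (rule hnorm_exp_commuting[OF _ adj_gen gen_commute_lax])

lemma hnorm_tbshift: "hnorm N (tbshift N \<rhd> x) \<le> 2 * hnorm N x"
proof -
  have "dop N \<rhd> tbshift N \<rhd> x = tbshift N \<rhd> dop N \<rhd> x - tbshift N \<rhd> x"
    using arg_cong[OF tbshift_dop[of N], of "\<lambda>X. X \<rhd> x"] by (simp add: app.add_left)
  then have "norm (dop N \<rhd> tbshift N \<rhd> x) \<le> norm (dop N \<rhd> x) + norm x"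
    using norm_triangle_ineq4[of "tbshift N \<rhd> dop N \<rhd> x" "tbshift N \<rhd> x"]
      norm_app_le[OF norm_tbshift, of N x] norm_app_le[OF norm_tbshift, of N "dop N \<rhd> x"] by simp
  then show ?thesis using norm_app_le[OF norm_tbshift, of N x] norm_ge_zero[of "dop N \<rhd> x"]
    by (simp add: hnorm_def del: norm_ge_zero)
qed

text \<open>The counterpart for the adjoint, because powers of K are moved to the test vector
  through their adjoints.\<close>

lemma hnorm_tbshift_adj: "hnorm N ((trunc N * shift) \<rhd> x) \<le> 2 * hnorm N x"
proof -
  let ?C = "trunc N * shift"
  have n: "norm ?C \<le> 1" using norm_adj[OF adj_tbshift] norm_tbshift by metis
  have "dop N * ?C = ?C * dop N + ?C"
    using adj_unique[OF adj_mult[OF adj_tbshift adj_dop]]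
      adj_add[OF adj_mult[OF adj_dop adj_tbshift] adj_tbshift] tbshift_dop by metis
  then have "dop N \<rhd> ?C \<rhd> x = ?C \<rhd> dop N \<rhd> x + ?C \<rhd> x"
    by (metis app.add_left app_mult)
  then have "norm (dop N \<rhd> ?C \<rhd> x) \<le> norm (dop N \<rhd> x) + norm x"
    using norm_triangle_ineq[of "?C \<rhd> dop N \<rhd> x" "?C \<rhd> x"]
      norm_app_le[OF n, of x] norm_app_le[OF n, of "dop N \<rhd> x"] by (simp del: app_mult)
  then show ?thesis using norm_app_le[OF n, of x] norm_ge_zero[of "dop N \<rhd> x"]
    by (simp add: hnorm_def del: norm_ge_zero app_mult)
qed

section \<open>Duhamel estimates for intertwined exponentials and powers\<close>

lemma exp_scaleR_has_vector_derivative: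
  fixes X :: "'a::{real_normed_algebra_1, banach}"
  shows "((\<lambda>s. exp (s *\<^sub>R X)) has_vector_derivative exp (s *\<^sub>R X) * X) (at s within S)"
    "((\<lambda>s. exp (s *\<^sub>R X)) has_vector_derivative X * exp (s *\<^sub>R X)) (at s within S)"
  by (auto intro: has_vector_derivative_at_within exp_scaleR_has_vector_derivative_right
    exp_scaleR_has_vector_derivative_left)

lemma exp_conj_has_vector_derivative:
  fixes X Y Q :: "'a::{real_normed_algebra_1, banach}"
  shows "((\<lambda>\<sigma>. exp (\<sigma> *\<^sub>R - Y) * Q * exp (\<sigma> *\<^sub>R X)) has_vector_derivative
    exp (\<sigma> *\<^sub>R - Y) * (Q * X - Y * Q) * exp (\<sigma> *\<^sub>R X)) (at \<sigma> within S)"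
proof -
  have "((\<lambda>\<sigma>. exp (\<sigma> *\<^sub>R - Y) * Q * exp (\<sigma> *\<^sub>R X)) has_vector_derivative
     (exp (\<sigma> *\<^sub>R - Y) * Q) * (X * exp (\<sigma> *\<^sub>R X)) + (exp (\<sigma> *\<^sub>R - Y) * - Y) * Q * exp (\<sigma> *\<^sub>R X)) (at \<sigma> within S)"
    by (rule has_vector_derivative_mult[OF has_vector_derivative_mult_left
          [OF exp_scaleR_has_vector_derivative(1)] exp_scaleR_has_vector_derivative(2)])
  then show ?thesis by (simp add: algebra_simps del: scaleR_minus_right)
qed

text \<open>Duhamel: the difference is the integral over sigma of exp ((tau - sigma) X') (Q X - X'
  Q) exp (sigma X). The inner defect is only controlled as a form on H^1, so the left exponential is
  moved to g; both exponentials preserve H^1 with constant c.\<close>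

lemma intertwine_exp:
  assumes X: "adj X (- X)" and X': "adj X' (- X')"
    and h: "\<And>s x. hnorm N (exp (s *\<^sub>R X) \<rhd> x) \<le> c * hnorm N x"
    and h': "\<And>s x. hnorm N (exp (s *\<^sub>R X') \<rhd> x) \<le> c * hnorm N x"
    and k: "\<And>x y. \<bar>inner ((Q * X - X' * Q) \<rhd> x) y\<bar> \<le> \<kappa> * hnorm N x * hnorm N y"
    and c: "0 \<le> c" and \<kappa>: "0 \<le> \<kappa>"
  shows "\<bar>inner ((Q * exp (\<tau> *\<^sub>R X) - exp (\<tau> *\<^sub>R X') * Q) \<rhd> f) g\<bar>
    \<le> \<bar>\<tau>\<bar> * \<kappa> * c\<^sup>2 * hnorm N f * hnorm N g"
proof -
  let ?F = "\<lambda>\<sigma>. inner ((exp (\<tau> *\<^sub>R X') * (exp (\<sigma> *\<^sub>R - X') * Q * exp (\<sigma> *\<^sub>R X))) \<rhd> f) g"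
  let ?F' = "\<lambda>\<sigma>. inner ((exp (\<tau> *\<^sub>R X') * (exp (\<sigma> *\<^sub>R - X') * (Q * X - X' * Q) * exp (\<sigma> *\<^sub>R X))) \<rhd> f) g"
  have d: "(?F has_vector_derivative ?F' \<sigma>) (at \<sigma> within UNIV)" for \<sigma>
    by (intro bounded_linear.has_vector_derivative[OF bounded_linear_inner_left]
        bounded_linear.has_vector_derivative[OF app.bounded_linear_left]
        has_vector_derivative_mult_right exp_conj_has_vector_derivative)
  have b: "norm (?F' \<sigma>) \<le> \<kappa> * (c * hnorm N f) * (c * hnorm N g)" for \<sigma>
  proof -
    let ?g = "exp (- (\<tau> - \<sigma>) *\<^sub>R X') \<rhd> g"
    have "exp (\<tau> *\<^sub>R X') * exp (\<sigma> *\<^sub>R - X') = exp ((\<tau> - \<sigma>) *\<^sub>R X')"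
      using exp_scaleR_add[of \<tau> "- \<sigma>" X'] by simp
    then have "?F' \<sigma> = inner (exp ((\<tau> - \<sigma>) *\<^sub>R X') \<rhd> (Q * X - X' * Q) \<rhd> exp (\<sigma> *\<^sub>R X) \<rhd> f) g"
      by (metis app_mult mult.assoc)
    also have "\<dots> = inner ((Q * X - X' * Q) \<rhd> exp (\<sigma> *\<^sub>R X) \<rhd> f) ?g"
      by (rule adjD[OF adj_exp_antisym[OF X']])
    finally have "norm (?F' \<sigma>) \<le> \<kappa> * hnorm N (exp (\<sigma> *\<^sub>R X) \<rhd> f) * hnorm N ?g"
      using k by simp
    also have "\<dots> \<le> \<kappa> * (c * hnorm N f) * (c * hnorm N g)"
      by (intro mult_mono h h' order_refl) (auto simp: \<kappa> c hnorm_nonneg)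
    finally show ?thesis .
  qed
  have "norm (?F \<tau> - ?F 0) \<le> \<kappa> * (c * hnorm N f) * (c * hnorm N g) * \<bar>\<tau> - 0\<bar>"
    by (rule vector_mean_value_bound[OF convex_UNIV d b]) auto
  moreover have "?F \<tau> = inner ((Q * exp (\<tau> *\<^sub>R X)) \<rhd> f) g"
    using exp_scaleR_minus[of \<tau> X'] by (simp add: mult.assoc[symmetric] del: app_mult)
  moreover have "?F 0 = inner ((exp (\<tau> *\<^sub>R X') * Q) \<rhd> f) g" by simp
  ultimately show ?thesis
    by (simp add: app.diff_left inner_diff_left power2_eq_square mult_ac)
qed

text \<open>Telescoping over the position where K is exchanged for K'. Powers of K act on x, those
  of K' pass to y through the adjoint K''; each factor costs b, and b >= 1 makes the exponents
  uniform.\<close>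

lemma intertwine_power:
  assumes k: "\<And>x y. \<bar>inner ((Q * K - K' * Q) \<rhd> x) y\<bar> \<le> \<delta> * hnorm N x * hnorm N y"
    and K: "\<And>x. hnorm N (K \<rhd> x) \<le> b * hnorm N x" and a: "adj K' K''"
    and K'': "\<And>x. hnorm N (K'' \<rhd> x) \<le> b * hnorm N x" and b: "1 \<le> b" and \<delta>: "0 \<le> \<delta>"
  shows "\<bar>inner ((Q * K ^ n - K' ^ n * Q) \<rhd> x) y\<bar> \<le> real n * \<delta> * b ^ n * hnorm N x * hnorm N y"
proof (induction n arbitrary: x)
  case (Suc n)
  have pw: "hnorm N (K'' ^ n \<rhd> y) \<le> b ^ n * hnorm N y" for n
  proof (induction n)
    case (Suc n)
    have "hnorm N (K'' \<rhd> K'' ^ n \<rhd> y) \<le> b * (b ^ n * hnorm N y)"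
      using order_trans[OF K'' mult_left_mono[OF Suc]] b by simp
    then show ?case by (simp add: mult.assoc)
  qed simp
  have "Q * K ^ Suc n - K' ^ Suc n * Q = (Q * K ^ n - K' ^ n * Q) * K + K' ^ n * (Q * K - K' * Q)"
    by (simp add: algebra_simps power_Suc2 del: power_Suc)
  then have "\<bar>inner ((Q * K ^ Suc n - K' ^ Suc n * Q) \<rhd> x) y\<bar>
      = \<bar>inner ((Q * K ^ n - K' ^ n * Q) \<rhd> K \<rhd> x) y + inner ((Q * K - K' * Q) \<rhd> x) (K'' ^ n \<rhd> y)\<bar>"
    using adjD[OF adj_power[OF a, of n], of "(Q * K - K' * Q) \<rhd> x" y]
    by (simp add: app.add_left inner_add_left del: power_Suc)
  also have "\<dots> \<le> real n * \<delta> * b ^ n * hnorm N (K \<rhd> x) * hnorm N y + \<delta> * hnorm N x * hnorm N (K'' ^ n \<rhd> y)"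
    by (rule order_trans[OF abs_triangle_ineq add_mono[OF Suc.IH k]])
  also have "\<dots> \<le> real n * \<delta> * b ^ n * (b * hnorm N x) * hnorm N y + \<delta> * hnorm N x * (b ^ n * hnorm N y)"
    using b \<delta> by (intro add_mono mult_mono K pw order_refl) (auto simp: hnorm_nonneg)
  also have "\<delta> * hnorm N x * (b ^ n * hnorm N y) \<le> \<delta> * hnorm N x * (b ^ Suc n * hnorm N y)"
    using b \<delta> by (intro mult_left_mono mult_right_mono power_increasing) (auto simp: hnorm_nonneg)
  finally show ?case by (simp add: algebra_simps)
qed (simp add: app.zero_left)

text \<open>With tau = t - r this is the compression of K(r).\<close>

definition kop :: "nat \<Rightarrow> (nat \<Rightarrow> complex) \<Rightarrow> real \<Rightarrow> ell2 endo" where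
  "kop N v \<tau> = exp (\<tau> *\<^sub>R gen N v) * tbshift N"

lemma hnorm_kop:
  assumes v: "wbound M v" shows "hnorm N (kop N v \<tau> \<rhd> x) \<le> 2 * (1 + 2 * M\<^sup>2) * hnorm N x"
proof -
  have "hnorm N (kop N v \<tau> \<rhd> x) \<le> (1 + 2 * M\<^sup>2) * hnorm N (tbshift N \<rhd> x)"
    unfolding kop_def app_mult by (rule hnorm_exp_gen[OF v])
  also have "\<dots> \<le> (1 + 2 * M\<^sup>2) * (2 * hnorm N x)"
    by (intro mult_left_mono hnorm_tbshift) auto
  finally show ?thesis by (simp only: mult_ac)
qed

lemma adj_kop: "adj (kop N v \<tau>) (trunc N * shift * exp (- \<tau> *\<^sub>R gen N v))"
  unfolding kop_def by (intro adj_mult adj_exp_antisym adj_gen adj_tbshift)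

lemma hnorm_kop_adj:
  assumes v: "wbound M v"
  shows "hnorm N ((trunc N * shift * exp (- \<tau> *\<^sub>R gen N v)) \<rhd> x) \<le> 2 * (1 + 2 * M\<^sup>2) * hnorm N x"
proof -
  have "hnorm N ((trunc N * shift) \<rhd> exp (- \<tau> *\<^sub>R gen N v) \<rhd> x) \<le> 2 * hnorm N (exp (- \<tau> *\<^sub>R gen N v) \<rhd> x)"
    by (rule hnorm_tbshift_adj)
  also have "\<dots> \<le> 2 * ((1 + 2 * M\<^sup>2) * hnorm N x)"
    by (intro mult_left_mono hnorm_exp_gen[OF v]) auto
  finally show ?thesis by (simp only: mult_ac app_mult)
qed

text \<open>For fixed N finitely many coefficients enter, so that differentiability of each Fourier
  coefficient in time gives differentiability in operator norm.\<close>

lemma ttoep_has_vector_derivative: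
  assumes "\<And>k. ((\<lambda>q. a q k) has_vector_derivative a' k) (at r within S)"
  shows "((\<lambda>q. ttoep N (a q)) has_vector_derivative ttoep N a') (at r within S)"
    "((\<lambda>q. ttoep_adj N (a q)) has_vector_derivative ttoep_adj N a') (at r within S)"
  unfolding ttoep_def ttoep_adj_def
  by (intro has_vector_derivative_mult_right has_vector_derivative_mult_left
      has_vector_derivative_sum bounded_linear.has_vector_derivative[OF bounded_linear_cop]
      bounded_linear.has_vector_derivative[OF bounded_linear_cnj] assms)+

lemma gen_has_vector_derivative:
  assumes "\<And>k. ((\<lambda>q. a q k) has_vector_derivative a' k) (at r within S)"
  shows "((\<lambda>q. gen N (a q)) has_vector_derivative gen_deriv N (a r) a') (at r within S)"
proof -
  note d = ttoep_has_vector_derivative[OF assms]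
  let ?T' = "ttoep N (a r) * ttoep_adj N a' + ttoep N a' * ttoep_adj N (a r)"
  have L: "((\<lambda>q. lax N (a q)) has_vector_derivative 0 - ?T') (at r within S)"
    unfolding lax_def
    by (intro has_vector_derivative_diff has_vector_derivative_const has_vector_derivative_mult d)
  have "((\<lambda>q. gen N (a q)) has_vector_derivative - (jop * ((0 - ?T') + (0 - ?T') + 0))) (at r within S)"
    unfolding gen_def
    by (intro has_vector_derivative_minus has_vector_derivative_mult_right has_vector_derivative_add
        has_vector_derivative_const L)
  moreover have "- (jop * ((0 - ?T') + (0 - ?T') + 0)) = gen_deriv N (a r) a'"
    by (simp add: gen_deriv_def algebra_simps)
  ultimately show ?thesis by simp
qed

text \<open>Up to \<open>o(q - r)\<close> and a truncation error of order \<open>1 / N\<close>, the operator \<open>1 + (q - r) B\<close>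
  intertwines the operators at the times \<open>r\<close> and \<open>q\<close>.\<close>

lemma kop_step:
  fixes a :: "real \<Rightarrow> nat \<Rightarrow> complex"
  assumes bnd_all: "\<forall>q\<in>S. wbound M (a q)" and r: "r \<in> S" and N: "0 < N"
    and der: "\<And>k. ((\<lambda>q. a q k) has_vector_derivative cs_field (a r) k) (at r within S)"
    and T_all: "\<forall>q\<in>S. \<bar>t - q\<bar> \<le> T" and \<eta>: "0 < \<eta>"
  shows "\<forall>\<^sub>F q in at r within S. \<forall>x y.
    \<bar>inner (((1 + (q - r) *\<^sub>R bop N (a r)) * kop N (a r) (t - r)
        - kop N (a q) (t - q) * (1 + (q - r) *\<^sub>R bop N (a r))) \<rhd> x) y\<bar>
      \<le> \<bar>q - r\<bar> * (((32 * M ^ 4 + 4 * M\<^sup>2) / real N + \<eta>) * (2 * T * (1 + 2 * M\<^sup>2) ^ 3 + (1 + 2 * M\<^sup>2)))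
        * hnorm N x * hnorm N y"
proof -
  note bnd = bspec[OF bnd_all] and T = bspec[OF T_all]
  let ?B = "bop N (a r)" and ?X = "gen N (a r)" and ?C = "tbshift N"
  let ?G = "gen_deriv N (a r) (cs_field (a r))"
  define c where "c = 1 + 2 * M\<^sup>2"
  define e where "e = (32 * M ^ 4 + 4 * M\<^sup>2) / real N + \<eta>"
  have c1: "1 \<le> c" by (simp add: c_def)
  have e0: "0 \<le> e" using \<eta> by (simp add: e_def)
  have T0: "0 \<le> T" using T[OF r] by linarith
  let ?Q = "\<lambda>q. 1 + (q - r) *\<^sub>R ?B"
  note did = has_vector_derivative_scaleR_diff
  have dQ: "(?Q has_vector_derivative ?B) (at r within S)"
    using has_vector_derivative_add[OF has_vector_derivative_const did, of 1 r ?B r S] by simp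
  \<comment> \<open>Remainder of first order: the defect of the intertwining of the generators is 0
    at q = r and has the derivative [B, X] - G there, with G the time derivative of the generator.
    Subtracting this linear term leaves o(q - r).\<close>
  let ?m1 = "\<lambda>q. ?Q q * ?X - gen N (a q) * ?Q q - (q - r) *\<^sub>R (?B * ?X - ?X * ?B - ?G)"
  have "(?m1 has_vector_derivative ?B * ?X - (gen N (a r) * ?B + ?G * ?Q r)
      - (?B * ?X - ?X * ?B - ?G)) (at r within S)"
    by (intro has_vector_derivative_diff has_vector_derivative_mult has_vector_derivative_mult_left
        gen_has_vector_derivative[OF der] dQ did)
  then have "(?m1 has_vector_derivative 0) (at r within S)" by simp
  from vanishing_derivative_bound[OF this _ \<eta>]
  have ev1: "\<forall>\<^sub>F q in at r within S. norm (?m1 q) \<le> \<eta> * \<bar>q - r\<bar>" by simp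
  \<comment> \<open>The same for the shift, combined with the exponential over the short time q - r;
    its linear term is the defect bounded by \<open>shift_error_bound\<close>.\<close>
  let ?m2 = "\<lambda>q. ?Q q * exp ((q - r) *\<^sub>R ?X) * ?C - ?C * ?Q q
      - (q - r) *\<^sub>R (?B * ?C + ?X * ?C - ?C * ?B)"
  have dexp: "((\<lambda>q. exp ((q - r) *\<^sub>R ?X)) has_vector_derivative ?X) (at r within S)"
  proof -
    have eq: "exp ((q - r) *\<^sub>R ?X) = exp (q *\<^sub>R ?X) * exp (- r *\<^sub>R ?X)" for q
      using exp_scaleR_add[of q "- r" ?X] by simp
    have "((\<lambda>q. exp (q *\<^sub>R ?X) * exp (- r *\<^sub>R ?X)) has_vector_derivative
        ?X * exp (r *\<^sub>R ?X) * exp (- r *\<^sub>R ?X)) (at r within S)"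
      by (intro has_vector_derivative_mult_left exp_scaleR_has_vector_derivative)
    moreover have "?X * exp (r *\<^sub>R ?X) * exp (- r *\<^sub>R ?X) = ?X"
      by (simp add: mult.assoc exp_scaleR_minus del: scaleR_minus_left)
    ultimately show ?thesis unfolding eq by simp
  qed
  have "(?m2 has_vector_derivative (?Q r * ?X + ?B * exp ((r - r) *\<^sub>R ?X)) * ?C - ?C * ?B
      - (?B * ?C + ?X * ?C - ?C * ?B)) (at r within S)"
    by (intro has_vector_derivative_diff has_vector_derivative_mult has_vector_derivative_mult_left
        has_vector_derivative_mult_right dexp dQ did)
  then have "(?m2 has_vector_derivative 0) (at r within S)" by (simp add: algebra_simps)
  from vanishing_derivative_bound[OF this _ \<eta>]
  have ev2: "\<forall>\<^sub>F q in at r within S. norm (?m2 q) \<le> \<eta> * \<bar>q - r\<bar>" by simp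
  have ev3: "\<forall>\<^sub>F q in at r within S. q \<in> S" by (simp add: eventually_at_filter)
  from ev1 ev2 ev3 show ?thesis
  proof eventually_elim
    case (elim q)
    let ?h = "q - r" and ?\<tau> = "t - q" and ?X' = "gen N (a q)" and ?Q = "1 + (q - r) *\<^sub>R ?B"
    have small: "\<bar>inner (Y \<rhd> x) y\<bar> \<le> \<bar>?h\<bar> * \<eta> * hnorm N x * hnorm N y" if "norm Y \<le> \<eta> * \<bar>?h\<bar>" for Y x y
    proof -
      have "\<bar>inner (Y \<rhd> x) y\<bar> \<le> norm (Y \<rhd> x) * norm y" by (rule Cauchy_Schwarz_ineq2)
      also have "\<dots> \<le> (\<eta> * \<bar>?h\<bar> * hnorm N x) * hnorm N y"
      proof (intro mult_mono norm_le_hnorm)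
        show "norm (Y \<rhd> x) \<le> \<eta> * \<bar>?h\<bar> * hnorm N x"
          by (rule order_trans[OF norm_app_le[OF that] mult_left_mono[OF norm_le_hnorm]]) (use \<eta> in simp)
      qed (use \<eta> in \<open>auto simp: hnorm_nonneg\<close>)
      finally show ?thesis by (simp add: mult_ac)
    qed
    have N32: "32 * M ^ 4 / real (Suc N) + \<eta> \<le> e" and N4: "4 * M\<^sup>2 / real N + \<eta> \<le> e"
    proof -
      have "32 * M ^ 4 / real (Suc N) \<le> 32 * M ^ 4 / real N"
        using N by (intro divide_left_mono) auto
      moreover have "0 \<le> 4 * M\<^sup>2 / real N" "0 \<le> 32 * M ^ 4 / real N" by auto
      ultimately show "32 * M ^ 4 / real (Suc N) + \<eta> \<le> e" "4 * M\<^sup>2 / real N + \<eta> \<le> e"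
        unfolding e_def add_divide_distrib by linarith+
    qed
    have k: "\<bar>inner ((?Q * ?X - ?X' * ?Q) \<rhd> x) y\<bar> \<le> (\<bar>?h\<bar> * e) * hnorm N x * hnorm N y" for x y
    proof -
      have I1: "inner ((?Q * ?X - ?X' * ?Q) \<rhd> x) y
          = inner (?m1 q \<rhd> x) y + ?h * inner ((?B * ?X - ?X * ?B - ?G) \<rhd> x) y"
        unfolding app.diff_left[of _ "?h *\<^sub>R _"] by (simp add: app.scaleR_left inner_diff_left)
      have "\<bar>inner ((?Q * ?X - ?X' * ?Q) \<rhd> x) y\<bar> \<le> \<bar>?h\<bar> * \<eta> * hnorm N x * hnorm N y
          + \<bar>?h\<bar> * (32 * M ^ 4 / real (Suc N) * hnorm N x * hnorm N y)"
        unfolding I1 by (rule order_trans[OF abs_triangle_ineq], unfold abs_mult)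
          (intro add_mono small elim mult_left_mono lax_pair_bound bnd r abs_ge_zero)
      also have "\<dots> = (\<bar>?h\<bar> * (32 * M ^ 4 / real (Suc N) + \<eta>)) * hnorm N x * hnorm N y"
        by (simp only: distrib_left distrib_right mult_ac add_ac)
      also have "\<dots> \<le> (\<bar>?h\<bar> * e) * hnorm N x * hnorm N y"
        by (intro mult_right_mono mult_left_mono N32) (auto simp: hnorm_nonneg)
      finally show ?thesis .
    qed
    show ?case
    proof (intro allI)
      fix x y
      let ?I1 = "inner ((?Q * exp (?\<tau> *\<^sub>R ?X) - exp (?\<tau> *\<^sub>R ?X') * ?Q) \<rhd> exp (?h *\<^sub>R ?X) \<rhd> ?C \<rhd> x) y"
      let ?I2 = "inner ((?Q * exp (?h *\<^sub>R ?X) * ?C - ?C * ?Q) \<rhd> x) (exp (- ?\<tau> *\<^sub>R ?X') \<rhd> y)"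
      \<comment> \<open>The time t - r splits into t - q, over which the Lax pair intertwines the
        two generators, and q - r, whose exponential is absorbed into the comparison of the
        shifts.\<close>
      have "exp ((t - r) *\<^sub>R ?X) = exp (?\<tau> *\<^sub>R ?X) * exp (?h *\<^sub>R ?X)"
        using exp_scaleR_add[of ?\<tau> ?h ?X] by simp
      then have "?Q * kop N (a r) (t - r) - kop N (a q) ?\<tau> * ?Q
        = (?Q * exp (?\<tau> *\<^sub>R ?X) - exp (?\<tau> *\<^sub>R ?X') * ?Q) * (exp (?h *\<^sub>R ?X) * ?C)
          + exp (?\<tau> *\<^sub>R ?X') * (?Q * exp (?h *\<^sub>R ?X) * ?C - ?C * ?Q)"
        unfolding kop_def by (simp only: left_diff_distrib right_diff_distrib mult.assoc) simp
      then have "inner ((?Q * kop N (a r) (t - r) - kop N (a q) ?\<tau> * ?Q) \<rhd> x) y = ?I1 + ?I2"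
        by (simp only: app.add_left inner_add_left app_mult adjD[OF adj_exp_antisym[OF adj_gen]])
      \<comment> \<open>The factor c^2 comes from the two exponentials in the Duhamel formula, the
        third c from the short exponential, and the 2 from the shift.\<close>
      moreover have "\<bar>?I1\<bar> \<le> \<bar>?h\<bar> * (e * (2 * T * c ^ 3)) * hnorm N x * hnorm N y"
      proof -
        have "\<bar>?I1\<bar> \<le> \<bar>?\<tau>\<bar> * (\<bar>?h\<bar> * e) * c\<^sup>2 * hnorm N (exp (?h *\<^sub>R ?X) \<rhd> ?C \<rhd> x) * hnorm N y"
          by (rule intertwine_exp[OF adj_gen adj_gen _ _ k])
            (use hnorm_exp_gen[OF bnd] r elim c1 e0 in \<open>auto simp: c_def\<close>)
        also have "\<dots> \<le> T * (\<bar>?h\<bar> * e) * c\<^sup>2 * (c * (2 * hnorm N x)) * hnorm N y"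
        proof (intro mult_right_mono mult_mono T elim order_refl)
          have "hnorm N (exp (?h *\<^sub>R ?X) \<rhd> ?C \<rhd> x) \<le> c * hnorm N (?C \<rhd> x)"
            using hnorm_exp_gen[OF bnd[OF r]] by (simp add: c_def)
          also have "\<dots> \<le> c * (2 * hnorm N x)"
            using c1 by (intro mult_left_mono hnorm_tbshift) auto
          finally show "hnorm N (exp (?h *\<^sub>R ?X) \<rhd> ?C \<rhd> x) \<le> c * (2 * hnorm N x)" .
        qed (use e0 T0 c1 in \<open>auto simp: hnorm_nonneg\<close>)
        finally show ?thesis by (simp add: power2_eq_square power3_eq_cube mult_ac)
      qed
      moreover have "\<bar>?I2\<bar> \<le> \<bar>?h\<bar> * (e * c) * hnorm N x * hnorm N y"
      proof -
        let ?y = "exp (- ?\<tau> *\<^sub>R ?X') \<rhd> y"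
        have I2: "?I2 = inner (?m2 q \<rhd> x) ?y + ?h * inner ((?B * ?C + ?X * ?C - ?C * ?B) \<rhd> x) ?y"
          unfolding app.diff_left[of _ "?h *\<^sub>R _"] by (simp add: app.scaleR_left inner_diff_left)
        have "\<bar>?I2\<bar> \<le> \<bar>?h\<bar> * \<eta> * hnorm N x * hnorm N ?y
            + \<bar>?h\<bar> * (4 * M\<^sup>2 / real N * hnorm N x * hnorm N ?y)"
          unfolding I2 by (rule order_trans[OF abs_triangle_ineq], unfold abs_mult)
            (intro add_mono small elim mult_left_mono shift_error_bound bnd r N abs_ge_zero)
        also have "\<dots> = (\<bar>?h\<bar> * (4 * M\<^sup>2 / real N + \<eta>)) * hnorm N x * hnorm N ?y"
          by (simp only: distrib_left distrib_right mult_ac add_ac)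
        also have "\<dots> \<le> (\<bar>?h\<bar> * e) * hnorm N x * (c * hnorm N y)"
          using hnorm_exp_gen[OF bnd[OF elim(3)]] e0
          by (intro mult_mono mult_left_mono N4) (auto simp: hnorm_nonneg c_def)
        finally show ?thesis by (simp add: mult_ac)
      qed
      ultimately have "\<bar>inner ((?Q * kop N (a r) (t - r) - kop N (a q) ?\<tau> * ?Q) \<rhd> x) y\<bar>
          \<le> \<bar>?h\<bar> * (e * (2 * T * c ^ 3)) * hnorm N x * hnorm N y + \<bar>?h\<bar> * (e * c) * hnorm N x * hnorm N y"
        by linarith
      also have "\<dots> = \<bar>?h\<bar> * (e * (2 * T * c ^ 3 + c)) * hnorm N x * hnorm N y"
        by (simp only: distrib_left distrib_right mult_ac)
      finally show "\<bar>inner ((?Q * kop N (a r) (t - r) - kop N (a q) ?\<tau> * ?Q) \<rhd> x) y\<bar>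
        \<le> \<bar>?h\<bar> * (((32 * M ^ 4 + 4 * M\<^sup>2) / real N + \<eta>) * (2 * T * (1 + 2 * M\<^sup>2) ^ 3 + (1 + 2 * M\<^sup>2)))
          * hnorm N x * hnorm N y"
        by (simp only: e_def c_def)
    qed
  qed
qed

lemma hnorm_ttoep_unit:
  assumes v: "wbound M v" shows "hnorm N (ttoep N v \<rhd> unit_vec 0 1) \<le> 2 * M"
proof -
  have "norm (ttoep N (\<lambda>k. of_nat k * v k)) \<le> M"
    by (rule norm_ttoep_deriv_wbound[OF v])
  moreover have "dop N \<rhd> ttoep N v \<rhd> unit_vec 0 1 = ttoep N (\<lambda>k. of_nat k * v k) \<rhd> unit_vec 0 1"
    using arg_cong[OF dop_ttoep[of N v], of "\<lambda>X. X \<rhd> unit_vec 0 1"]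
    by (simp add: app.add_left dop_unit_vec app.zero_right)
  ultimately show ?thesis
    using norm_app_le[OF norm_ttoep_wbound[OF v, of N], of "unit_vec 0 1"]
      norm_app_le[of "ttoep N (\<lambda>k. of_nat k * v k)" M "unit_vec 0 1"]
    by (simp add: hnorm_def)
qed

text \<open>The increment of Phi from r to q consists of the defect of u' = B u and of the
  intertwining defect of K^n, both O(|q - r| / N) up to o(q - r). Pairing with a complex c in the
  constant mode makes up for an inner product that sees only real parts, and the interval from 0 to
  t is covered for either sign of t.\<close>

lemma galerkin_drift:
  fixes a :: "real \<Rightarrow> nat \<Rightarrow> complex"
  defines "\<Phi> \<equiv> \<lambda>N n c t q. inner (kop N (a q) (t - q) ^ n \<rhd> ttoep N (a q) \<rhd> unit_vec 0 1) (unit_vec 0 c)"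
  assumes bnd: "\<And>q. q \<in> {min 0 t..max 0 t} \<Longrightarrow> wbound M (a q)"
    and der: "\<And>q k. q \<in> {min 0 t..max 0 t} \<Longrightarrow>
      ((\<lambda>q. a q k) has_vector_derivative cs_field (a q) k) (at q within {min 0 t..max 0 t})"
    and c1: "cmod c \<le> 1"
  shows "\<exists>K. \<forall>N>0. \<bar>\<Phi> N n c t t - \<Phi> N n c t 0\<bar> \<le> K / real N"
proof -
  let ?S = "{min 0 t..max 0 t}"
  define b where "b = 2 * (1 + 2 * M\<^sup>2)"
  define T where "T = \<bar>t\<bar>"
  define c4 where "c4 = 2 * T * (1 + 2 * M\<^sup>2) ^ 3 + (1 + 2 * M\<^sup>2)"
  \<comment> \<open>Sum of the constants of the three error bounds. C0 below collects the growth b^n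
    of the n-th powers and the factor that \<open>intertwine_power\<close> produces on u.\<close>
  define \<kappa> where "\<kappa> = 32 * M ^ 4 + 4 * M\<^sup>2 + 4 * M ^ 3"
  define C0 where "C0 = b ^ n + real n * c4 * b ^ n * (2 * M)"
  have "0 \<in> ?S" by auto
  then have M: "0 \<le> M" using bnd wbound_summable(5) by blast
  have b1: "1 \<le> b" by (simp add: b_def add_increasing2)
  have bnd_all: "\<forall>q\<in>?S. wbound M (a q)" and T_all: "\<forall>q\<in>?S. \<bar>t - q\<bar> \<le> T"
    using bnd by (auto simp: T_def)
  have c40: "0 \<le> c4" by (simp add: c4_def T_def)
  have C00: "0 \<le> C0" using b1 c40 M by (simp add: C0_def)
  have main: "\<bar>\<Phi> N n c t t - \<Phi> N n c t 0\<bar> \<le> (\<kappa> * C0 * T) / real N" if N: "0 < N" for N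
  proof -
    let ?\<Phi> = "\<Phi> N n c t"
    let ?g = "unit_vec 0 c"
    have step: "\<forall>\<^sub>F q in at r within ?S. \<bar>?\<Phi> q - ?\<Phi> r\<bar> \<le> (\<kappa> / real N * C0 + \<epsilon>) * \<bar>q - r\<bar>"
      if r: "r \<in> ?S" and \<epsilon>: "0 < \<epsilon>" for r \<epsilon>
    proof -
      \<comment> \<open>Small enough that the o(q - r) terms, multiplied by C0, stay below
        epsilon.\<close>
      define \<eta> where "\<eta> = \<epsilon> / (C0 + 1)"
      have \<eta>: "0 < \<eta>" using \<epsilon> C00 by (simp add: \<eta>_def)
      have \<eta>C: "\<eta> * C0 \<le> \<epsilon>" using \<epsilon> C00 by (simp add: \<eta>_def field_simps)
      let ?B = "bop N (a r)" and ?K = "kop N (a r) (t - r)"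
      let ?U = "\<lambda>q. ttoep N (a q) \<rhd> unit_vec 0 1"
      let ?E = "ttoep N (cs_field (a r)) \<rhd> unit_vec 0 1 - ?B \<rhd> ?U r"
      let ?Q = "\<lambda>q. 1 + (q - r) *\<^sub>R ?B"
      \<comment> \<open>Taylor remainder of u at r, with the derivative split into B u and the
        compression defect \<open>?E\<close>.\<close>
      let ?m = "\<lambda>q. ?U q - ?U r - (q - r) *\<^sub>R (?B \<rhd> ?U r) - (q - r) *\<^sub>R ?E"
      have "(?m has_vector_derivative ttoep N (cs_field (a r)) \<rhd> unit_vec 0 1 - 0 - ?B \<rhd> ?U r - ?E) (at r within ?S)"
        by (intro has_vector_derivative_diff has_vector_derivative_const has_vector_derivative_scaleR_diff
            bounded_linear.has_vector_derivative[OF app.bounded_linear_left] ttoep_has_vector_derivative der r)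
      then have "(?m has_vector_derivative 0) (at r within ?S)" by simp
      from vanishing_derivative_bound[OF this _ \<eta>]
      have ev1: "\<forall>\<^sub>F q in at r within ?S. norm (?m q) \<le> \<eta> * \<bar>q - r\<bar>" by simp
      have ev2: "\<forall>\<^sub>F q in at r within ?S. q \<in> ?S" by (simp add: eventually_at_filter)
      from ev1 ev2 kop_step[OF bnd_all r N der[OF r] T_all \<eta>] show ?thesis
      proof eventually_elim
        case (elim q)
        let ?K' = "kop N (a q) (t - q)" and ?h = "q - r"
        let ?K'' = "trunc N * shift * exp (- (t - q) *\<^sub>R gen N (a q))"
        let ?e = "(32 * M ^ 4 + 4 * M\<^sup>2) / real N + \<eta>"
        have e0: "0 \<le> ?e" using \<eta> by simp
        have hg: "hnorm N ?g \<le> 1" using c1 by (simp add: hnorm_def dop_unit_vec)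
        have pw: "hnorm N (?K'' ^ m \<rhd> ?g) \<le> b ^ m" for m
        proof (induction m)
          case (Suc m)
          have "hnorm N (?K'' \<rhd> ?K'' ^ m \<rhd> ?g) \<le> b * hnorm N (?K'' ^ m \<rhd> ?g)"
            unfolding b_def by (rule hnorm_kop_adj[OF bnd[OF elim(2)]])
          also have "\<dots> \<le> b * b ^ m" using b1 Suc by (intro mult_left_mono) auto
          finally show ?case by simp
        qed (use hg in simp)
        have P: "\<bar>inner ((?Q q * ?K ^ n - ?K' ^ n * ?Q q) \<rhd> ?U r) ?g\<bar>
            \<le> real n * (\<bar>?h\<bar> * (?e * c4)) * b ^ n * hnorm N (?U r) * hnorm N ?g"
          unfolding b_def
          by (rule intertwine_power[OF _ hnorm_kop[OF bnd[OF r]] adj_kop hnorm_kop_adj[OF bnd[OF elim(2)]]])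
            (use elim(3) e0 c40 in \<open>auto simp: c4_def add_increasing2\<close>)
        also have "\<dots> \<le> real n * (\<bar>?h\<bar> * (?e * c4)) * b ^ n * (2 * M) * 1"
          using e0 c40 b1 M
          by (intro mult_mono hg hnorm_ttoep_unit[OF bnd[OF r]] order_refl) (auto simp: hnorm_nonneg)
        also have "\<dots> = \<bar>?h\<bar> * (?e * (real n * c4 * b ^ n * (2 * M)))" by (simp add: mult_ac)
        also have "\<dots> \<le> \<bar>?h\<bar> * ((\<kappa> / real N + \<eta>) * (real n * c4 * b ^ n * (2 * M)))"
          using M N c40 b1
          by (intro mult_left_mono mult_right_mono add_right_mono divide_right_mono) (auto simp: \<kappa>_def)
        finally have 1: "\<bar>inner ((?Q q * ?K ^ n - ?K' ^ n * ?Q q) \<rhd> ?U r) ?g\<bar>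
            \<le> \<bar>?h\<bar> * ((\<kappa> / real N + \<eta>) * (real n * c4 * b ^ n * (2 * M)))" .
        let ?y = "?K'' ^ n \<rhd> ?g"
        have "\<bar>inner (?U q - ?Q q \<rhd> ?U r) ?y\<bar> = \<bar>inner (?m q) ?y + ?h * inner ?E ?y\<bar>"
          by (simp add: app_simps inner_diff_left inner_add_left algebra_simps)
        also have "\<dots> \<le> norm (?m q) * norm ?y + \<bar>?h\<bar> * (4 * M ^ 3 / real (Suc N) * hnorm N ?y)"
          by (rule order_trans[OF abs_triangle_ineq], unfold abs_mult)
            (intro add_mono Cauchy_Schwarz_ineq2 mult_left_mono field_error_bound bnd r abs_ge_zero)
        also have "\<dots> \<le> (\<eta> * \<bar>?h\<bar>) * b ^ n + \<bar>?h\<bar> * (4 * M ^ 3 / real (Suc N) * b ^ n)"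
          using M \<eta> order_trans[OF norm_le_hnorm pw]
          by (intro add_mono mult_mono mult_left_mono pw elim) auto
        also have "\<dots> = \<bar>?h\<bar> * ((4 * M ^ 3 / real (Suc N) + \<eta>) * b ^ n)"
          by (simp only: distrib_left distrib_right mult_ac add_ac)
        also have "\<dots> \<le> \<bar>?h\<bar> * ((\<kappa> / real N + \<eta>) * b ^ n)"
        proof -
          have "4 * M ^ 3 / real (Suc N) \<le> \<kappa> / real N"
            using M N by (intro frac_le) (auto simp: \<kappa>_def)
          then show ?thesis using b1 by (intro mult_left_mono mult_right_mono) auto
        qed
        finally have 2: "\<bar>inner (?U q - ?Q q \<rhd> ?U r) ?y\<bar> \<le> \<bar>?h\<bar> * ((\<kappa> / real N + \<eta>) * b ^ n)" .
        \<comment> \<open>B is antisymmetric and annihilates constants, so 1 + (q - r) B may be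
          inserted into the pairing at time r without changing it.\<close>
        have Bg: "inner (?B \<rhd> x) ?g = 0" for x
          by (simp add: adjD[OF adj_bop] app.minus_left bop_unit_vec)
        have "?\<Phi> r = inner ((?Q q * ?K ^ n) \<rhd> ?U r) ?g"
          by (simp add: \<Phi>_def app_simps inner_add_left Bg)
        moreover have "?\<Phi> q = inner ((?K' ^ n * ?Q q) \<rhd> ?U r) ?g + inner (?U q - ?Q q \<rhd> ?U r) ?y"
          unfolding adjD[OF adj_power[OF adj_kop], symmetric]
          by (simp add: \<Phi>_def app.diff_right inner_diff_left)
        ultimately have "?\<Phi> q - ?\<Phi> r = inner (?U q - ?Q q \<rhd> ?U r) ?y - inner ((?Q q * ?K ^ n - ?K' ^ n * ?Q q) \<rhd> ?U r) ?g"
          by (simp add: app.diff_left inner_diff_left del: app_mult)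
        then have "\<bar>?\<Phi> q - ?\<Phi> r\<bar> \<le> \<bar>?h\<bar> * ((\<kappa> / real N + \<eta>) * b ^ n)
            + \<bar>?h\<bar> * ((\<kappa> / real N + \<eta>) * (real n * c4 * b ^ n * (2 * M)))"
          using 1 2 by linarith
        also have "\<dots> = \<bar>?h\<bar> * (\<kappa> / real N * C0 + \<eta> * C0)"
          by (simp only: C0_def distrib_left distrib_right mult_ac add_ac)
        also have "\<dots> \<le> \<bar>?h\<bar> * (\<kappa> / real N * C0 + \<epsilon>)" using \<eta>C by (intro mult_left_mono) auto
        finally show ?case by (simp only: mult.commute)
      qed
    qed
    have "\<bar>?\<Phi> (max 0 t) - ?\<Phi> (min 0 t)\<bar> \<le> \<kappa> / real N * C0 * (max 0 t - min 0 t)"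
      by (rule dini_bound[OF _ step]) auto
    moreover have "max 0 t - min 0 t = T" by (auto simp: T_def)
    \<comment> \<open>For t < 0 the end points are interchanged, which the absolute value
      hides.\<close>
    moreover have "\<bar>?\<Phi> (max 0 t) - ?\<Phi> (min 0 t)\<bar> = \<bar>?\<Phi> t - ?\<Phi> 0\<bar>"
      by (cases "0 \<le> t") (auto simp: max_def min_def)
    ultimately show ?thesis by (simp add: mult_ac)
  qed
  then show ?thesis by blast
qed

section \<open>The unitary group generated by the Lax operator\<close>

lemma tendsto_at_zero_minus:
  fixes f :: "real \<Rightarrow> 'a::topological_space"
  assumes "(f \<longlongrightarrow> l) (at 0)" shows "((\<lambda>h. f (- h)) \<longlongrightarrow> l) (at 0)"
  using assms filtermap_at_minus[of "0 :: real"] by (simp add: filterlim_def filtermap_filtermap[symmetric, where f = f and g = uminus])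

lemma norm_add_diff_le: "norm (a + b - c) \<le> norm a + norm b + norm c" for a :: "'a::real_normed_vector"
  using norm_triangle_ineq[of a b] norm_triangle_ineq4[of "a + b" c] by linarith

lemma has_vector_derivative_if_LIM:
  fixes f :: "real \<Rightarrow> 'a::real_normed_vector"
  assumes "((\<lambda>h. (1 / h) *\<^sub>R (f (t + h) - f t)) \<longlongrightarrow> d) (at 0)"
  shows "(f has_vector_derivative d) (at t)"
proof -
  have "norm ((1 / h) *\<^sub>R (f (t + h) - f t) - d) = norm (f (t + h) - f t - h *\<^sub>R d) / norm h" if "h \<noteq> 0" for h
  proof -
    have "(1 / h) *\<^sub>R (f (t + h) - f t) - d = (1 / h) *\<^sub>R (f (t + h) - f t - h *\<^sub>R d)"
      using that by (simp add: scaleR_diff_right)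
    then show ?thesis by simp
  qed
  moreover have "((\<lambda>h. norm ((1 / h) *\<^sub>R (f (t + h) - f t) - d)) \<longlongrightarrow> 0) (at 0)"
    using assms LIM_zero tendsto_norm_zero by blast
  ultimately have "((\<lambda>h. norm (f (t + h) - f t - h *\<^sub>R d) / norm h) \<longlongrightarrow> 0) (at 0)"
    by (auto intro: Lim_transform_eventually simp: eventually_at_filter)
  then show ?thesis
    by (simp add: has_vector_derivative_def has_derivative_at bounded_linear_scaleR_left)
qed

definition xop :: "nat \<Rightarrow> (nat \<Rightarrow> complex) \<Rightarrow> ell2 endo" where
  "xop N v = jop * lax N v"

definition dom1 :: "ell2 set" where
  "dom1 = {x. summable (\<lambda>n. (cmod (of_nat n * coef x n))\<^sup>2)}"

text \<open>Meaningful on \<open>dom1\<close> only, where the weighted sequence is again square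
  summable.\<close>

definition dfull :: "ell2 \<Rightarrow> ell2" where
  "dfull x = Abs_ell2 (\<lambda>n. of_nat n * coef x n)"

definition laxfull :: "(nat \<Rightarrow> complex) \<Rightarrow> ell2 \<Rightarrow> ell2" where
  "laxfull v x = dfull x - toep v \<rhd> toep_adj v \<rhd> x"

text \<open>\<open>xop N v\<close> vanishes on the modes above N, so each approximating group is the
  identity there and acts isometrically on all of \<open>ell2\<close>.\<close>

definition lim_group :: "(nat \<Rightarrow> complex) \<Rightarrow> real \<Rightarrow> ell2 \<Rightarrow> ell2" where
  "lim_group v t x = lim (\<lambda>N. exp (t *\<^sub>R xop N v) \<rhd> x)"

lemma coef_dfull: "x \<in> dom1 \<Longrightarrow> coef (dfull x) n = of_nat n * coef x n"
  by (simp add: dfull_def dom1_def Abs_ell2_inverse)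

lemma dom1I: "(\<And>n. of_nat n * coef x n = coef y n) \<Longrightarrow> x \<in> dom1"
  by (simp add: dom1_def summable_coef)

lemma dfull_eqI: "(\<And>n. of_nat n * coef x n = coef y n) \<Longrightarrow> dfull x = y"
  by (rule ell2_eqI) (simp add: coef_dfull dom1I)

lemma dom1_cop:
  assumes "x \<in> dom1" shows "cop c \<rhd> x \<in> dom1" "dfull (cop c \<rhd> x) = cop c \<rhd> dfull x"
proof -
  have "of_nat n * coef (cop c \<rhd> x) n = coef (cop c \<rhd> dfull x) n" for n
    using assms by (simp add: coef_dfull coef_cop algebra_simps)
  then show "cop c \<rhd> x \<in> dom1" "dfull (cop c \<rhd> x) = cop c \<rhd> dfull x" by (rule dom1I, rule dfull_eqI)
qed

lemma dom1_unit_vec: "unit_vec k c \<in> dom1" "dfull (unit_vec k c) = unit_vec k (of_nat k * c)"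
  by (rule dom1I[of _ "unit_vec k (of_nat k * c)"] dfull_eqI; simp add: coef_unit_vec)+

lemma dom1_trunc: "trunc N \<rhd> x \<in> dom1"
  by (rule dom1I[of _ "dop N \<rhd> x"]) (simp add: coef_trunc coef_dop)

lemma dop_eq_dfull: "x \<in> dom1 \<Longrightarrow> dop N \<rhd> x = trunc N \<rhd> dfull x"
  by (rule ell2_eqI) (simp add: coef_dop coef_trunc coef_dfull)

lemma norm_dop_dfull: "x \<in> dom1 \<Longrightarrow> norm (dop N \<rhd> x) \<le> norm (dfull x)"
  by (simp add: dop_eq_dfull norm_trunc_app)

lemma adj_xop: "adj (xop N v) (- xop N v)"
  unfolding xop_def by (rule adj_jop_lax)

lemma xop_commute_lax: "xop N v * lax N v = lax N v * xop N v"
  unfolding xop_def by (metis cop_commute_lax mult.assoc)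

lemma hnorm_exp_xop: "wbound M v \<Longrightarrow> hnorm N (exp (s *\<^sub>R xop N v) \<rhd> x) \<le> (1 + 2 * M\<^sup>2) * hnorm N x"
  by (rule hnorm_exp_commuting[OF _ adj_xop xop_commute_lax])

lemma norm_exp_xop: "norm (exp (s *\<^sub>R xop N v) \<rhd> x) = norm x"
  by (rule norm_exp_antisym[OF adj_xop])

lemma cop_commute_xop: "cop c * xop N v = xop N v * cop c"
proof -
  have "cop c * xop N v = (cop c * jop) * lax N v" by (simp only: xop_def mult.assoc)
  also have "cop c * jop = jop * cop c" by (simp only: cop_mult[symmetric] mult.commute)
  also have "jop * cop c * lax N v = xop N v * cop c"
    by (simp only: xop_def mult.assoc cop_commute_lax[of c])
  finally show ?thesis .
qed

lemma cop_commute_exp_xop: "cop c * exp (s *\<^sub>R xop N v) = exp (s *\<^sub>R xop N v) * cop c"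
proof (rule commute_exp)
  have "cop c * xop N v = xop N v * cop c" by (rule cop_commute_xop)
  then show "cop c * s *\<^sub>R xop N v = s *\<^sub>R xop N v * cop c" by simp
qed

lemma trunc_commute_exp_xop: "trunc N * exp (s *\<^sub>R xop N v) = exp (s *\<^sub>R xop N v) * trunc N"
proof (rule commute_exp)
  have "trunc N * lax N v = lax N v * trunc N"
  proof -
    have "trunc N * (ttoep N v * ttoep_adj N v) = ttoep N v * ttoep_adj N v"
      by (metis mult.assoc trunc_ttoep)
    moreover have "ttoep_adj N v * trunc N = ttoep_adj N v"
      by (metis adj_mult adj_trunc adj_ttoep adj_unique trunc_ttoep)
    ultimately show ?thesis
      by (simp add: lax_def algebra_simps trunc_dop dop_trunc)
  qed
  then have "trunc N * xop N v = xop N v * trunc N"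
    unfolding xop_def by (metis cop_commute_trunc mult.assoc)
  then show "trunc N * s *\<^sub>R xop N v = s *\<^sub>R xop N v * trunc N" by simp
qed

text \<open>On the modes above N and up to K, D is at least N + 1.\<close>

lemma norm_trunc_diff:
  assumes "N \<le> K" shows "norm (trunc K \<rhd> x - trunc N \<rhd> x) \<le> norm (dop K \<rhd> x) / real (Suc N)"
proof -
  have "norm (real (Suc N) *\<^sub>R (trunc K \<rhd> x - trunc N \<rhd> x)) \<le> norm (dop K \<rhd> x)"
  proof (rule norm_ell2_le)
    fix n
    show "cmod (coef (real (Suc N) *\<^sub>R (trunc K \<rhd> x - trunc N \<rhd> x)) n) \<le> cmod (coef (dop K \<rhd> x) n)"
    proof (cases "N < n \<and> n \<le> K")
      case True
      then have "real (Suc N) * cmod (coef x n) \<le> real n * cmod (coef x n)"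
        by (intro mult_right_mono) auto
      with True show ?thesis
        by (simp add: coef_trunc coef_dop norm_mult del: of_nat_Suc)
    qed (use assms in \<open>auto simp: coef_trunc coef_dop\<close>)
  qed
  then have "real (Suc N) * norm (trunc K \<rhd> x - trunc N \<rhd> x) \<le> norm (dop K \<rhd> x)"
    by (simp only: norm_scaleR abs_of_nat)
  then show ?thesis by (simp add: field_simps del: of_nat_Suc)
qed

text \<open>Duhamel again, now between the levels N and K with the projection as intertwiner. What
  acts on the modes between N and K is O(1/N) because the group at level K preserves H^1
  uniformly.\<close>

lemma galerkin_compare:
  assumes v: "wbound M v" and NK: "N \<le> K" and x: "x \<in> dom1"
  shows "norm (trunc K \<rhd> exp (t *\<^sub>R xop K v) \<rhd> x - trunc N \<rhd> exp (t *\<^sub>R xop N v) \<rhd> x)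
    \<le> (1 + \<bar>t\<bar> * M\<^sup>2) * (1 + 2 * M\<^sup>2) * (norm x + norm (dfull x)) / real (Suc N)"
proof -
  let ?c = "(1 + 2 * M\<^sup>2) * (norm x + norm (dfull x))"
  let ?P = "trunc N" and ?XN = "xop N v" and ?XK = "xop K v"
  note sv = wbound_summable(1)[OF v]
  have dK: "norm (dop K \<rhd> exp (s *\<^sub>R ?XK) \<rhd> x) \<le> ?c" for s
  proof -
    have "norm (dop K \<rhd> exp (s *\<^sub>R ?XK) \<rhd> x) \<le> (1 + 2 * M\<^sup>2) * hnorm K x"
      by (rule order_trans[OF norm_dop_le_hnorm hnorm_exp_xop[OF v]])
    also have "\<dots> \<le> ?c"
      unfolding hnorm_def by (intro mult_left_mono add_left_mono norm_dop_dfull x) auto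
    finally show ?thesis .
  qed
  have PP: "?P * trunc K = ?P" "?P * dop K = dop N" "trunc K * ?P = ?P"
    using NK by (intro endo_eqI ell2_eqI; simp add: coef_trunc coef_dop)+
  \<comment> \<open>D commutes with the projections, so only the product T_u T_{u bar} contributes,
    on the modes that the level N does not see.\<close>
  have diff: "?P * ?XK - ?XN * ?P = - (jop * (?P * toep v * toep_adj v * (trunc K - ?P)))"
  proof -
    have "?P * lax K v - lax N v * ?P = - (?P * toep v * toep_adj v * (trunc K - ?P))"
    proof -
      have "?P * (trunc K * toep v * (toep_adj v * trunc K)) = ?P * toep v * toep_adj v * trunc K"
        by (metis PP(1) mult.assoc)
      moreover have "?P * toep v * (toep_adj v * ?P) * ?P = ?P * toep v * toep_adj v * ?P"
        by (metis mult.assoc trunc_trunc)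
      ultimately show ?thesis
        unfolding lax_def ttoep_eq[OF sv] ttoep_adj_eq[OF sv]
        by (simp add: right_diff_distrib left_diff_distrib PP dop_trunc)
    qed
    moreover have "?P * ?XK - ?XN * ?P = jop * (?P * lax K v - lax N v * ?P)"
      unfolding xop_def right_diff_distrib by (metis cop_commute_trunc mult.assoc)
    ultimately show ?thesis by simp
  qed
  let ?F = "\<lambda>\<sigma>. (exp (t *\<^sub>R ?XN) * (exp (\<sigma> *\<^sub>R - ?XN) * ?P * exp (\<sigma> *\<^sub>R ?XK))) \<rhd> x"
  let ?F' = "\<lambda>\<sigma>. (exp (t *\<^sub>R ?XN) * (exp (\<sigma> *\<^sub>R - ?XN) * (?P * ?XK - ?XN * ?P) * exp (\<sigma> *\<^sub>R ?XK))) \<rhd> x"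
  have d: "(?F has_vector_derivative ?F' \<sigma>) (at \<sigma> within UNIV)" for \<sigma>
    by (intro bounded_linear.has_vector_derivative[OF app.bounded_linear_left]
        has_vector_derivative_mult_right exp_conj_has_vector_derivative)
  have b: "norm (?F' \<sigma>) \<le> M\<^sup>2 * (?c / real (Suc N))" for \<sigma>
  proof -
    let ?y = "exp (\<sigma> *\<^sub>R ?XK) \<rhd> x"
    have "exp (\<sigma> *\<^sub>R - ?XN) = exp ((- \<sigma>) *\<^sub>R ?XN)" by simp
    then have "norm (?F' \<sigma>) = norm ((?P * ?XK - ?XN * ?P) \<rhd> ?y)"
      by (simp add: norm_exp_xop del: scaleR_minus_left scaleR_minus_right)
    also have "\<dots> = norm (?P \<rhd> toep v \<rhd> toep_adj v \<rhd> (trunc K \<rhd> ?y - ?P \<rhd> ?y))"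
      unfolding diff by (simp add: app.minus_left norm_cop_app app.diff_left)
    also have "\<dots> \<le> M * (M * norm (trunc K \<rhd> ?y - ?P \<rhd> ?y))"
    proof (rule order_trans[OF norm_trunc_app order_trans[OF norm_app_le[OF norm_toep_wbound(1)[OF v]] mult_left_mono]])
      show "norm (toep_adj v \<rhd> (trunc K \<rhd> ?y - ?P \<rhd> ?y)) \<le> M * norm (trunc K \<rhd> ?y - ?P \<rhd> ?y)"
        using norm_app_le[of "toep_adj v" M] norm_adj[OF adj_toep[OF sv]] norm_toep_wbound(1)[OF v] by simp
    qed (rule wbound_summable(5)[OF v])
    also have "\<dots> = M\<^sup>2 * norm (trunc K \<rhd> ?y - ?P \<rhd> ?y)" by (simp add: power2_eq_square)
    also have "\<dots> \<le> M\<^sup>2 * (?c / real (Suc N))"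
      by (intro mult_left_mono order_trans[OF norm_trunc_diff[OF NK]] divide_right_mono dK) auto
    finally show ?thesis .
  qed
  have "norm (?F t - ?F 0) \<le> M\<^sup>2 * (?c / real (Suc N)) * \<bar>t - 0\<bar>"
    by (rule vector_mean_value_bound[OF convex_UNIV d b]) auto
  moreover have "?F t = ?P \<rhd> exp (t *\<^sub>R ?XK) \<rhd> x"
    using exp_scaleR_minus[of t ?XN] by (simp add: mult.assoc[symmetric] del: app_mult) simp
  moreover have "?F 0 = ?P \<rhd> exp (t *\<^sub>R ?XN) \<rhd> x"
    by (simp add: app_mult[symmetric] trunc_commute_exp_xop del: app_mult)
  ultimately have 1: "norm (?P \<rhd> exp (t *\<^sub>R ?XK) \<rhd> x - ?P \<rhd> exp (t *\<^sub>R ?XN) \<rhd> x)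
      \<le> \<bar>t\<bar> * M\<^sup>2 * ?c / real (Suc N)" by (simp add: mult_ac)
  \<comment> \<open>The modes between N and K of the finer approximation, which the comparison after
    projection leaves out.\<close>
  have 2: "norm (trunc K \<rhd> exp (t *\<^sub>R ?XK) \<rhd> x - ?P \<rhd> exp (t *\<^sub>R ?XK) \<rhd> x) \<le> ?c / real (Suc N)"
    by (rule order_trans[OF norm_trunc_diff[OF NK] divide_right_mono[OF dK]]) simp
  have "norm (trunc K \<rhd> exp (t *\<^sub>R ?XK) \<rhd> x - ?P \<rhd> exp (t *\<^sub>R ?XN) \<rhd> x)
      \<le> ?c / real (Suc N) + \<bar>t\<bar> * M\<^sup>2 * ?c / real (Suc N)"
    using norm_triangle_ineq[of "trunc K \<rhd> exp (t *\<^sub>R ?XK) \<rhd> x - ?P \<rhd> exp (t *\<^sub>R ?XK) \<rhd> x"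
      "?P \<rhd> exp (t *\<^sub>R ?XK) \<rhd> x - ?P \<rhd> exp (t *\<^sub>R ?XN) \<rhd> x"] 1 2 by simp
  also have "\<dots> = (1 + \<bar>t\<bar> * M\<^sup>2) * (1 + 2 * M\<^sup>2) * (norm x + norm (dfull x)) / real (Suc N)"
    by (simp only: add_divide_distrib[symmetric] distrib_right mult_1 mult.assoc)
  finally show ?thesis .
qed

text \<open>The counterpart on sequences of \<open>unitary_group_generated_by\<close>. The last
  clause is an equivalence and so prescribes the domain of the generator exactly.\<close>

definition lax_group :: "(nat \<Rightarrow> complex) \<Rightarrow> (real \<Rightarrow> ell2 \<Rightarrow> ell2) \<Rightarrow> bool" where
  "lax_group v W \<longleftrightarrow> (\<forall>t x y. W t (x + y) = W t x + W t y) \<and> (\<forall>t c x. W t (cop c \<rhd> x) = cop c \<rhd> W t x) \<and>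
     (\<forall>t x. norm (W t x) = norm x) \<and> (\<forall>x. W 0 x = x) \<and> (\<forall>s t x. W (s + t) x = W s (W t x)) \<and>
     (\<forall>x g. (x \<in> dom1 \<and> laxfull v x = g) \<longleftrightarrow> ((\<lambda>h. (1 / h) *\<^sub>R (W h x - x)) \<longlongrightarrow> jop \<rhd> g) (at 0))"

context
  fixes M :: real and v :: "nat \<Rightarrow> complex"
  assumes v: "wbound M v"
begin

abbreviation "gexp N t \<equiv> exp (t *\<^sub>R xop N v)"
abbreviation "glim \<equiv> lim_group v"

text \<open>\<open>galerkin_compare\<close> concerns the truncated evolutions. Truncation commutes
  with the group and the group is isometric, so that the discarded part has the norm of the tail of
  x.\<close>

lemma Cauchy_dom1:
  assumes x: "x \<in> dom1" shows "Cauchy (\<lambda>N. gexp N t \<rhd> x)"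
proof -
  let ?C = "(1 + \<bar>t\<bar> * M\<^sup>2) * (1 + 2 * M\<^sup>2) * (norm x + norm (dfull x))"
  have "Cauchy (\<lambda>N. trunc N \<rhd> gexp N t \<rhd> x)"
  proof (rule metric_CauchyI)
    fix e :: real assume e: "0 < e"
    obtain n0 where n0: "?C / e < real n0" using reals_Archimedean2 by blast
    have lt: "norm (trunc K \<rhd> gexp K t \<rhd> x - trunc N \<rhd> gexp N t \<rhd> x) < e" if "n0 \<le> N" "N \<le> K" for N K
    proof -
      have "?C / real (Suc N) < e"
      proof -
        have "?C < e * real n0" using n0 e by (simp add: field_simps)
        also have "\<dots> \<le> e * real (Suc N)" using that e by simp
        finally show ?thesis by (simp add: field_simps)
      qed
      then show ?thesis using galerkin_compare[OF v that(2) x, of t] by linarith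
    qed
    have "dist (trunc m \<rhd> gexp m t \<rhd> x) (trunc n \<rhd> gexp n t \<rhd> x) < e" if "n0 \<le> m" "n0 \<le> n" for m n
      using lt[of m n] lt[of n m] that by (cases "m \<le> n") (auto simp: dist_norm norm_minus_commute)
    then show "\<exists>n0. \<forall>m\<ge>n0. \<forall>n\<ge>n0. dist (trunc m \<rhd> gexp m t \<rhd> x) (trunc n \<rhd> gexp n t \<rhd> x) < e" by blast
  qed
  then obtain y where y: "(\<lambda>N. trunc N \<rhd> gexp N t \<rhd> x) \<longlonglongrightarrow> y"
    using Cauchy_convergent convergent_def by blast
  have "(\<lambda>N. gexp N t \<rhd> (trunc N \<rhd> x - x)) \<longlonglongrightarrow> 0"
  proof (rule tendsto_norm_zero_cancel)
    show "(\<lambda>N. norm (gexp N t \<rhd> (trunc N \<rhd> x - x))) \<longlonglongrightarrow> 0"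
      unfolding norm_exp_xop using trunc_tendsto LIM_zero tendsto_norm_zero by blast
  qed
  from tendsto_diff[OF y this]
  have "(\<lambda>N. trunc N \<rhd> gexp N t \<rhd> x - gexp N t \<rhd> (trunc N \<rhd> x - x)) \<longlonglongrightarrow> y - 0" .
  moreover have "trunc N \<rhd> gexp N t \<rhd> x - gexp N t \<rhd> (trunc N \<rhd> x - x) = gexp N t \<rhd> x" for N
    using arg_cong[OF trunc_commute_exp_xop[of N t v], of "\<lambda>X. X \<rhd> x"] by (simp add: app.diff_right)
  ultimately have "(\<lambda>N. gexp N t \<rhd> x) \<longlonglongrightarrow> y - 0" by (simp only:)
  then show ?thesis by (rule LIMSEQ_imp_Cauchy)
qed

lemma approx_dom1:
  assumes "0 < e" obtains y where "y \<in> dom1" "norm (x - y) < e"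
proof -
  obtain N where "norm (trunc N \<rhd> x - x) < e"
    using LIMSEQ_D[OF trunc_tendsto assms] by blast
  then show thesis using that[OF dom1_trunc] by (metis norm_minus_commute)
qed

text \<open>Density of \<open>dom1\<close> and isometry, by a three epsilon argument.\<close>

lemma lim_group_tendsto: "(\<lambda>N. gexp N t \<rhd> x) \<longlonglongrightarrow> glim t x"
proof -
  have "Cauchy (\<lambda>N. gexp N t \<rhd> x)"
  proof (rule metric_CauchyI)
    fix e :: real assume e: "0 < e"
    obtain y where y: "y \<in> dom1" "norm (x - y) < e / 3" using e approx_dom1[of "e / 3"] by auto
    from metric_CauchyD[OF Cauchy_dom1[OF y(1), of t], of "e / 3"] e obtain n0 where
      n0: "\<And>m n. n0 \<le> m \<Longrightarrow> n0 \<le> n \<Longrightarrow> dist (gexp m t \<rhd> y) (gexp n t \<rhd> y) < e / 3"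
      by auto
    have d: "norm (gexp n t \<rhd> x - gexp n t \<rhd> y) < e / 3" for n
      using y(2) by (simp add: app.diff_right[symmetric] norm_exp_xop)
    have "dist (gexp m t \<rhd> x) (gexp n t \<rhd> x) < e" if "n0 \<le> m" "n0 \<le> n" for m n
    proof -
      have "dist (gexp m t \<rhd> x) (gexp n t \<rhd> x) \<le> dist (gexp m t \<rhd> x) (gexp m t \<rhd> y)
          + dist (gexp m t \<rhd> y) (gexp n t \<rhd> y) + dist (gexp n t \<rhd> x) (gexp n t \<rhd> y)"
        using dist_triangle[of "gexp m t \<rhd> x" "gexp n t \<rhd> x" "gexp m t \<rhd> y"]
          dist_triangle2[of "gexp m t \<rhd> y" "gexp n t \<rhd> x" "gexp n t \<rhd> y"] by linarith
      also have "\<dots> < e" using d[of m] d[of n] n0[OF that] by (simp add: dist_norm)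
      finally show ?thesis .
    qed
    then show "\<exists>n0. \<forall>m\<ge>n0. \<forall>n\<ge>n0. dist (gexp m t \<rhd> x) (gexp n t \<rhd> x) < e" by blast
  qed
  then show ?thesis
    unfolding lim_group_def using Cauchy_convergent convergent_LIMSEQ_iff by blast
qed

text \<open>Isometry allows the argument to vary with N; compositions such as the group law and the
  powers of \<open>kop\<close> rely on this.\<close>

lemma lim_group_tendsto_seq:
  assumes "y \<longlonglongrightarrow> x" shows "(\<lambda>N. gexp N t \<rhd> y N) \<longlonglongrightarrow> glim t x"
proof -
  have "(\<lambda>N. gexp N t \<rhd> (y N - x)) \<longlonglongrightarrow> 0"
    by (rule tendsto_norm_zero_cancel)
      (unfold norm_exp_xop, rule tendsto_norm_zero, rule LIM_zero, rule assms)
  from tendsto_add[OF this lim_group_tendsto[of t x]] show ?thesis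
    by (simp add: app.diff_right)
qed

lemma lim_group_add: "glim t (x + y) = glim t x + glim t y"
proof (rule LIMSEQ_unique[OF lim_group_tendsto])
  show "(\<lambda>N. gexp N t \<rhd> (x + y)) \<longlonglongrightarrow> glim t x + glim t y"
    unfolding app.add_right by (intro tendsto_add lim_group_tendsto)
qed

lemma lim_group_cop: "glim t (cop c \<rhd> x) = cop c \<rhd> glim t x"
proof (rule LIMSEQ_unique[OF lim_group_tendsto])
  have "gexp N t \<rhd> cop c \<rhd> x = cop c \<rhd> gexp N t \<rhd> x" for N by (metis app_mult cop_commute_exp_xop)
  then show "(\<lambda>N. gexp N t \<rhd> cop c \<rhd> x) \<longlonglongrightarrow> cop c \<rhd> glim t x"
    by (simp add: bounded_linear.tendsto[OF app.bounded_linear_right lim_group_tendsto])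
qed

lemma lim_group_scaleR: "glim t (r *\<^sub>R x) = r *\<^sub>R glim t x"
  using lim_group_cop[of t "of_real r" x] by (simp add: cop_of_real app.scaleR_left)

lemma lim_group_diff: "glim t (x - y) = glim t x - glim t y"
  using lim_group_add[of t "x - y" y] by simp

lemma norm_lim_group: "norm (glim t x) = norm x"
  using tendsto_norm[OF lim_group_tendsto[of t x]] by (simp add: norm_exp_xop LIMSEQ_const_iff)

lemma lim_group_zero: "glim 0 x = x"
  using lim_group_tendsto[of 0 x] by (simp add: LIMSEQ_const_iff)

lemma lim_group_plus: "glim (s + t) x = glim s (glim t x)"
proof (rule LIMSEQ_unique[OF lim_group_tendsto])
  show "(\<lambda>N. gexp N (s + t) \<rhd> x) \<longlonglongrightarrow> glim s (glim t x)"
    unfolding exp_scaleR_add app_mult by (intro lim_group_tendsto_seq lim_group_tendsto)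
qed

lemma inner_lim_group: "inner (glim t x) y = inner x (glim (- t) y)"
proof (rule LIMSEQ_unique)
  show "(\<lambda>N. inner (gexp N t \<rhd> x) y) \<longlonglongrightarrow> inner (glim t x) y"
    by (intro tendsto_inner lim_group_tendsto tendsto_const)
  show "(\<lambda>N. inner (gexp N t \<rhd> x) y) \<longlonglongrightarrow> inner x (glim (- t) y)"
    unfolding adjD[OF adj_exp_antisym[OF adj_xop]]
    by (intro tendsto_inner lim_group_tendsto tendsto_const)
qed

lemma lax_tendsto:
  assumes x: "x \<in> dom1" shows "(\<lambda>N. lax N v \<rhd> x) \<longlonglongrightarrow> laxfull v x"
proof -
  note sv = wbound_summable(1)[OF v]
  have "norm (trunc N \<rhd> toep v \<rhd> toep_adj v \<rhd> trunc N \<rhd> x - toep v \<rhd> toep_adj v \<rhd> x)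
      \<le> norm (toep v \<rhd> toep_adj v \<rhd> (trunc N \<rhd> x - x)) + norm (trunc N \<rhd> toep v \<rhd> toep_adj v \<rhd> x - toep v \<rhd> toep_adj v \<rhd> x)" for N
  proof -
    let ?w = "toep v \<rhd> toep_adj v \<rhd> (trunc N \<rhd> x - x)" and ?u = "toep v \<rhd> toep_adj v \<rhd> x"
    have eq: "trunc N \<rhd> toep v \<rhd> toep_adj v \<rhd> trunc N \<rhd> x - ?u = trunc N \<rhd> ?w + (trunc N \<rhd> ?u - ?u)"
      by (simp add: app.diff_right)
    show ?thesis
      unfolding eq by (rule order_trans[OF norm_triangle_ineq add_right_mono[OF norm_trunc_app]])
  qed
  moreover have "(\<lambda>N. norm (toep v \<rhd> toep_adj v \<rhd> (trunc N \<rhd> x - x))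
      + norm (trunc N \<rhd> toep v \<rhd> toep_adj v \<rhd> x - toep v \<rhd> toep_adj v \<rhd> x)) \<longlonglongrightarrow> 0 + 0"
  proof (intro tendsto_add tendsto_norm_zero LIM_zero trunc_tendsto)
    have "(\<lambda>N. toep v \<rhd> toep_adj v \<rhd> (trunc N \<rhd> x - x)) \<longlonglongrightarrow> toep v \<rhd> toep_adj v \<rhd> 0"
      by (intro bounded_linear.tendsto[OF app.bounded_linear_right] LIM_zero trunc_tendsto)
    then show "(\<lambda>N. toep v \<rhd> toep_adj v \<rhd> (trunc N \<rhd> x - x)) \<longlonglongrightarrow> 0"
      by (simp add: app.zero_right)
  qed
  ultimately have "(\<lambda>N. trunc N \<rhd> toep v \<rhd> toep_adj v \<rhd> trunc N \<rhd> x - toep v \<rhd> toep_adj v \<rhd> x) \<longlonglongrightarrow> 0"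
    unfolding add_0 by (rule Lim_null_comparison[OF always_eventually[OF allI]])
  from LIM_zero_cancel[OF this]
  have "(\<lambda>N. trunc N \<rhd> toep v \<rhd> toep_adj v \<rhd> trunc N \<rhd> x) \<longlonglongrightarrow> toep v \<rhd> toep_adj v \<rhd> x" .
  moreover have "(\<lambda>N. dop N \<rhd> x) \<longlonglongrightarrow> dfull x"
    unfolding dop_eq_dfull[OF x] by (rule trunc_tendsto)
  ultimately show ?thesis
    unfolding lax_def laxfull_def ttoep_eq[OF sv] ttoep_adj_eq[OF sv]
    using tendsto_diff by (fastforce simp: app.diff_left)
qed

lemma exp_has_vector_derivative_app:
  "((\<lambda>s. gexp N s \<rhd> x) has_vector_derivative gexp N s \<rhd> xop N v \<rhd> x) (at s within S)"
  using bounded_linear.has_vector_derivative[OF app.bounded_linear_left exp_scaleR_has_vector_derivative(1)]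
  by simp

text \<open>Uniformity in N is the point, since it carries continuity over to the limit. On a nearby
  y in the domain the velocities \<open>xop N v \<rhd> y\<close> converge and are therefore
  bounded.\<close>

lemma exp_equicontinuous:
  assumes "0 < e"
  shows "\<exists>\<delta>>0. \<forall>N s. \<bar>s\<bar> < \<delta> \<longrightarrow> norm (gexp N s \<rhd> x - x) < e"
proof -
  obtain y where y: "y \<in> dom1" "norm (x - y) < e / 3" using assms approx_dom1[of "e / 3"] by auto
  have "Bseq (\<lambda>N. xop N v \<rhd> y)"
  proof -
    have "(\<lambda>N. jop \<rhd> lax N v \<rhd> y) \<longlonglongrightarrow> jop \<rhd> laxfull v y"
      by (intro bounded_linear.tendsto[OF app.bounded_linear_right] lax_tendsto y)
    then show ?thesis unfolding xop_def app_mult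
      by (rule convergent_imp_Bseq[OF convergentI])
  qed
  then obtain B where B: "0 < B" "\<And>N. norm (xop N v \<rhd> y) \<le> B" by (auto elim: BseqE)
  have "norm (gexp N s \<rhd> x - x) < e" if "\<bar>s\<bar> < e / (3 * B)" for N s
  proof -
    have "norm (gexp N s \<rhd> y - gexp N 0 \<rhd> y) \<le> B * \<bar>s - 0\<bar>"
      by (rule vector_mean_value_bound[OF convex_UNIV exp_has_vector_derivative_app])
        (auto simp: norm_exp_xop B)
    moreover have "B * \<bar>s\<bar> < e / 3" using that B(1) by (simp add: field_simps)
    ultimately have 1: "norm (gexp N s \<rhd> y - y) < e / 3" by simp
    have "gexp N s \<rhd> x - x = gexp N s \<rhd> (x - y) + (gexp N s \<rhd> y - y) - (x - y)"
      by (simp add: app.diff_right)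
    also have "norm \<dots> \<le> norm (gexp N s \<rhd> (x - y)) + norm (gexp N s \<rhd> y - y) + norm (x - y)"
      by (rule norm_add_diff_le)
    also have "\<dots> < e" using 1 y(2) by (simp add: norm_exp_xop)
    finally show ?thesis .
  qed
  then show ?thesis using B(1) assms by (intro exI[of _ "e / (3 * B)"]) auto
qed

lemma lim_group_continuous: "((\<lambda>r. glim r x) \<longlongrightarrow> glim t x) (at t)"
proof (rule LIM_I)
  fix e :: real assume e: "0 < e"
  then obtain \<delta> where \<delta>: "0 < \<delta>" "\<And>N s. \<bar>s\<bar> < \<delta> \<Longrightarrow> norm (gexp N s \<rhd> x - x) < e / 2"
    using exp_equicontinuous[of "e / 2" x] by auto
  have "norm (glim r x - glim t x) < e" if "\<bar>r - t\<bar> < \<delta>" for r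
  proof -
    have "norm (glim (r - t) x - x) \<le> e / 2"
    proof (rule LIMSEQ_le_const2)
      show "(\<lambda>N. norm (gexp N (r - t) \<rhd> x - x)) \<longlonglongrightarrow> norm (glim (r - t) x - x)"
        by (intro tendsto_intros lim_group_tendsto)
    qed (use \<delta>(2)[OF that] in \<open>auto intro: less_imp_le\<close>)
    moreover have "glim r x - glim t x = glim t (glim (r - t) x - x)"
      using lim_group_plus[of t "r - t" x] by (simp add: lim_group_diff)
    ultimately show ?thesis using e by (simp add: norm_lim_group)
  qed
  then show "\<exists>s>0. \<forall>r. r \<noteq> t \<and> norm (r - t) < s \<longrightarrow> norm (glim r x - glim t x) < e"
    using \<delta>(1) by auto
qed

text \<open>The mean value bound is applied to exp (s X_N) x - s X_N x, whose derivative (exp (s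
  X_N) - 1) X_N x is small for small s, uniformly in N up to terms that vanish in the limit. That
  limit is taken with h fixed, before h tends to 0.\<close>

lemma lim_group_generator:
  assumes x: "x \<in> dom1"
  shows "((\<lambda>h. (1 / h) *\<^sub>R (glim h x - x)) \<longlongrightarrow> jop \<rhd> laxfull v x) (at 0)"
proof (rule LIM_I)
  let ?g = "jop \<rhd> laxfull v x"
  let ?gN = "\<lambda>N. xop N v \<rhd> x"
  have gN: "?gN \<longlonglongrightarrow> ?g"
    unfolding xop_def app_mult
    by (intro bounded_linear.tendsto[OF app.bounded_linear_right] lax_tendsto x)
  fix e :: real assume e: "0 < e"
  then obtain \<delta> where \<delta>: "0 < \<delta>" "\<And>N s. \<bar>s\<bar> < \<delta> \<Longrightarrow> norm (gexp N s \<rhd> ?g - ?g) < e / 2"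
    using exp_equicontinuous[of "e / 2" ?g] by auto
  have "norm ((1 / h) *\<^sub>R (glim h x - x) - ?g) < e" if h: "h \<noteq> 0" "\<bar>h\<bar> < \<delta>" for h
  proof -
    have le: "norm (gexp N h \<rhd> x - x - h *\<^sub>R ?gN N) \<le> (e / 2 + 2 * norm (?gN N - ?g)) * \<bar>h\<bar>" for N
    proof -
      let ?S = "{- \<bar>h\<bar>..\<bar>h\<bar>}"
      have "norm ((gexp N h \<rhd> x - h *\<^sub>R ?gN N) - (gexp N 0 \<rhd> x - 0 *\<^sub>R ?gN N)) \<le> (e / 2 + 2 * norm (?gN N - ?g)) * \<bar>h - 0\<bar>"
      proof (rule vector_mean_value_bound[where S = ?S])
        show "((\<lambda>s. gexp N s \<rhd> x - s *\<^sub>R ?gN N) has_vector_derivative gexp N s \<rhd> ?gN N - ?gN N) (at s within ?S)" for s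
          by (intro has_vector_derivative_diff exp_has_vector_derivative_app
              has_vector_derivative_scaleR_diff[of 0, simplified])
        show "norm (gexp N s \<rhd> ?gN N - ?gN N) \<le> e / 2 + 2 * norm (?gN N - ?g)" if s: "s \<in> ?S" for s
        proof -
          have "gexp N s \<rhd> ?gN N - ?gN N = (gexp N s \<rhd> ?g - ?g) + gexp N s \<rhd> (?gN N - ?g) - (?gN N - ?g)"
            by (simp add: app.diff_right)
          also have "norm \<dots> \<le> norm (gexp N s \<rhd> ?g - ?g) + norm (gexp N s \<rhd> (?gN N - ?g)) + norm (?gN N - ?g)"
            by (rule norm_add_diff_le)
          also have "\<dots> \<le> e / 2 + 2 * norm (?gN N - ?g)"
          proof -
            have "norm (gexp N s \<rhd> ?g - ?g) < e / 2" by (rule \<delta>(2)) (use s h in auto)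
            then show ?thesis by (simp add: norm_exp_xop)
          qed
          finally show ?thesis .
        qed
      qed auto
      then show ?thesis by (simp add: algebra_simps)
    qed
    have "norm (glim h x - x - h *\<^sub>R ?g) \<le> (e / 2 + 2 * norm (?g - ?g)) * \<bar>h\<bar>"
    proof (rule LIMSEQ_le)
      show "(\<lambda>N. norm (gexp N h \<rhd> x - x - h *\<^sub>R ?gN N)) \<longlonglongrightarrow> norm (glim h x - x - h *\<^sub>R ?g)"
        by (intro tendsto_intros lim_group_tendsto gN)
      show "(\<lambda>N. (e / 2 + 2 * norm (?gN N - ?g)) * \<bar>h\<bar>) \<longlonglongrightarrow> (e / 2 + 2 * norm (?g - ?g)) * \<bar>h\<bar>"
        by (intro tendsto_intros gN)
    qed (use le in blast)
    then have "norm (glim h x - x - h *\<^sub>R ?g) / \<bar>h\<bar> \<le> e / 2"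
      using h by (simp add: pos_divide_le_eq)
    then have "norm ((1 / h) *\<^sub>R (glim h x - x - h *\<^sub>R ?g)) \<le> e / 2" by simp
    moreover have "(1 / h) *\<^sub>R (glim h x - x - h *\<^sub>R ?g) = (1 / h) *\<^sub>R (glim h x - x) - ?g"
      using h by (simp add: scaleR_diff_right)
    ultimately show ?thesis using e by simp
  qed
  then show "\<exists>s>0. \<forall>h. h \<noteq> 0 \<and> norm (h - 0) < s \<longrightarrow> norm ((1 / h) *\<^sub>R (glim h x - x) - ?g) < e"
    using \<delta>(1) by auto
qed

lemma adj_toep_toep: "inner (toep v \<rhd> toep_adj v \<rhd> x) y = inner x (toep v \<rhd> toep_adj v \<rhd> y)"
  using adj_toep[OF wbound_summable(1)[OF v]] by (metis adjD adj_sym)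

text \<open>The domain is no larger than H^1: pairing the difference quotient with basis vectors,
  where the generator is known, exhibits n x_n as the coefficients of the square summable sequence g
  + T_u T_{u bar} x.\<close>

lemma lim_group_generator_conv:
  assumes l: "((\<lambda>h. (1 / h) *\<^sub>R (glim h x - x)) \<longlongrightarrow> jop \<rhd> g) (at 0)"
  shows "x \<in> dom1" "laxfull v x = g"
proof -
  have key: "inner (jop \<rhd> g) (unit_vec k c) = - inner x (jop \<rhd> laxfull v (unit_vec k c))" for k c
  proof -
    let ?\<phi> = "unit_vec k c"
    have "((\<lambda>h. inner ((1 / h) *\<^sub>R (glim h x - x)) ?\<phi>) \<longlongrightarrow> inner (jop \<rhd> g) ?\<phi>) (at 0)"
      by (intro tendsto_inner l tendsto_const)
    moreover have "((\<lambda>h. inner ((1 / h) *\<^sub>R (glim h x - x)) ?\<phi>) \<longlongrightarrow> - inner x (jop \<rhd> laxfull v ?\<phi>)) (at 0)"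
    proof -
      have "((\<lambda>h. (1 / h) *\<^sub>R (glim h ?\<phi> - ?\<phi>)) \<longlongrightarrow> jop \<rhd> laxfull v ?\<phi>) (at 0)"
        by (rule lim_group_generator[OF dom1_unit_vec(1)])
      \<comment> \<open>The adjoint of the group at time h is the group at time - h, hence the
        reflected difference quotient.\<close>
      then have "((\<lambda>h. (1 / - h) *\<^sub>R (glim (- h) ?\<phi> - ?\<phi>)) \<longlongrightarrow> jop \<rhd> laxfull v ?\<phi>) (at 0)"
        by (rule tendsto_at_zero_minus)
      then have "((\<lambda>h. - inner x ((1 / - h) *\<^sub>R (glim (- h) ?\<phi> - ?\<phi>))) \<longlongrightarrow> - inner x (jop \<rhd> laxfull v ?\<phi>)) (at 0)"
        by (intro tendsto_minus tendsto_inner tendsto_const)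
      moreover have eq: "inner ((1 / h) *\<^sub>R (glim h x - x)) ?\<phi> = - inner x ((1 / - h) *\<^sub>R (glim (- h) ?\<phi> - ?\<phi>))" for h
        by (simp add: inner_diff_left inner_diff_right inner_lim_group)
      ultimately show ?thesis unfolding eq by blast
    qed
    ultimately show ?thesis using tendsto_unique trivial_limit_at by blast
  qed
  have eq: "of_nat k * coef x k = coef (g + toep v \<rhd> toep_adj v \<rhd> x) k" for k
  proof -
    let ?z = "coef g k" and ?w = "of_nat k * coef x k - coef (toep v \<rhd> toep_adj v \<rhd> x) k"
    have "inner ?z d = inner ?w d" for d
    proof -
      \<comment> \<open>Chosen so that i times it is \<open>unit_vec k d\<close>, which strips the
        factor i from \<open>key\<close>.\<close>
      let ?\<phi> = "unit_vec k (- \<i> * d)" and ?\<psi> = "unit_vec k d"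
      have J: "jop \<rhd> ?\<phi> = ?\<psi>" by (rule ell2_eqI) (simp add: coef_cop coef_unit_vec)
      have JL: "jop \<rhd> laxfull v ?\<phi> = laxfull v ?\<psi>"
      proof -
        have "jop \<rhd> toep v \<rhd> toep_adj v \<rhd> ?\<phi> = toep v \<rhd> toep_adj v \<rhd> ?\<psi>"
        proof -
          note t = cop_commute_toep[OF wbound_summable(1)[OF v]] and ta = cop_commute_toep_adj[OF wbound_summable(1)[OF v]]
          show ?thesis using t[of \<i>] ta[of \<i>] J by (metis app_mult)
        qed
        moreover have "jop \<rhd> dfull ?\<phi> = dfull ?\<psi>"
          using dom1_cop(2)[OF dom1_unit_vec(1), of \<i> k "- \<i> * d"] J by simp
        ultimately show ?thesis by (simp add: laxfull_def app.diff_right)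
      qed
      have "inner (jop \<rhd> g) ?\<phi> = - inner g ?\<psi>"
        using adjD[OF adj_jop, of g ?\<phi>] J by (simp add: app.minus_left)
      with key[of k "- \<i> * d"] have "inner g ?\<psi> = inner x (laxfull v ?\<psi>)"
        by (simp only: JL neg_equal_iff_equal)
      also have "\<dots> = inner (of_nat k * coef x k) d - inner (coef (toep v \<rhd> toep_adj v \<rhd> x) k) d"
      proof -
        have "inner (coef x k) (of_nat k * d) = inner (of_nat k * coef x k) d"
          by (simp add: inner_complex_def algebra_simps)
        then show ?thesis
          by (simp add: laxfull_def inner_diff_right adj_toep_toep[symmetric] dom1_unit_vec inner_unit_vec)
      qed
      finally show ?thesis by (simp add: inner_unit_vec inner_diff_left)
    qed
    from this[of "?z - ?w"] have "inner (?z - ?w) (?z - ?w) = 0" by (simp only: inner_diff_left)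
    then have "?z - ?w = 0" by (rule inner_eq_zero_iff[THEN iffD1])
    then show ?thesis by (simp add: algebra_simps)
  qed
  show x: "x \<in> dom1" by (rule dom1I[OF eq])
  show "laxfull v x = g" by (simp add: laxfull_def dfull_eqI[OF eq])
qed

section \<open>Uniqueness of the group\<close>

lemma laxfull_antisym:
  assumes "x \<in> dom1" "y \<in> dom1"
  shows "inner (jop \<rhd> laxfull v x) y = - inner x (jop \<rhd> laxfull v y)"
proof (rule LIMSEQ_unique)
  show "(\<lambda>N. inner (xop N v \<rhd> x) y) \<longlonglongrightarrow> inner (jop \<rhd> laxfull v x) y"
    unfolding xop_def app_mult
    by (intro tendsto_inner tendsto_const bounded_linear.tendsto[OF app.bounded_linear_right] lax_tendsto assms)
  have "inner (xop N v \<rhd> x) y = - inner x (xop N v \<rhd> y)" for N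
    using adjD[OF adj_xop] by (simp add: app.minus_left)
  then show "(\<lambda>N. inner (xop N v \<rhd> x) y) \<longlonglongrightarrow> - inner x (jop \<rhd> laxfull v y)"
    unfolding xop_def app_mult
    by (auto intro!: tendsto_inner tendsto_const bounded_linear.tendsto[OF app.bounded_linear_right]
      lax_tendsto assms tendsto_minus)
qed

lemma lax_group_lim_group: "lax_group v glim"
  unfolding lax_group_def
  using lim_group_add lim_group_cop norm_lim_group lim_group_zero lim_group_plus
    lim_group_generator lim_group_generator_conv by blast

lemma lax_group_diff:
  assumes "lax_group v W" shows "W t (x - y) = W t x - W t y"
proof -
  have "W t (x - y + y) = W t (x - y) + W t y" using assms unfolding lax_group_def by blast
  then show ?thesis by (simp add: algebra_simps)
qed

text \<open>The isometry W t is applied to the difference quotient of x at time 0 and commutes with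
  W h. The generator clause, read backwards, then places W t x in the domain.\<close>

lemma group_derivative:
  assumes W: "lax_group v W" and x: "x \<in> dom1"
  shows "W t x \<in> dom1" "((\<lambda>t. W t x) has_vector_derivative jop \<rhd> laxfull v (W t x)) (at t)"
proof -
  note diff = lax_group_diff[OF W]
  have nrm: "norm (W t x) = norm x" and plus: "W (s + t) x = W s (W t x)"
    and cp: "W t (cop c \<rhd> x) = cop c \<rhd> W t x"
    and gen: "(x \<in> dom1 \<and> laxfull v x = g) \<longleftrightarrow> ((\<lambda>h. (1 / h) *\<^sub>R (W h x - x)) \<longlongrightarrow> jop \<rhd> g) (at 0)"
    for s t x c g
    using W unfolding lax_group_def by blast+
  have scale: "W t (r *\<^sub>R x) = r *\<^sub>R W t x" for t r x
    using cp[of t "of_real r" x] by (simp add: cop_of_real app.scaleR_left)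
  let ?g = "laxfull v x"
  have "((\<lambda>h. (1 / h) *\<^sub>R (W h x - x)) \<longlongrightarrow> jop \<rhd> ?g) (at 0)" by (rule iffD1[OF gen, OF conjI[OF x refl]])
  from tendsto_norm_zero[OF LIM_zero[OF this]]
  have "((\<lambda>h. norm (W t ((1 / h) *\<^sub>R (W h x - x) - jop \<rhd> ?g))) \<longlongrightarrow> 0) (at 0)" by (simp only: nrm)
  then have "((\<lambda>h. W t ((1 / h) *\<^sub>R (W h x - x) - jop \<rhd> ?g)) \<longlongrightarrow> 0) (at 0)"
    by (rule tendsto_norm_zero_cancel)
  moreover have "W t ((1 / h) *\<^sub>R (W h x - x) - jop \<rhd> ?g)
      = (1 / h) *\<^sub>R (W h (W t x) - W t x) - jop \<rhd> W t ?g" for h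
    using plus[of t h x] plus[of h t x] by (simp add: diff scale cp add.commute)
  ultimately have "((\<lambda>h. (1 / h) *\<^sub>R (W h (W t x) - W t x)) \<longlongrightarrow> jop \<rhd> W t ?g) (at 0)"
    by (simp add: LIM_zero_iff)
  from iffD2[OF gen this] have *: "W t x \<in> dom1" "laxfull v (W t x) = W t ?g" by auto
  show "W t x \<in> dom1" by fact
  have "((\<lambda>h. (1 / h) *\<^sub>R (W (t + h) x - W t x)) \<longlongrightarrow> jop \<rhd> laxfull v (W t x)) (at 0)"
    using \<open>((\<lambda>h. (1 / h) *\<^sub>R (W h (W t x) - W t x)) \<longlongrightarrow> jop \<rhd> W t ?g) (at 0)\<close>
    by (simp add: *(2) plus[symmetric] add.commute)
  then show "((\<lambda>t. W t x) has_vector_derivative jop \<rhd> laxfull v (W t x)) (at t)"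
    by (rule has_vector_derivative_if_LIM)
qed

text \<open>On the domain, the pairing of the two evolutions of y is constant in time by
  antisymmetry, hence equal to the squared norm of y; two vectors of that norm with this pairing
  coincide. Density and isometry extend this to all x.\<close>

lemma lax_group_unique:
  assumes W: "lax_group v W" shows "W t x = glim t x"
proof -
  have nrm: "norm (W t x) = norm x" and zero: "W 0 x = x" for t x
    using W unfolding lax_group_def by blast+
  have dom: "W t y = glim t y" if y: "y \<in> dom1" for y
  proof -
    let ?p = "\<lambda>t. inner (W t y) (glim t y)"
    have "(?p has_real_derivative 0) (at s)" for s
    proof -
      have "(?p has_vector_derivative (inner (W s y) (jop \<rhd> laxfull v (glim s y))
          + inner (jop \<rhd> laxfull v (W s y)) (glim s y))) (at s)"
        by (intro bounded_bilinear.has_vector_derivative[OF bounded_bilinear_inner]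
            group_derivative[OF W y] group_derivative[OF lax_group_lim_group y])
      then show ?thesis
        using laxfull_antisym[OF group_derivative(1)[OF W y] group_derivative(1)[OF lax_group_lim_group y]]
        by (simp add: has_real_derivative_iff_has_vector_derivative)
    qed
    then have "?p t = ?p 0" by (meson DERIV_isconst_all)
    then have "inner (W t y) (glim t y) = (norm y)\<^sup>2"
      by (simp add: zero lim_group_zero power2_norm_eq_inner)
    then have "(norm (W t y - glim t y))\<^sup>2 = 0"
      using nrm[of t y] norm_lim_group[of t y]
      by (simp add: power2_norm_eq_inner inner_diff_left inner_diff_right inner_commute norm_eq_sqrt_inner)
    then show ?thesis by simp
  qed
  have "norm (W t x - glim t x) \<le> e" if e: "0 < e" for e
  proof -
    obtain y where y: "y \<in> dom1" "norm (x - y) < e / 2" using e approx_dom1[of "e / 2"] by auto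
    have "W t x - glim t x = W t (x - y) - glim t (x - y)"
      using dom[OF y(1)] by (simp add: lax_group_diff[OF W] lim_group_diff)
    then have "norm (W t x - glim t x) \<le> norm (W t (x - y)) + norm (glim t (x - y))"
      by (metis norm_triangle_ineq4)
    then show ?thesis using y(2) by (simp add: nrm norm_lim_group)
  qed
  then have "norm (W t x - glim t x) \<le> 0" using field_le_epsilon by (metis add_0)
  then show ?thesis by simp
qed

text \<open>In exp (- i tau (2 L + 1)) the summand 1 commutes with the rest and splits off as a
  scalar; what remains is the group of i L at time - 2 tau.\<close>

lemma kop_tendsto:
  assumes "y \<longlonglongrightarrow> x"
  shows "(\<lambda>N. kop N v \<tau> \<rhd> y N) \<longlonglongrightarrow> cop (exp (- \<i> * of_real \<tau>)) \<rhd> glim (- 2 * \<tau>) (bshift \<rhd> x)"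
proof -
  let ?c = "cop (exp (- \<i> * of_real \<tau>))"
  have kop: "kop N v \<tau> = ?c * gexp N (- 2 * \<tau>) * tbshift N" for N
  proof -
    have J: "cop (- \<i> * of_real \<tau>) = - (\<tau> *\<^sub>R jop)"
      by (intro endo_eqI ell2_eqI)
        (simp add: coef_cop app.minus_left app.scaleR_left, simp add: scaleR_conv_of_real)
    have "\<tau> *\<^sub>R gen N v = cop (- \<i> * of_real \<tau>) + (- 2 * \<tau>) *\<^sub>R xop N v"
      unfolding J gen_def xop_def
      by (simp add: algebra_simps scaleR_2[symmetric] flip: scaleR_scaleR)
    moreover have "cop (- \<i> * of_real \<tau>) * (- 2 * \<tau>) *\<^sub>R xop N v = (- 2 * \<tau>) *\<^sub>R xop N v * cop (- \<i> * of_real \<tau>)"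
      unfolding mult_scaleR_left mult_scaleR_right by (simp only: cop_commute_xop)
    ultimately show ?thesis
      unfolding kop_def cop_exp by (simp only: exp_add_commuting)
  qed
  have "(\<lambda>N. tbshift N \<rhd> y N) \<longlonglongrightarrow> bshift \<rhd> x"
  proof -
    have "(\<lambda>N. trunc N \<rhd> (y N - x)) \<longlonglongrightarrow> 0"
    proof (rule tendsto_norm_zero_cancel, rule tendsto_sandwich[OF _ _ tendsto_const])
      show "(\<lambda>N. norm (y N - x)) \<longlonglongrightarrow> 0" using assms LIM_zero tendsto_norm_zero by blast
    qed (auto intro!: always_eventually norm_trunc_app)
    from tendsto_add[OF this trunc_tendsto[of x]] have "(\<lambda>N. trunc N \<rhd> y N) \<longlonglongrightarrow> x"
      by (simp add: app.diff_right)
    then show ?thesis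
      unfolding tbshift_def app_mult by (rule bounded_linear.tendsto[OF app.bounded_linear_right])
  qed
  then show ?thesis
    unfolding kop app_mult
    by (intro bounded_linear.tendsto[OF app.bounded_linear_right] lim_group_tendsto_seq)
qed

lemma kop_power_tendsto:
  assumes "y \<longlonglongrightarrow> x"
  shows "(\<lambda>N. kop N v \<tau> ^ n \<rhd> y N) \<longlonglongrightarrow>
    ((\<lambda>x. cop (exp (- \<i> * of_real \<tau>)) \<rhd> glim (- 2 * \<tau>) (bshift \<rhd> x)) ^^ n) x"
proof (induction n)
  case (Suc n)
  from kop_tendsto[OF Suc] show ?case by (simp only: power_Suc app_mult funpow.simps o_apply)
qed (simp add: assms)

end

text \<open>At q = t the exponential is trivial, and the n-th power of the truncated shift reads off
  the coefficient n. At q = 0 the compressed expressions converge to the right-hand side. The drift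
  between the two is O(1/N).\<close>

lemma explicit_formula_coeff:
  fixes a :: "real \<Rightarrow> nat \<Rightarrow> complex"
  assumes bnd: "\<And>q. q \<in> {min 0 t..max 0 t} \<Longrightarrow> wbound M (a q)"
    and der: "\<And>q k. q \<in> {min 0 t..max 0 t} \<Longrightarrow>
      ((\<lambda>q. a q k) has_vector_derivative cs_field (a q) k) (at q within {min 0 t..max 0 t})"
  shows "a t n = coef (((\<lambda>x. cop (exp (- \<i> * of_real t)) \<rhd> lim_group (a 0) (- 2 * t) (bshift \<rhd> x)) ^^ n)
      (toep (a 0) \<rhd> unit_vec 0 1)) 0"
    (is "_ = coef ?z 0")
proof -
  have b0: "wbound M (a 0)" by (rule bnd) auto
  have tend: "(\<lambda>N. ttoep N (a 0) \<rhd> unit_vec 0 1) \<longlonglongrightarrow> toep (a 0) \<rhd> unit_vec 0 1"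
    unfolding ttoep_eq[OF wbound_summable(1)[OF b0]] app_mult by (rule trunc_tendsto)
  have "inner (a t n) c = inner (coef ?z 0) c" if c: "cmod c \<le> 1" for c
  proof (rule LIMSEQ_unique)
    let ?\<Phi> = "\<lambda>N q. inner (kop N (a q) (t - q) ^ n \<rhd> ttoep N (a q) \<rhd> unit_vec 0 1) (unit_vec 0 c)"
    have "\<exists>K. \<forall>N>0. \<bar>?\<Phi> N t - ?\<Phi> N 0\<bar> \<le> K / real N"
      by (rule galerkin_drift[OF bnd der c])
    then obtain K where K: "\<And>N. 0 < N \<Longrightarrow> \<bar>?\<Phi> N t - ?\<Phi> N 0\<bar> \<le> K / real N" by blast
    \<comment> \<open>The condition n <= N keeps the coefficient n from being cut off by the
      truncated shifts.\<close>
    have t: "?\<Phi> N t = inner (a t n) c" if N: "n \<le> N" for N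
    proof -
      have p: "coef (tbshift N ^ n \<rhd> x) 0 = coef x n" for x
      proof -
        have "coef (tbshift N ^ m \<rhd> x) k = coef x (k + m)" if "k + m \<le> N" for m k
          using that by (induction m arbitrary: k) (auto simp: coef_tbshift)
        from this[of 0 n] N show ?thesis by simp
      qed
      have "(\<Sum>k\<le>n. a t k * (if n - k = 0 then 1 else 0)) = (\<Sum>k\<in>{n}. a t k)"
        by (rule sum.mono_neutral_cong_right) auto
      then show ?thesis
        using N by (simp add: kop_def inner_unit_vec p coef_ttoep coef_unit_vec)
    qed
    have "(\<lambda>N. ?\<Phi> N t - ?\<Phi> N 0) \<longlonglongrightarrow> 0"
    proof (rule Lim_null_comparison)
      show "\<forall>\<^sub>F N in sequentially. norm (?\<Phi> N t - ?\<Phi> N 0) \<le> K / real N"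
        using eventually_gt_at_top[of 0] by eventually_elim (use K in simp)
      show "(\<lambda>N. K / real N) \<longlonglongrightarrow> 0" by (rule lim_const_over_n)
    qed
    moreover have "(\<lambda>N. ?\<Phi> N 0) \<longlonglongrightarrow> inner ?z (unit_vec 0 c)"
      using kop_power_tendsto[OF b0 tend, of t n] by (intro tendsto_inner tendsto_const) simp
    ultimately have "(\<lambda>N. (?\<Phi> N t - ?\<Phi> N 0) + ?\<Phi> N 0) \<longlonglongrightarrow> 0 + inner ?z (unit_vec 0 c)"
      by (rule tendsto_add)
    then show "(\<lambda>N. ?\<Phi> N t) \<longlonglongrightarrow> inner (coef ?z 0) c" by (simp add: inner_unit_vec)
    show "(\<lambda>N. ?\<Phi> N t) \<longlonglongrightarrow> inner (a t n) c"
      by (rule tendsto_eventually) (use t in \<open>auto simp: eventually_sequentially\<close>)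
  qed
  \<comment> \<open>The two values of c give the real and the imaginary part.\<close>
  from this[of 1] this[of \<i>] show ?thesis by (simp add: complex_eq_iff)
qed

section \<open>Fourier series on the circle\<close>

subsection \<open>Integration over a period\<close>

definition expc :: "int \<Rightarrow> real \<Rightarrow> complex" where
  "expc n x = exp (\<i> * of_int n * complex_of_real x)"

lemma expc_simps: "expc 0 x = 1" "expc m x * expc n x = expc (m + n) x" "cnj (expc n x) = expc (- n) x"
    "cmod (expc n x) = 1"
  by (simp_all add: expc_def exp_add[symmetric] exp_cnj algebra_simps norm_exp_eq_Re)

lemma continuous_on_expc: "continuous_on S (expc n)"
  unfolding expc_def by (intro continuous_intros)

lemma sets_circ: "{0..2 * pi} \<in> sets lebesgue" by simp

lemma finite_measure_circ: "finite_measure circ_measure"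
  by (rule finite_measureI) (simp add: emeasure_restrict_space)

lemma integral_const_circ: "integral\<^sup>L circ_measure (\<lambda>_. c :: 'a::{banach, second_countable_topology}) = (2 * pi) *\<^sub>R c"
proof -
  interpret finite_measure circ_measure by (rule finite_measure_circ)
  show ?thesis by (simp add: measure_restrict_space)
qed

lemma continuous_measurable_circ:
  fixes f :: "real \<Rightarrow> 'a::euclidean_space"
  assumes "continuous_on UNIV f" shows "f \<in> borel_measurable circ_measure"
  using borel_measurable_integrable[OF continuous_imp_integrable_real[OF continuous_on_subset[OF assms subset_UNIV]]]
  by simp

lemma measurable_expc: "expc n \<in> borel_measurable circ_measure"
  by (rule continuous_measurable_circ[OF continuous_on_expc])

lemma measurable_cnj:
  assumes "f \<in> borel_measurable M" shows "(\<lambda>x. cnj (f x)) \<in> borel_measurable M"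
  by (rule borel_measurable_continuous_on[OF _ assms]) (intro continuous_intros)

lemma integrable_bounded_mult:
  fixes g h :: "real \<Rightarrow> complex"
  assumes g: "integrable circ_measure g" and h: "h \<in> borel_measurable circ_measure"
    and b: "\<And>x. x \<in> {0..2 * pi} \<Longrightarrow> cmod (h x) \<le> B"
  shows "integrable circ_measure (\<lambda>x. g x * h x)"
proof (rule Bochner_Integration.integrable_bound)
  show "integrable circ_measure (\<lambda>x. B * norm (g x))"
    using g by simp
  show "(\<lambda>x. g x * h x) \<in> borel_measurable circ_measure"
    using g h by (intro borel_measurable_times) auto
  show "AE x in circ_measure. norm (g x * h x) \<le> norm (B * norm (g x))"
  proof (rule AE_I2)
    fix x assume "x \<in> space circ_measure"
    then have "cmod (h x) \<le> B" using b by simp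
    then have "cmod (h x) * cmod (g x) \<le> \<bar>B\<bar> * cmod (g x)"
      by (intro mult_right_mono) auto
    then show "norm (g x * h x) \<le> norm (B * norm (g x))"
      by (simp add: norm_mult abs_mult mult.commute)
  qed
qed

lemma expc_2pi: "expc n (2 * pi) = 1"
proof -
  have "expc n (2 * pi) = exp (2 * of_int n * of_real pi * \<i>)" by (simp add: expc_def mult_ac)
  also have "\<dots> = 1" using exp_integer_2pi[of "of_int n"] by (simp add: mult_ac)
  finally show ?thesis .
qed

lemma integral_expc: "integral\<^sup>L circ_measure (expc n) = (if n = 0 then 2 * pi else 0)"
proof (cases "n = 0")
  case True
  then have "expc n = (\<lambda>_. 1)" by (simp add: fun_eq_iff expc_simps)
  then have "integral\<^sup>L circ_measure (expc n) = (2 * pi) *\<^sub>R 1" by (simp only: integral_const_circ)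
  then show ?thesis using True by (simp add: scaleR_conv_of_real)
next
  case False
  let ?F = "\<lambda>x. expc n x / (\<i> * of_int n)"
  have "(?F has_vector_derivative expc n x) (at x within {0..2 * pi})" for x
  proof -
    have "((\<lambda>z. exp (\<i> * of_int n * z) / (\<i> * of_int n)) has_field_derivative exp (\<i> * of_int n * of_real x)) (at (of_real x))"
      using False by (auto intro!: derivative_eq_intros)
    from has_vector_derivative_real_field[OF this] show ?thesis by (simp add: expc_def)
  qed
  then have "(expc n has_integral ?F (2 * pi) - ?F 0) {0..2 * pi}"
    by (intro fundamental_theorem_of_calculus) auto
  moreover have "?F (2 * pi) = ?F 0" by (simp add: expc_2pi expc_simps(1) expc_def[of n 0])
  ultimately have "integral {0..2 * pi} (expc n) = 0" by (simp add: integral_unique)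
  moreover have "integrable circ_measure (expc n)"
    by (rule continuous_imp_integrable_real[OF continuous_on_expc])
  ultimately show ?thesis
    using False lebesgue_integral_eq_integral[of "{0..2 * pi}" "expc n"] by simp
qed

subsection \<open>Uniqueness of Fourier coefficients\<close>

inductive trig_poly :: "(real \<Rightarrow> complex) \<Rightarrow> bool" where
  mono: "trig_poly (\<lambda>x. c * expc n x)"
| add: "trig_poly f \<Longrightarrow> trig_poly g \<Longrightarrow> trig_poly (\<lambda>x. f x + g x)"

lemma trig_poly_mult: "trig_poly f \<Longrightarrow> trig_poly g \<Longrightarrow> trig_poly (\<lambda>x. f x * g x)"
proof (induction rule: trig_poly.induct)
  case (mono c n)
  from mono show ?case
  proof (induction rule: trig_poly.induct)
    case (mono d m)
    have "(\<lambda>x. c * expc n x * (d * expc m x)) = (\<lambda>x. (c * d) * expc (n + m) x)"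
      by (simp add: fun_eq_iff expc_simps(2)[symmetric])
    then show ?case by (simp only: trig_poly.mono)
  next
    case (add f g)
    from trig_poly.add[OF add.IH] show ?case by (simp only: distrib_left)
  qed
next
  case (add f h)
  from trig_poly.add[OF add.IH(1)[OF add.prems] add.IH(2)[OF add.prems]] show ?case
    by (simp only: distrib_right)
qed

text \<open>On the circle a real linear functional is cos x f(1) + sin x f(i), a combination of
  e^{ix} and e^{-ix}; products are covered by \<open>trig_poly_mult\<close>.\<close>

lemma trig_poly_real_polynomial:
  assumes "real_polynomial_function (p :: complex \<Rightarrow> real)"
  shows "trig_poly (\<lambda>x. of_real (p (exp (\<i> * of_real x))))"
  using assms
proof (induction rule: real_polynomial_function.induct)
  case (linear f)
  let ?A = "complex_of_real (f 1)" and ?B = "complex_of_real (f \<i>)"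
  have "of_real (f (exp (\<i> * of_real x))) = (?A - \<i> * ?B) / 2 * expc 1 x + (?A + \<i> * ?B) / 2 * expc (- 1) x" for x
  proof -
    have "exp (\<i> * of_real x) = cos x *\<^sub>R 1 + sin x *\<^sub>R \<i>"
      by (simp add: complex_eq_iff Re_exp Im_exp)
    then have "f (exp (\<i> * of_real x)) = cos x * f 1 + sin x * f \<i>"
      using linear by (simp only: linear_add linear_scale bounded_linear.linear real_scaleR_def)
    then show ?thesis
      by (simp add: expc_def complex_eq_iff Re_exp Im_exp field_simps)
  qed
  moreover have "trig_poly (\<lambda>x. (?A - \<i> * ?B) / 2 * expc 1 x + (?A + \<i> * ?B) / 2 * expc (- 1) x)"
    by (intro trig_poly.intros)
  ultimately show ?case by simp
next
  case (const c)
  have "trig_poly (\<lambda>x. of_real c * expc 0 x)" by (rule trig_poly.mono)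
  then show ?case by (simp add: expc_simps)
next
  case (add f g)
  then show ?case using trig_poly.add by simp
next
  case (mult f g)
  then show ?case using trig_poly_mult by simp
qed

text \<open>A continuous map of a compact space onto a Hausdorff space is a quotient map, so a
  continuous function that is constant on its fibres descends.\<close>

lemma continuous_circle_lift:
  fixes k :: "real \<Rightarrow> real"
  assumes k: "continuous_on {0..2 * pi} k" and per: "k 0 = k (2 * pi)"
  shows "\<exists>G. continuous_on (sphere 0 1) G \<and> (\<forall>x\<in>{0..2 * pi}. G (exp (\<i> * of_real x)) = k x)"
proof (intro exI[of _ "\<lambda>z. k (Arg2pi z)"] conjI)
  let ?X = "top_of_set {0..2 * pi}" and ?Y = "top_of_set (sphere (0 :: complex) 1)"
  let ?e = "\<lambda>x. exp (\<i> * complex_of_real x)"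
  have eq: "k (Arg2pi (?e x)) = k x" if x: "x \<in> {0..2 * pi}" for x
  \<comment> \<open>\<open>Arg2pi\<close> takes values in [0, 2 pi), so the right end point is sent
    to 0, and the equality of the end values enters.\<close>
  proof (cases "x = 2 * pi")
    case True
    have "?e x = 1" using exp_two_pi_i' by (simp add: True mult_ac)
    then show ?thesis using True per by (simp add: Arg2pi_eq_0[THEN iffD2])
  next
    case False
    then have "Arg2pi (?e x) = x" using x by (intro Arg2pi_unique[of 1]) auto
    then show ?thesis by simp
  qed
  show "\<forall>x\<in>{0..2 * pi}. k (Arg2pi (?e x)) = k x" using eq by blast
  have img: "?e ` {0..2 * pi} = sphere 0 1"
  proof
    show "?e ` {0..2 * pi} \<subseteq> sphere 0 1" by auto
    show "sphere 0 1 \<subseteq> ?e ` {0..2 * pi}"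
    proof
      fix z :: complex assume "z \<in> sphere 0 1"
      then have "?e (Arg2pi z) = z" by (simp add: complex_norm_eq_1_exp[symmetric])
      then show "z \<in> ?e ` {0..2 * pi}"
        using Arg2pi_ge_0[of z] Arg2pi_lt_2pi[of z] by (intro image_eqI[of _ _ "Arg2pi z"]) auto
    qed
  qed
  have "quotient_map ?X ?Y ?e"
  proof (rule T1_Spaces.continuous_imp_quotient_map)
    show "continuous_map ?X ?Y ?e" using img by (auto intro!: continuous_intros)
    show "compact_space ?X" by (simp add: compact_space_subtopology)
    show "Hausdorff_space ?Y" by (simp add: Hausdorff_space_subtopology)
    show "?e ` topspace ?X = topspace ?Y" using img by simp
  qed
  moreover have "continuous_map ?X euclidean ((\<lambda>z. k (Arg2pi z)) \<circ> ?e)"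
  proof (rule continuous_map_eq[of _ _ k])
    show "continuous_map ?X euclidean k" using k by simp
    show "k x = ((\<lambda>z. k (Arg2pi z)) \<circ> ?e) x" if "x \<in> topspace ?X" for x using eq[of x] that by simp
  qed
  ultimately have "continuous_map ?Y euclidean (\<lambda>z. k (Arg2pi z))"
    using continuous_compose_quotient_map_eq by blast
  then show "continuous_on (sphere 0 1) (\<lambda>z. k (Arg2pi z))" by simp
qed

context
  fixes g :: "real \<Rightarrow> complex"
  assumes g: "integrable circ_measure g"
    and zero: "\<And>n. integral\<^sup>L circ_measure (\<lambda>x. g x * expc n x) = 0"
begin

lemma integral_trig_poly_zero:
  "trig_poly h \<Longrightarrow> integrable circ_measure (\<lambda>x. g x * h x) \<and> integral\<^sup>L circ_measure (\<lambda>x. g x * h x) = 0"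
proof (induction rule: trig_poly.induct)
  case (mono c n)
  have "integrable circ_measure (\<lambda>x. g x * expc n x)"
    by (rule integrable_bounded_mult[OF g measurable_expc, of _ 1]) (simp add: expc_simps)
  moreover have "(\<lambda>x. g x * (c * expc n x)) = (\<lambda>x. c * (g x * expc n x))" by (simp add: mult_ac)
  ultimately show ?case using zero by simp
next
  case (add f h)
  then show ?case by (simp add: distrib_left)
qed

text \<open>By Stone-Weierstrass on the circle, k is a uniform limit of trigonometric polynomials,
  each of which integrates to 0 against g; the error is at most e times the L^1 norm of g.\<close>

lemma integral_periodic_real_zero:
  fixes k :: "real \<Rightarrow> real"
  assumes k: "continuous_on UNIV k" and per: "k 0 = k (2 * pi)"
  shows "integral\<^sup>L circ_measure (\<lambda>x. g x * of_real (k x)) = 0"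
proof -
  obtain G where G: "continuous_on (sphere 0 1) G" "\<And>x. x \<in> {0..2 * pi} \<Longrightarrow> G (exp (\<i> * of_real x)) = k x"
    using continuous_circle_lift[OF continuous_on_subset[OF k subset_UNIV] per] by blast
  have km: "(\<lambda>x. complex_of_real (k x)) \<in> borel_measurable circ_measure"
    by (rule continuous_measurable_circ) (intro continuous_intros k)
  have "compact (k ` {0..2 * pi})"
    by (intro compact_continuous_image continuous_on_subset[OF k]) auto
  then obtain B where B: "\<And>x. x \<in> {0..2 * pi} \<Longrightarrow> \<bar>k x\<bar> \<le> B"
    using compact_imp_bounded bounded_iff by (metis imageI real_norm_def)
  have ik: "integrable circ_measure (\<lambda>x. g x * of_real (k x))"
    by (rule integrable_bounded_mult[OF g km, of B]) (use B in auto)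
  let ?C = "integral\<^sup>L circ_measure (\<lambda>x. cmod (g x))"
  have "norm (integral\<^sup>L circ_measure (\<lambda>x. g x * of_real (k x))) \<le> e * ?C" if e: "0 < e" for e
  proof -
    obtain p where p: "real_polynomial_function p" "\<And>z. z \<in> sphere 0 1 \<Longrightarrow> \<bar>G z - p z\<bar> < e"
      using Stone_Weierstrass_real_polynomial_function[OF compact_sphere G(1) e] by metis
    let ?h = "\<lambda>x. complex_of_real (p (exp (\<i> * of_real x)))"
    note h = integral_trig_poly_zero[OF trig_poly_real_polynomial[OF p(1)]]
    have "integral\<^sup>L circ_measure (\<lambda>x. g x * of_real (k x))
        = integral\<^sup>L circ_measure (\<lambda>x. g x * of_real (k x) - g x * ?h x)"
      using h ik by simp
    also have "norm \<dots> \<le> integral\<^sup>L circ_measure (\<lambda>x. e * cmod (g x))"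
    proof (rule Bochner_Integration.integral_norm_bound_integral)
      show "integrable circ_measure (\<lambda>x. g x * of_real (k x) - g x * ?h x)" using h ik by simp
      show "integrable circ_measure (\<lambda>x. e * cmod (g x))" using g by simp
      fix x assume "x \<in> space circ_measure"
      then have x: "x \<in> {0..2 * pi}" by simp
      have "\<bar>k x - p (exp (\<i> * of_real x))\<bar> \<le> e"
        using p(2)[of "exp (\<i> * of_real x)"] G(2)[OF x] by simp
      then have "cmod (g x) * \<bar>k x - p (exp (\<i> * of_real x))\<bar> \<le> cmod (g x) * e"
        by (rule mult_left_mono) simp
      moreover have "g x * of_real (k x) - g x * ?h x = g x * of_real (k x - p (exp (\<i> * of_real x)))"
        by (simp add: right_diff_distrib)
      ultimately show "norm (g x * of_real (k x) - g x * ?h x) \<le> e * cmod (g x)"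
        by (simp only: norm_mult norm_of_real mult.commute)
    qed
    finally show ?thesis by simp
  qed
  then have "norm (integral\<^sup>L circ_measure (\<lambda>x. g x * of_real (k x))) \<le> 0 + e" if e: "0 < e" for e
  proof -
    have C: "0 \<le> ?C" by simp
    have "norm (integral\<^sup>L circ_measure (\<lambda>x. g x * of_real (k x))) \<le> e / (?C + 1) * ?C"
      by (rule \<open>\<And>e. 0 < e \<Longrightarrow> _\<close>) (intro divide_pos_pos e add_nonneg_pos C zero_less_one)
    also have "\<dots> \<le> e"
    proof -
      have "e / (c + 1) * c \<le> e" if "0 \<le> c" for c :: real using e that by (simp add: field_simps)
      from this[OF C] show ?thesis .
    qed
    finally show ?thesis by simp
  qed
  then have "norm (integral\<^sup>L circ_measure (\<lambda>x. g x * of_real (k x))) \<le> 0"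
    by (rule field_le_epsilon)
  then show ?thesis by simp
qed

text \<open>We test \<open>g\<close> against continuous functions \<open>r n\<close> that are bounded by 1, vanish at the end points
  and converge almost everywhere to the conjugate sign of \<open>g\<close>.\<close>

lemma fourier_coefficients_zero_imp_AE: "AE x in circ_measure. g x = 0"
proof -
  define s where "s x = cnj (sgn (g x))" for x
  have gm: "g \<in> borel_measurable circ_measure" using g by simp
  have sm: "s \<in> borel_measurable circ_measure"
    unfolding s_def sgn_div_norm using gm by (intro measurable_cnj) measurable
  then have "s measurable_on {0..2 * pi}"
    using measurable_on_iff_borel_measurable[OF sets_circ] by blast
  then obtain N q where N: "negligible N" and q: "\<And>n. continuous_on UNIV (q n)"
    and lim: "\<And>x. x \<notin> N \<Longrightarrow> (\<lambda>n. q n x) \<longlonglongrightarrow> (if x \<in> {0..2 * pi} then s x else 0)"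
    unfolding measurable_on_def by blast
  \<comment> \<open>Vanishes at both end points, as periodicity requires, and equals 1 at each
    interior point once n is large.\<close>
  define cut where "cut n x = min 1 (real n * max 0 (min x (2 * pi - x)))" for n and x :: real
  \<comment> \<open>Division by max 1 |q| bounds the modulus by 1 and leaves the limit unchanged, as
    the conjugate sign has modulus at most 1.\<close>
  define r where "r n x = of_real (cut n x) * (q n x / of_real (max 1 (cmod (q n x))))" for n x
  have rc: "continuous_on UNIV (r n)" for n
    unfolding r_def cut_def by (intro continuous_intros q) auto
  have cut01: "0 \<le> cut n x" "cut n x \<le> 1" for n x by (auto simp: cut_def)
  have clamp: "cmod (w / of_real (max 1 (cmod w))) \<le> 1" for w :: complex
    by (simp add: norm_divide)
  have r1: "cmod (r n x) \<le> 1" for n x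
  proof -
    have "cmod (r n x) = cut n x * cmod (q n x / of_real (max 1 (cmod (q n x))))"
      by (simp only: r_def norm_mult norm_of_real abs_of_nonneg[OF cut01(1)])
    also have "\<dots> \<le> 1 * 1" by (intro mult_mono cut01 clamp) auto
    finally show ?thesis by simp
  qed
  have r0: "r n 0 = 0" "r n (2 * pi) = 0" for n by (simp_all add: r_def cut_def)
  have zero_r: "integral\<^sup>L circ_measure (\<lambda>x. g x * r n x) = 0" for n
  proof -
    have b: "integrable circ_measure (\<lambda>x. g x * complex_of_real (f (r n x)))"
      if f: "continuous_on UNIV f" "\<And>z. \<bar>f z\<bar> \<le> cmod z" for f :: "complex \<Rightarrow> real"
    proof (rule integrable_bounded_mult[OF g, of _ 1])
      show "(\<lambda>x. complex_of_real (f (r n x))) \<in> borel_measurable circ_measure"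
        by (rule continuous_measurable_circ) (intro continuous_intros continuous_on_compose2[OF f(1) rc], auto)
      show "cmod (complex_of_real (f (r n x))) \<le> 1" for x
        using order_trans[OF f(2)[of "r n x"] r1] by simp
    qed
    have z: "integral\<^sup>L circ_measure (\<lambda>x. g x * complex_of_real (f (r n x))) = 0"
      if f: "continuous_on UNIV f" "\<And>z. \<bar>f z\<bar> \<le> cmod z" for f :: "complex \<Rightarrow> real"
      by (rule integral_periodic_real_zero[of "\<lambda>x. f (r n x)"])
        (auto intro!: continuous_on_compose2[OF f(1) rc] simp: r0)
    have "g x * r n x = g x * of_real (Re (r n x)) + \<i> * (g x * of_real (Im (r n x)))" for x
      by (subst complex_eq[of "r n x"]) (simp add: algebra_simps)
    then show ?thesis
      using b[of Re] b[of Im] z[of Re] z[of Im]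
      by (simp add: abs_Re_le_cmod abs_Im_le_cmod continuous_on_Re continuous_on_Im continuous_on_id)
  qed
  have AEN: "AE x in circ_measure. x \<notin> N"
  proof -
    have "AE x in lebesgue. x \<notin> N"
      using N by (intro AE_not_in) (simp add: negligible_iff_null_sets)
    then show ?thesis by (auto simp: AE_restrict_space_iff elim: eventually_mono)
  qed
  have AE0: "AE x in circ_measure. x \<noteq> 0 \<and> x \<noteq> 2 * pi"
  proof -
    have "AE x in lebesgue. x \<notin> {0, 2 * pi}"
      by (intro AE_not_in) (simp add: negligible_iff_null_sets[symmetric])
    then show ?thesis by (auto simp: AE_restrict_space_iff elim: eventually_mono)
  qed
  have "(\<lambda>n. integral\<^sup>L circ_measure (\<lambda>x. g x * r n x)) \<longlonglongrightarrow> integral\<^sup>L circ_measure (\<lambda>x. g x * s x)"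
  proof (rule integral_dominated_convergence[where w = "\<lambda>x. cmod (g x)"])
    show "(\<lambda>x. g x * s x) \<in> borel_measurable circ_measure"
      by (intro borel_measurable_times gm sm)
    show "(\<lambda>x. g x * r n x) \<in> borel_measurable circ_measure" for n
      by (intro borel_measurable_times gm continuous_measurable_circ rc)
    show "integrable circ_measure (\<lambda>x. cmod (g x))" using g by simp
    show "AE x in circ_measure. norm (g x * r n x) \<le> cmod (g x)" for n
      by (rule AE_I2) (use r1 in \<open>simp add: norm_mult mult_left_le\<close>)
    show "AE x in circ_measure. (\<lambda>n. g x * r n x) \<longlonglongrightarrow> g x * s x"
      using AEN AE0 AE_space
    proof eventually_elim
      case (elim x)
      then have x: "0 < x" "x < 2 * pi" by auto
      have qx: "(\<lambda>n. q n x) \<longlonglongrightarrow> s x" using lim[OF elim(1)] x by simp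
      have m1: "max 1 (cmod (s x)) = 1" by (simp add: s_def norm_sgn)
      have "(\<lambda>n. max 1 (cmod (q n x))) \<longlonglongrightarrow> 1"
        using tendsto_max[OF tendsto_const tendsto_norm[OF qx], of 1] by (simp only: m1)
      then have "(\<lambda>n. q n x / of_real (max 1 (cmod (q n x)))) \<longlonglongrightarrow> s x / of_real 1"
        by (intro tendsto_divide tendsto_of_real qx) auto
      moreover have "(\<lambda>n. cut n x) \<longlonglongrightarrow> 1"
      proof (rule tendsto_eventually)
        obtain n0 where n0: "1 / min x (2 * pi - x) < real n0" using reals_Archimedean2 by blast
        have "cut n x = 1" if "n \<ge> n0" for n
        proof -
          have m: "0 < min x (2 * pi - x)" using x by simp
          have "1 < real n0 * min x (2 * pi - x)" using n0 m by (simp add: pos_divide_less_eq)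
          also have "\<dots> \<le> real n * min x (2 * pi - x)" using that m by (intro mult_right_mono) auto
          finally show ?thesis using m by (simp add: cut_def max_def)
        qed
        then show "\<forall>\<^sub>F n in sequentially. cut n x = 1" by (auto simp: eventually_sequentially)
      qed
      ultimately have "(\<lambda>n. g x * r n x) \<longlonglongrightarrow> g x * (of_real 1 * (s x / of_real 1))"
        unfolding r_def by (intro tendsto_mult tendsto_const tendsto_of_real)
      then show ?case by simp
    qed
  qed
  then have "integral\<^sup>L circ_measure (\<lambda>x. g x * s x) = 0"
    by (simp add: zero_r LIMSEQ_const_iff)
  moreover have "g x * s x = of_real (cmod (g x))" for x
  proof -
    have "g x * s x = (g x * cnj (g x)) / of_real (cmod (g x))" by (simp add: s_def sgn_eq)
    then show ?thesis by (simp add: complex_norm_square[symmetric] power2_eq_square)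
  qed
  ultimately have "integral\<^sup>L circ_measure (\<lambda>x. cmod (g x)) = 0" by simp
  then have "AE x in circ_measure. cmod (g x) = 0"
    using integral_nonneg_eq_0_iff_AE[of circ_measure "\<lambda>x. cmod (g x)"] g by simp
  then show ?thesis by simp
qed

end

subsection \<open>The Riesz--Fischer theorem\<close>

lemma integrable_continuous_circ:
  "continuous_on UNIV f \<Longrightarrow> integrable circ_measure (f :: real \<Rightarrow> 'a::euclidean_space)"
  by (rule continuous_imp_integrable_real) (rule continuous_on_subset, auto)

lemma integral_sq_trig_sum:
  fixes c :: "nat \<Rightarrow> complex"
  assumes "finite K"
  shows "integral\<^sup>L circ_measure (\<lambda>x. (cmod (\<Sum>k\<in>K. c k * expc (int k) x))\<^sup>2) = 2 * pi * (\<Sum>k\<in>K. (cmod (c k))\<^sup>2)"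
proof -
  have cont: "continuous_on UNIV (\<lambda>x. c k * cnj (c l) * expc (int k - int l) x)" for k l
    by (intro continuous_intros continuous_on_expc)
  have sq: "complex_of_real ((cmod (\<Sum>k\<in>K. c k * expc (int k) x))\<^sup>2)
      = (\<Sum>k\<in>K. \<Sum>l\<in>K. c k * cnj (c l) * expc (int k - int l) x)" for x
  proof -
    have "complex_of_real ((cmod (\<Sum>k\<in>K. c k * expc (int k) x))\<^sup>2)
        = (\<Sum>k\<in>K. c k * expc (int k) x) * (\<Sum>l\<in>K. cnj (c l) * expc (- int l) x)"
      by (simp only: complex_norm_square cnj_sum complex_cnj_mult expc_simps)
    also have "\<dots> = (\<Sum>k\<in>K. \<Sum>l\<in>K. c k * cnj (c l) * (expc (int k) x * expc (- int l) x))"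
      by (simp only: sum_product mult_ac)
    finally show ?thesis by (simp only: expc_simps) simp
  qed
  have "complex_of_real (integral\<^sup>L circ_measure (\<lambda>x. (cmod (\<Sum>k\<in>K. c k * expc (int k) x))\<^sup>2))
      = integral\<^sup>L circ_measure (\<lambda>x. \<Sum>k\<in>K. \<Sum>l\<in>K. c k * cnj (c l) * expc (int k - int l) x)"
    unfolding sq[symmetric] by (rule integral_complex_of_real[symmetric])
  also have "\<dots> = (\<Sum>k\<in>K. \<Sum>l\<in>K. c k * cnj (c l) * (if int k - int l = 0 then 2 * pi else 0))"
    by (simp only: Bochner_Integration.integral_sum integrable_continuous_circ[OF cont]
        Bochner_Integration.integrable_sum integral_mult_right_zero integral_expc)
  also have "\<dots> = (\<Sum>k\<in>K. c k * cnj (c k) * (2 * pi))"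
    using assms by (intro sum.cong refl) (simp add: if_distrib sum.delta cong: if_cong)
  also have "\<dots> = complex_of_real (2 * pi * (\<Sum>k\<in>K. (cmod (c k))\<^sup>2))"
    by (simp add: complex_norm_square[symmetric] sum_distrib_left mult_ac)
  finally show ?thesis by (simp only: of_real_eq_iff)
qed

lemma fatou_sq:
  fixes h :: "nat \<Rightarrow> real \<Rightarrow> complex"
  assumes m: "\<And>i. h i \<in> borel_measurable M" and lim: "AE x in M. (\<lambda>i. h i x) \<longlonglongrightarrow> f x"
    and le: "\<forall>\<^sub>F i in sequentially. (\<integral>\<^sup>+x. ennreal ((cmod (h i x))\<^sup>2) \<partial>M) \<le> B"
  shows "(\<integral>\<^sup>+x. ennreal ((cmod (f x))\<^sup>2) \<partial>M) \<le> B"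
proof -
  have "(\<integral>\<^sup>+x. ennreal ((cmod (f x))\<^sup>2) \<partial>M) = (\<integral>\<^sup>+x. liminf (\<lambda>i. ennreal ((cmod (h i x))\<^sup>2)) \<partial>M)"
  proof (rule nn_integral_cong_AE)
    show "AE x in M. ennreal ((cmod (f x))\<^sup>2) = liminf (\<lambda>i. ennreal ((cmod (h i x))\<^sup>2))"
      using lim
    proof eventually_elim
      case (elim x)
      have "(\<lambda>i. ennreal ((cmod (h i x))\<^sup>2)) \<longlonglongrightarrow> ennreal ((cmod (f x))\<^sup>2)"
        by (intro tendsto_ennrealI tendsto_power tendsto_norm elim)
      from lim_imp_Liminf[OF sequentially_bot this] show ?case by simp
    qed
  qed
  also have "\<dots> \<le> liminf (\<lambda>i. \<integral>\<^sup>+x. ennreal ((cmod (h i x))\<^sup>2) \<partial>M)"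
    by (rule nn_integral_liminf) (use m in measurable)
  also have "\<dots> \<le> B" by (rule Liminf_le[OF sequentially_bot le])
  finally show ?thesis .
qed

lemma amgm_weighted: "0 < w \<Longrightarrow> (a :: real) \<le> (w + a\<^sup>2 / w) / 2"
proof -
  assume w: "0 < w"
  have "0 \<le> (a - w)\<^sup>2 / w" using w by simp
  also have "(a - w)\<^sup>2 / w = a\<^sup>2 / w + w - 2 * a" using w by (simp add: power2_eq_square field_simps)
  finally show ?thesis by simp
qed

text \<open>Cauchy-Schwarz on a space of mass 2 pi, through the pointwise bound a <= (w + a^2 / w) /
  2, which is sharp at a = w.\<close>

lemma integral_norm_le_sq:
  fixes f :: "real \<Rightarrow> complex"
  assumes m: "f \<in> borel_measurable circ_measure" and sq: "integrable circ_measure (\<lambda>x. (cmod (f x))\<^sup>2)"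
    and w: "0 < w" and le: "integral\<^sup>L circ_measure (\<lambda>x. (cmod (f x))\<^sup>2) \<le> 2 * pi * w\<^sup>2"
  shows "integrable circ_measure f" "integral\<^sup>L circ_measure (\<lambda>x. cmod (f x)) \<le> 2 * pi * w"
proof -
  interpret finite_measure circ_measure by (rule finite_measure_circ)
  have i: "integrable circ_measure (\<lambda>x. (w + (cmod (f x))\<^sup>2 / w) / 2)"
    by (intro integrable_divide Bochner_Integration.integrable_add sq) simp
  show f: "integrable circ_measure f"
    by (rule Bochner_Integration.integrable_bound[OF i m]) (rule AE_I2, use amgm_weighted[OF w] w in simp)
  have "integral\<^sup>L circ_measure (\<lambda>x. cmod (f x)) \<le> integral\<^sup>L circ_measure (\<lambda>x. (w + (cmod (f x))\<^sup>2 / w) / 2)"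
    by (intro integral_mono i integrable_norm f amgm_weighted w)
  also have "\<dots> = (2 * pi * w + integral\<^sup>L circ_measure (\<lambda>x. (cmod (f x))\<^sup>2) / w) / 2"
    using sq by (simp add: integral_const_circ[of w, simplified] Bochner_Integration.integral_add)
  also have "\<dots> \<le> (2 * pi * w + 2 * pi * w\<^sup>2 / w) / 2"
    using le w by (intro divide_right_mono add_left_mono) auto
  also have "\<dots> = 2 * pi * w" using w by (simp add: power2_eq_square)
  finally show "integral\<^sup>L circ_measure (\<lambda>x. cmod (f x)) \<le> 2 * pi * w" .
qed

text \<open>The partial sums converge almost everywhere along a subsequence whose L^2 increments are
  of order 2^{-j}, since the L^1 norms of the increments are then summable. Fatou's lemma bounds the
  limit and its distance to the subsequence in L^2, and L^1 convergence carries the coefficients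
  over.\<close>

lemma riesz_fischer:
  fixes c :: "nat \<Rightarrow> complex"
  assumes c: "summable (\<lambda>k. (cmod (c k))\<^sup>2)"
  shows "\<exists>f. f \<in> borel_measurable circ_measure \<and> integrable circ_measure (\<lambda>x. (cmod (f x))\<^sup>2) \<and>
    integral\<^sup>L circ_measure (\<lambda>x. (cmod (f x))\<^sup>2) \<le> 2 * pi * (\<Sum>k. (cmod (c k))\<^sup>2) \<and>
    (\<forall>n. integral\<^sup>L circ_measure (\<lambda>x. f x * expc (- n) x) = 2 * pi * (if 0 \<le> n then c (nat n) else 0))"
proof -
  define S where "S n x = (\<Sum>k<n. c k * expc (int k) x)" for n x
  have Sc: "continuous_on UNIV (S n)" for n
    unfolding S_def by (intro continuous_intros continuous_on_expc)
  have Sm: "S n \<in> borel_measurable circ_measure" for n by (rule continuous_measurable_circ[OF Sc])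
  have Sdiff: "S n x - S m x = (\<Sum>k\<in>{m..<n}. c k * expc (int k) x)" if "m \<le> n" for m n x
    using sum_diff_nat_ivl[of 0 m n "\<lambda>k. c k * expc (int k) x"] that by (simp add: S_def atLeast0LessThan)
  have dcont: "continuous_on UNIV (\<lambda>x. S n x - S m x)" for n m by (intro continuous_intros Sc)
  have sqcont: "continuous_on UNIV (\<lambda>x. (cmod (S n x - S m x))\<^sup>2)" for n m
    by (intro continuous_intros Sc)
  have Sint: "integral\<^sup>L circ_measure (\<lambda>x. (cmod (S n x - S m x))\<^sup>2) = 2 * pi * (\<Sum>k\<in>{m..<n}. (cmod (c k))\<^sup>2)"
    if "m \<le> n" for m n
    unfolding Sdiff[OF that] by (rule integral_sq_trig_sum) simp
  have Snn: "(\<integral>\<^sup>+x. ennreal ((cmod (S n x - S m x))\<^sup>2) \<partial>circ_measure) = ennreal (2 * pi * (\<Sum>k\<in>{m..<n}. (cmod (c k))\<^sup>2))"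
    if "m \<le> n" for m n
    using nn_integral_eq_integral[OF integrable_continuous_circ[OF sqcont], of n m] Sint[OF that] by simp
  have "\<forall>j. \<exists>N. \<forall>m\<ge>N. \<forall>n. (\<Sum>k\<in>{m..<n}. (cmod (c k))\<^sup>2) \<le> (1 / 4) ^ j"
  proof
    fix j
    have "0 < (1 / 4 :: real) ^ j" by simp
    then obtain N where N: "\<And>m n. N \<le> m \<Longrightarrow> norm (\<Sum>k\<in>{m..<n}. (cmod (c k))\<^sup>2) < (1 / 4) ^ j"
      using c unfolding summable_Cauchy by blast
    have "(\<Sum>k\<in>{m..<n}. (cmod (c k))\<^sup>2) \<le> (1 / 4) ^ j" if "N \<le> m" for m n
      using less_imp_le[OF N[OF that, of n]] by (simp add: sum_nonneg)
    then show "\<exists>N. \<forall>m\<ge>N. \<forall>n. (\<Sum>k\<in>{m..<n}. (cmod (c k))\<^sup>2) \<le> (1 / 4) ^ j" by blast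
  qed
  then obtain Nf where Nf: "\<And>j m n. Nf j \<le> m \<Longrightarrow> (\<Sum>k\<in>{m..<n}. (cmod (c k))\<^sup>2) \<le> (1 / 4) ^ j" by metis
  \<comment> \<open>Summing the thresholds makes r monotone with \<open>Nf j\<close> at most r j;
    the extra j makes it unbounded.\<close>
  define r where "r j = j + (\<Sum>i\<le>j. Nf i)" for j
  have rS: "r j \<le> r (Suc j)" for j by (simp add: r_def)
  have rmono: "r i \<le> r j" if "i \<le> j" for i j using lift_Suc_mono_le[of r, OF rS that] .
  have rN: "Nf j \<le> r j" for j
    using member_le_sum[of j "{..j}" Nf] by (simp add: r_def)
  have rj: "j \<le> r j" for j by (simp add: r_def)
  have half: "(1 / 4 :: real) ^ j = ((1 / 2) ^ j)\<^sup>2" for j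
    by (simp add: power2_eq_square power_mult_distrib[symmetric])
  have tail: "integral\<^sup>L circ_measure (\<lambda>x. (cmod (S n x - S (r j) x))\<^sup>2) \<le> 2 * pi * ((1 / 2) ^ j)\<^sup>2"
    if "r j \<le> n" for j n
    unfolding Sint[OF that] half[symmetric] by (intro mult_left_mono Nf rN) auto
  define d where "d j x = S (r (Suc j)) x - S (r j) x" for j x
  have d1: "integral\<^sup>L circ_measure (\<lambda>x. cmod (d j x)) \<le> 2 * pi * (1 / 2) ^ j"
    "integrable circ_measure (d j)" for j
  proof -
    have "0 < (1 / 2 :: real) ^ j" by simp
    note integral_norm_le_sq[OF continuous_measurable_circ[OF dcont] integrable_continuous_circ[OF sqcont] this tail[OF rS]]
    then show "integral\<^sup>L circ_measure (\<lambda>x. cmod (d j x)) \<le> 2 * pi * (1 / 2) ^ j"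
      "integrable circ_measure (d j)" by (simp_all only: d_def[abs_def])
  qed
  have AEconv: "AE x in circ_measure. convergent (\<lambda>j. S (r j) x)"
  proof -
    have dm: "(\<lambda>x. ennreal (cmod (d j x))) \<in> borel_measurable circ_measure" for j
      using d1(2)[of j] by measurable
    have "(\<integral>\<^sup>+x. (\<Sum>j. ennreal (cmod (d j x))) \<partial>circ_measure) = (\<Sum>j. \<integral>\<^sup>+x. ennreal (cmod (d j x)) \<partial>circ_measure)"
      by (rule nn_integral_suminf[OF dm])
    also have "\<dots> = (\<Sum>j. ennreal (integral\<^sup>L circ_measure (\<lambda>x. cmod (d j x))))"
      by (intro suminf_cong nn_integral_eq_integral integrable_norm d1) auto
    also have "\<dots> \<noteq> top"
    proof (rule ennreal_suminf_neq_top)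
      show "summable (\<lambda>j. integral\<^sup>L circ_measure (\<lambda>x. cmod (d j x)))"
      proof (rule summable_comparison_test')
        show "summable (\<lambda>j. 2 * pi * (1 / 2 :: real) ^ j)"
          by (intro summable_mult summable_geometric) simp
        show "norm (integral\<^sup>L circ_measure (\<lambda>x. cmod (d j x))) \<le> 2 * pi * (1 / 2) ^ j" for j
          using d1(1)[of j] by simp
      qed
    qed simp
    finally have "(\<integral>\<^sup>+x. (\<Sum>j. ennreal (cmod (d j x))) \<partial>circ_measure) \<noteq> \<infinity>" by simp
    from nn_integral_PInf_AE[OF borel_measurable_suminf_order[OF dm] this]
    have "AE x in circ_measure. (\<Sum>j. ennreal (cmod (d j x))) \<noteq> \<infinity>" .
    then show ?thesis
    proof eventually_elim
      case (elim x)
      then have "summable (\<lambda>j. cmod (d j x))" by (intro summable_suminf_not_top) auto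
      then have "summable (\<lambda>j. d j x)" by (rule summable_norm_cancel)
      then have "(\<lambda>n. \<Sum>j<n. d j x) \<longlonglongrightarrow> (\<Sum>j. d j x)" using summable_LIMSEQ by blast
      moreover have "(\<Sum>j<n. d j x) = S (r n) x - S (r 0) x" for n
        unfolding d_def by (rule sum_lessThan_telescope)
      ultimately have "(\<lambda>n. S (r n) x - S (r 0) x) \<longlonglongrightarrow> (\<Sum>j. d j x)" by simp
      from tendsto_add[OF this tendsto_const[of "S (r 0) x"]] show ?case
        by (auto simp: convergent_def)
    qed
  qed
  define f where "f x = lim (\<lambda>j. S (r j) x)" for x
  have fm: "f \<in> borel_measurable circ_measure"
    unfolding f_def by (intro borel_measurable_lim_metric Sm)
  have AElim: "AE x in circ_measure. (\<lambda>j. S (r j) x) \<longlonglongrightarrow> f x"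
    using AEconv by eventually_elim (simp add: f_def convergent_LIMSEQ_iff)
  have tot: "(\<integral>\<^sup>+x. ennreal ((cmod (f x))\<^sup>2) \<partial>circ_measure) \<le> ennreal (2 * pi * (\<Sum>k. (cmod (c k))\<^sup>2))"
  proof (rule fatou_sq[OF _ AElim])
    show "\<forall>\<^sub>F i in sequentially. (\<integral>\<^sup>+x. ennreal ((cmod (S (r i) x))\<^sup>2) \<partial>circ_measure) \<le> ennreal (2 * pi * (\<Sum>k. (cmod (c k))\<^sup>2))"
    proof (intro always_eventually allI)
      fix i
      have "S 0 x = 0" for x by (simp add: S_def)
      then show "(\<integral>\<^sup>+x. ennreal ((cmod (S (r i) x))\<^sup>2) \<partial>circ_measure) \<le> ennreal (2 * pi * (\<Sum>k. (cmod (c k))\<^sup>2))"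
        using Snn[of 0 "r i"] sum_le_suminf[OF c, of "{0..<r i}"] by (auto intro!: ennreal_leI)
    qed
  qed (rule Sm)
  have sqm: "(\<lambda>x. (cmod (f x))\<^sup>2) \<in> borel_measurable circ_measure" using fm by measurable
  have fsq: "integrable circ_measure (\<lambda>x. (cmod (f x))\<^sup>2)"
    by (rule integrableI_nonneg[OF sqm]) (use tot in \<open>auto simp: top_unique less_top[symmetric]\<close>)
  have fle: "integral\<^sup>L circ_measure (\<lambda>x. (cmod (f x))\<^sup>2) \<le> 2 * pi * (\<Sum>k. (cmod (c k))\<^sup>2)"
    using tot nn_integral_eq_integral[OF fsq] by (simp add: suminf_nonneg c)
  have approx: "integrable circ_measure (\<lambda>x. f x - S (r j) x)"
      "integral\<^sup>L circ_measure (\<lambda>x. cmod (f x - S (r j) x)) \<le> 2 * pi * (1 / 2) ^ j" for j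
  proof -
    have "(\<integral>\<^sup>+x. ennreal ((cmod (f x - S (r j) x))\<^sup>2) \<partial>circ_measure) \<le> ennreal (2 * pi * ((1 / 2) ^ j)\<^sup>2)"
    proof (rule fatou_sq[where h = "\<lambda>i x. S (r i) x - S (r j) x"])
      show "AE x in circ_measure. (\<lambda>i. S (r i) x - S (r j) x) \<longlonglongrightarrow> f x - S (r j) x"
        using AElim by eventually_elim (intro tendsto_intros)
      show "\<forall>\<^sub>F i in sequentially. (\<integral>\<^sup>+x. ennreal ((cmod (S (r i) x - S (r j) x))\<^sup>2) \<partial>circ_measure)
          \<le> ennreal (2 * pi * ((1 / 2) ^ j)\<^sup>2)"
        using eventually_ge_at_top[of j]
      proof eventually_elim
        case (elim i)
        show ?case
          unfolding Snn[OF rmono[OF elim]] half[symmetric] by (intro ennreal_leI mult_left_mono Nf rN) auto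
      qed
    qed (intro borel_measurable_diff Sm)
    note nn = this
    have dm: "(\<lambda>x. f x - S (r j) x) \<in> borel_measurable circ_measure" by (intro borel_measurable_diff fm Sm)
    have sq: "integrable circ_measure (\<lambda>x. (cmod (f x - S (r j) x))\<^sup>2)"
      by (rule integrableI_nonneg) (use dm nn in \<open>auto simp: top_unique less_top[symmetric]\<close>)
    have "integral\<^sup>L circ_measure (\<lambda>x. (cmod (f x - S (r j) x))\<^sup>2) \<le> 2 * pi * ((1 / 2) ^ j)\<^sup>2"
      using nn nn_integral_eq_integral[OF sq] by simp
    from integral_norm_le_sq[OF dm sq _ this] show "integrable circ_measure (\<lambda>x. f x - S (r j) x)"
      "integral\<^sup>L circ_measure (\<lambda>x. cmod (f x - S (r j) x)) \<le> 2 * pi * (1 / 2) ^ j" by auto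
  qed
  have fi: "integrable circ_measure f"
    using Bochner_Integration.integrable_add[OF approx(1)[of 0] integrable_continuous_circ[OF Sc[of "r 0"]]] by simp
  have coeff: "integral\<^sup>L circ_measure (\<lambda>x. f x * expc (- n) x) = 2 * pi * (if 0 \<le> n then c (nat n) else 0)" for n
  proof (rule LIMSEQ_unique)
    have im: "integrable circ_measure (\<lambda>x. h x * expc (- n) x)" if "integrable circ_measure h" for h
      by (rule integrable_bounded_mult[OF that measurable_expc, of _ 1]) (simp add: expc_simps)
    let ?I = "\<lambda>j. integral\<^sup>L circ_measure (\<lambda>x. S (r j) x * expc (- n) x)"
    have "(\<lambda>j. integral\<^sup>L circ_measure (\<lambda>x. f x * expc (- n) x) - ?I j) \<longlonglongrightarrow> 0"
    proof (rule Lim_null_comparison[OF always_eventually[OF allI]])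
      fix j
      have "integral\<^sup>L circ_measure (\<lambda>x. f x * expc (- n) x) - ?I j
          = integral\<^sup>L circ_measure (\<lambda>x. (f x - S (r j) x) * expc (- n) x)"
        using im[OF fi] im[OF integrable_continuous_circ[OF Sc]] by (simp add: left_diff_distrib)
      also have "norm \<dots> \<le> integral\<^sup>L circ_measure (\<lambda>x. norm ((f x - S (r j) x) * expc (- n) x))"
        by (rule integral_norm_bound)
      also have "\<dots> = integral\<^sup>L circ_measure (\<lambda>x. cmod (f x - S (r j) x))"
        by (simp add: norm_mult expc_simps)
      finally show "norm (integral\<^sup>L circ_measure (\<lambda>x. f x * expc (- n) x) - ?I j) \<le> 2 * pi * (1 / 2) ^ j"
        using approx(2)[of j] by linarith
    next
      show "(\<lambda>j. 2 * pi * (1 / 2) ^ j) \<longlonglongrightarrow> 0"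
        by (intro tendsto_mult_right_zero LIMSEQ_realpow_zero) auto
    qed
    from tendsto_diff[OF tendsto_const this, of "integral\<^sup>L circ_measure (\<lambda>x. f x * expc (- n) x)"]
    show "?I \<longlonglongrightarrow> integral\<^sup>L circ_measure (\<lambda>x. f x * expc (- n) x)" by simp
    have "?I j = 2 * pi * (if 0 \<le> n then c (nat n) else 0)" if j: "nat n < j" for j
    proof -
      have "S (r j) x * expc (- n) x = (\<Sum>k<r j. c k * expc (int k - n) x)" for x
        by (simp add: S_def sum_distrib_right mult.assoc expc_simps)
      moreover have "integrable circ_measure (\<lambda>x. c k * expc (int k - n) x)" for k
        by (intro integrable_continuous_circ continuous_intros continuous_on_expc)
      ultimately have "?I j = (\<Sum>k<r j. c k * (if int k - n = 0 then 2 * pi else 0))"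
        by (simp only: Bochner_Integration.integral_sum integral_mult_right_zero integral_expc)
      also have "\<dots> = (\<Sum>k\<in>(if 0 \<le> n then {nat n} else {}). c k * (2 * pi))"
        using order_less_le_trans[OF j rj] by (intro sum.mono_neutral_cong_right) (auto split: if_splits)
      finally show ?thesis by simp
    qed
    then show "?I \<longlonglongrightarrow> 2 * pi * (if 0 \<le> n then c (nat n) else 0)"
      by (intro tendsto_eventually) (auto simp: eventually_sequentially intro!: exI[of _ "Suc (nat n)"])
  qed
  show ?thesis using fm fsq fle coeff by blast
qed

subsection \<open>Classes of square-integrable functions\<close>

lemma ae_eq_refl: "f \<in> borel_measurable circ_measure \<Longrightarrow> ae_eq f f"
  by (simp add: ae_eq_def)

lemma fun_class_cases:
  obtains g where "g \<in> borel_measurable circ_measure" "f = fun_class g"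
proof -
  have "\<exists>g. g \<in> borel_measurable circ_measure \<and> f = fun_class g"
    by (rule circfun.abs_induct[where P = "\<lambda>f. \<exists>g. g \<in> borel_measurable circ_measure \<and> f = fun_class g"])
      (auto simp: ae_eq_def)
  then show thesis using that by blast
qed

lemma fun_class_eqI:
  assumes "f \<in> borel_measurable circ_measure" "g \<in> borel_measurable circ_measure"
    and "AE x in circ_measure. f x = g x"
  shows "fun_class f = fun_class g"
  using assms Quotient3_rel[OF Quotient3_circfun, of f g] by (simp add: ae_eq_def)

lemmas fun_class_ops = plus_circfun.abs_eq[OF ae_eq_refl ae_eq_refl]
  minus_circfun.abs_eq[OF ae_eq_refl ae_eq_refl] times_circfun.abs_eq[OF ae_eq_refl ae_eq_refl]
  cnj_fun.abs_eq[OF ae_eq_refl]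

lemmas inner_fun_class = inner_fun.abs_eq[OF ae_eq_refl ae_eq_refl]

lemma exp_fun_eq: "exp_fun n = fun_class (expc n)"
  by (simp add: exp_fun_def expc_def[abs_def])

lemma exp_fun_zero: "exp_fun 0 = 1"
  by (simp add: exp_fun_eq one_circfun_def expc_simps(1)[abs_def])

lemma fun_class_L2_iff:
  "g \<in> borel_measurable circ_measure \<Longrightarrow> fun_class g \<in> L2 \<longleftrightarrow> integrable circ_measure (\<lambda>x. (cmod (g x))\<^sup>2)"
  by (simp add: L2_def square_integrable.abs_eq[OF ae_eq_refl])

lemma L2_cases:
  assumes "f \<in> L2"
  obtains g where "g \<in> borel_measurable circ_measure" "integrable circ_measure (\<lambda>x. (cmod (g x))\<^sup>2)"
    "f = fun_class g"
  using fun_class_cases[of f] fun_class_L2_iff assms by metis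

lemma integrable_mult_sq:
  fixes g h :: "'a \<Rightarrow> complex"
  assumes m: "g \<in> borel_measurable M" "h \<in> borel_measurable M"
    and sq: "integrable M (\<lambda>x. (cmod (g x))\<^sup>2)" "integrable M (\<lambda>x. (cmod (h x))\<^sup>2)"
  shows "integrable M (\<lambda>x. g x * h x)"
proof (rule Bochner_Integration.integrable_bound[OF Bochner_Integration.integrable_add[OF sq]])
  show "(\<lambda>x. g x * h x) \<in> borel_measurable M" by (intro borel_measurable_times m)
  show "AE x in M. norm (g x * h x) \<le> norm ((cmod (g x))\<^sup>2 + (cmod (h x))\<^sup>2)"
    by (rule AE_I2) (simp add: norm_mult cmod_mult_le_sq)
qed

lemma bounded_mult_L2:
  assumes w: "w \<in> borel_measurable circ_measure" "\<And>x. cmod (w x) \<le> B" and f: "f \<in> L2"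
  shows "fun_class w * f \<in> L2"
proof -
  obtain g where g: "g \<in> borel_measurable circ_measure" "integrable circ_measure (\<lambda>x. (cmod (g x))\<^sup>2)"
    "f = fun_class g" using L2_cases[OF f] .
  have m: "(\<lambda>x. w x * g x) \<in> borel_measurable circ_measure" by (intro borel_measurable_times w g)
  have "integrable circ_measure (\<lambda>x. (cmod (w x * g x))\<^sup>2)"
  proof (rule Bochner_Integration.integrable_bound)
    show "integrable circ_measure (\<lambda>x. B\<^sup>2 * (cmod (g x))\<^sup>2)" using g(2) by simp
    show "AE x in circ_measure. norm ((cmod (w x * g x))\<^sup>2) \<le> norm (B\<^sup>2 * (cmod (g x))\<^sup>2)"
      by (rule AE_I2) (auto simp: norm_mult power_mult_distrib intro!: mult_right_mono power_mono w)
  qed (use m in measurable)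
  then show ?thesis
    using m by (simp add: g(3) fun_class_ops w g fun_class_L2_iff)
qed

lemma const_mult_L2: "f \<in> L2 \<Longrightarrow> const_fun c * f \<in> L2"
  unfolding const_fun_def by (rule bounded_mult_L2[of _ "cmod c"]) auto

lemma exp_mult_L2: "f \<in> L2 \<Longrightarrow> exp_fun n * f \<in> L2"
  unfolding exp_fun_eq by (rule bounded_mult_L2[of _ 1]) (auto simp: measurable_expc expc_simps)

lemma add_L2:
  assumes "f \<in> L2" "g \<in> L2" shows "f + g \<in> L2"
proof -
  obtain a b where a: "a \<in> borel_measurable circ_measure" "integrable circ_measure (\<lambda>x. (cmod (a x))\<^sup>2)" "f = fun_class a"
    and b: "b \<in> borel_measurable circ_measure" "integrable circ_measure (\<lambda>x. (cmod (b x))\<^sup>2)" "g = fun_class b"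
    using L2_cases assms by metis
  have m: "(\<lambda>x. a x + b x) \<in> borel_measurable circ_measure" by (intro borel_measurable_add a b)
  have "integrable circ_measure (\<lambda>x. (cmod (a x + b x))\<^sup>2)"
  proof (rule Bochner_Integration.integrable_bound)
    show "integrable circ_measure (\<lambda>x. 2 * (cmod (a x))\<^sup>2 + 2 * (cmod (b x))\<^sup>2)" using a(2) b(2) by simp
    show "AE x in circ_measure. norm ((cmod (a x + b x))\<^sup>2) \<le> norm (2 * (cmod (a x))\<^sup>2 + 2 * (cmod (b x))\<^sup>2)"
      by (rule AE_I2) (simp add: cmod_add_sq_le)
  qed (use m in measurable)
  then show ?thesis using m by (simp add: a(3) b(3) fun_class_ops a b fun_class_L2_iff)
qed

lemma exp_fun_L2: "exp_fun n \<in> L2"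
proof -
  interpret finite_measure circ_measure by (rule finite_measure_circ)
  show ?thesis
    unfolding exp_fun_eq by (simp add: fun_class_L2_iff measurable_expc expc_simps)
qed

lemma const_fun_simps: "const_fun (- 1) * f = - f" "const_fun 1 * f = f" "const_fun (c * d) = const_fun c * const_fun d"
proof -
  have "const_fun 1 = 1" by (simp add: const_fun_def one_circfun_def)
  moreover have "const_fun (- 1) + const_fun 1 = fun_class (\<lambda>_. 0)"
    unfolding const_fun_def by (subst fun_class_ops) auto
  then have "const_fun (- 1) + const_fun 1 = 0" by (simp add: zero_circfun_def)
  ultimately show "const_fun (- 1) * f = - f" "const_fun 1 * f = f"
    by (simp_all add: eq_neg_iff_add_eq_0[symmetric])
  show "const_fun (c * d) = const_fun c * const_fun d"
    unfolding const_fun_def by (subst fun_class_ops) auto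
qed

lemma diff_L2: "f \<in> L2 \<Longrightarrow> g \<in> L2 \<Longrightarrow> f - g \<in> L2"
  using add_L2[OF _ const_mult_L2[of g "- 1"], of f] by (simp add: const_fun_simps)

lemma inner_fun_add_left:
  assumes "f \<in> L2" "g \<in> L2" "h \<in> L2" shows "inner_fun (f + g) h = inner_fun f h + inner_fun g h"
proof -
  obtain a b k where a: "a \<in> borel_measurable circ_measure" "integrable circ_measure (\<lambda>x. (cmod (a x))\<^sup>2)" "f = fun_class a"
    and b: "b \<in> borel_measurable circ_measure" "integrable circ_measure (\<lambda>x. (cmod (b x))\<^sup>2)" "g = fun_class b"
    and k: "k \<in> borel_measurable circ_measure" "integrable circ_measure (\<lambda>x. (cmod (k x))\<^sup>2)" "h = fun_class k"
    using L2_cases assms by metis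
  have "integrable circ_measure (\<lambda>x. a x * cnj (k x))" "integrable circ_measure (\<lambda>x. b x * cnj (k x))"
    using a b k by (auto intro!: integrable_mult_sq measurable_cnj)
  then show ?thesis
    using borel_measurable_add[OF a(1) b(1)]
    by (simp add: a(3) b(3) k(3) fun_class_ops inner_fun_class a(1) b(1) k(1) distrib_right add_divide_distrib)
qed

lemma inner_fun_const_left: "inner_fun (const_fun c * f) g = c * inner_fun f g"
proof -
  obtain a b where ab: "a \<in> borel_measurable circ_measure" "f = fun_class a"
    "b \<in> borel_measurable circ_measure" "g = fun_class b" using fun_class_cases by metis
  then show ?thesis
    unfolding const_fun_def by (simp add: fun_class_ops inner_fun_class mult.assoc)
qed

lemma inner_fun_commute: "inner_fun g f = cnj (inner_fun f g)"
proof -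
  obtain a b where ab: "a \<in> borel_measurable circ_measure" "f = fun_class a"
    "b \<in> borel_measurable circ_measure" "g = fun_class b" using fun_class_cases by metis
  have "cnj (integral\<^sup>L circ_measure (\<lambda>x. a x * cnj (b x))) = integral\<^sup>L circ_measure (\<lambda>x. cnj (a x * cnj (b x)))"
    by (rule integral_bounded_linear'[OF bounded_linear_cnj bounded_linear_cnj, symmetric]) simp
  then show ?thesis
    unfolding ab(2,4) inner_fun_class[OF ab(1) ab(3)] inner_fun_class[OF ab(3) ab(1)] by (simp add: mult.commute)
qed

lemma fourier_add: "f \<in> L2 \<Longrightarrow> g \<in> L2 \<Longrightarrow> fourier (f + g) n = fourier f n + fourier g n"
  by (simp add: fourier_def inner_fun_add_left exp_fun_L2)

lemma fourier_const: "fourier (const_fun c * f) n = c * fourier f n"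
  by (simp add: fourier_def inner_fun_const_left)

lemma fourier_diff: "f \<in> L2 \<Longrightarrow> g \<in> L2 \<Longrightarrow> fourier (f - g) n = fourier f n - fourier g n"
  using fourier_add[OF _ const_mult_L2[of g "- 1"], of f n] fourier_const[of "- 1" g n]
  by (simp add: const_fun_simps)

lemma fourier_fun_class:
  "g \<in> borel_measurable circ_measure \<Longrightarrow>
    fourier (fun_class g) n = integral\<^sup>L circ_measure (\<lambda>x. g x * expc (- n) x) / (2 * pi)"
  by (simp add: fourier_def exp_fun_eq inner_fun_class measurable_expc expc_simps)

lemma fourier_exp_mult: "fourier (exp_fun m * f) n = fourier f (n - m)"
proof -
  obtain g where g: "g \<in> borel_measurable circ_measure" "f = fun_class g" by (rule fun_class_cases)
  have m: "(\<lambda>x. expc m x * g x) \<in> borel_measurable circ_measure"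
    by (intro borel_measurable_times measurable_expc g)
  have "expc m x * g x * expc (- n) x = g x * expc (- (n - m)) x" for x
    by (simp add: mult_ac expc_simps)
  then show ?thesis
    using m by (simp only: g(2) exp_fun_eq fun_class_ops measurable_expc g(1) fourier_fun_class)
qed

lemma fourier_one: "fourier 1 n = (if n = 0 then 1 else 0)"
  using fourier_fun_class[of "\<lambda>_. 1" n] by (simp add: one_circfun_def integral_expc)

text \<open>The difference has vanishing coefficients, and it is integrable because the circle has
  finite measure.\<close>

lemma fourier_inject:
  assumes f: "f \<in> L2" and g: "g \<in> L2" and eq: "\<And>n. fourier f n = fourier g n"
  shows "f = g"
proof -
  obtain k where k: "k \<in> borel_measurable circ_measure" "integrable circ_measure (\<lambda>x. (cmod (k x))\<^sup>2)" "f - g = fun_class k"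
    using L2_cases[OF diff_L2[OF f g]] .
  interpret finite_measure circ_measure by (rule finite_measure_circ)
  have "integrable circ_measure (\<lambda>x. k x * 1)" by (rule integrable_mult_sq) (use k in auto)
  moreover have "integral\<^sup>L circ_measure (\<lambda>x. k x * expc n x) = 0" for n
    using fourier_fun_class[OF k(1), of "- n"] fourier_diff[OF f g, of "- n"] eq[of "- n"] k(3) by simp
  ultimately have "AE x in circ_measure. k x = 0"
    by (intro fourier_coefficients_zero_imp_AE) auto
  then have "f - g = 0"
    unfolding k(3) zero_circfun_def by (intro fun_class_eqI k) auto
  then show ?thesis by simp
qed

section \<open>The L^2 norm and Bessel's inequality\<close>

lemma inner_fun_self:
  assumes "g \<in> borel_measurable circ_measure"
  shows "inner_fun (fun_class g) (fun_class g) = of_real (integral\<^sup>L circ_measure (\<lambda>x. (cmod (g x))\<^sup>2) / (2 * pi))"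
proof -
  have "integral\<^sup>L circ_measure (\<lambda>x. g x * cnj (g x)) = of_real (integral\<^sup>L circ_measure (\<lambda>x. (cmod (g x))\<^sup>2))"
    by (simp only: complex_norm_square[symmetric] integral_complex_of_real)
  then show ?thesis by (simp add: inner_fun_class assms)
qed

lemma L2_norm_fun_class:
  "g \<in> borel_measurable circ_measure \<Longrightarrow>
    (L2_norm (fun_class g))\<^sup>2 = integral\<^sup>L circ_measure (\<lambda>x. (cmod (g x))\<^sup>2) / (2 * pi)"
  by (simp add: L2_norm_def inner_fun_self)

lemma L2_norm_nonneg: "0 \<le> L2_norm f"
proof -
  obtain g where g: "g \<in> borel_measurable circ_measure" "f = fun_class g" by (rule fun_class_cases)
  then show ?thesis by (simp add: L2_norm_def inner_fun_self)
qed

lemma L2_norm_sq: "(L2_norm f)\<^sup>2 = Re (inner_fun f f)"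
proof -
  obtain g where g: "g \<in> borel_measurable circ_measure" "f = fun_class g" by (rule fun_class_cases)
  then show ?thesis by (simp add: L2_norm_fun_class inner_fun_self)
qed

lemma sum_L2: "(\<And>i. i \<in> K \<Longrightarrow> f i \<in> L2) \<Longrightarrow> sum f K \<in> L2"
proof (induction K rule: infinite_finite_induct)
  case empty
  show ?case using const_mult_L2[OF exp_fun_L2, of 0 0]
    by (simp add: exp_fun_zero) (simp add: const_fun_def zero_circfun_def)
next
  case (infinite K)
  show ?case using const_mult_L2[OF exp_fun_L2, of 0 0] infinite
    by (simp add: exp_fun_zero) (simp add: const_fun_def zero_circfun_def)
qed (simp add: add_L2)

lemma inner_fun_sum_left:
  "(\<And>i. i \<in> K \<Longrightarrow> f i \<in> L2) \<Longrightarrow> h \<in> L2 \<Longrightarrow> finite K \<Longrightarrow> inner_fun (sum f K) h = (\<Sum>i\<in>K. inner_fun (f i) h)"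
proof (induction K rule: infinite_finite_induct)
  case empty
  show ?case using inner_fun_const_left[of 0 0 h] by simp
qed (simp_all add: inner_fun_add_left sum_L2)

lemma bessel:
  assumes f: "f \<in> L2" shows "(\<Sum>k<n. (cmod (fourier f (int k)))\<^sup>2) \<le> (L2_norm f)\<^sup>2"
proof -
  let ?t = "\<lambda>k. const_fun (fourier f (int k)) * exp_fun (int k)"
  let ?p = "\<Sum>k<n. ?t k" and ?s = "\<Sum>k<n. (cmod (fourier f (int k)))\<^sup>2"
  have t: "?t k \<in> L2" for k by (intro const_mult_L2 exp_fun_L2)
  have p: "?p \<in> L2" by (intro sum_L2 t)
  have ip: "inner_fun ?p h = (\<Sum>k<n. fourier f (int k) * inner_fun (exp_fun (int k)) h)" if "h \<in> L2" for h
    using that by (simp add: inner_fun_sum_left t inner_fun_const_left)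
  have e: "inner_fun (exp_fun m) (exp_fun k) = (if m = k then 1 else 0)" for m k
    using fourier_exp_mult[of m 1 k] by (auto simp: fourier_def[symmetric] fourier_one)
  have pf: "inner_fun ?p f = of_real ?s"
    unfolding ip[OF f] inner_fun_commute[of "exp_fun _" f] fourier_def[symmetric] of_real_sum
    by (simp only: complex_norm_square)
  have "inner_fun ?p ?p = (\<Sum>k<n. fourier f (int k) * cnj (inner_fun ?p (exp_fun (int k))))"
    unfolding ip[OF p] by (simp add: inner_fun_commute[of "exp_fun _" ?p])
  also have "\<dots> = (\<Sum>k<n. fourier f (int k) * cnj (fourier f (int k)))"
    by (simp add: ip[OF exp_fun_L2] e if_distrib sum.delta cong: if_cong)
  also have "\<dots> = of_real ?s"
    unfolding of_real_sum by (simp only: complex_norm_square)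
  finally have pp: "inner_fun ?p ?p = of_real ?s" .
  have m: "f - ?p = f + const_fun (- 1) * ?p" by (simp add: const_fun_simps)
  have cp: "const_fun (- 1) * ?p \<in> L2" by (rule const_mult_L2[OF p])
  have right: "inner_fun h (f - ?p) = inner_fun h f - inner_fun h ?p" if h: "h \<in> L2" for h
    unfolding m inner_fun_commute[of h]
    by (simp add: inner_fun_add_left[OF f cp h] inner_fun_const_left)
  have "inner_fun (f - ?p) (f - ?p) = inner_fun f (f - ?p) - inner_fun ?p (f - ?p)"
  proof -
    have "inner_fun (f - ?p) h = inner_fun f h - inner_fun ?p h" if h: "h \<in> L2" for h
      unfolding m inner_fun_add_left[OF f cp h] inner_fun_const_left by simp
    from this[OF diff_L2[OF f p]] show ?thesis .
  qed
  also have "\<dots> = inner_fun f f - of_real ?s"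
  proof -
    have "inner_fun f ?p = of_real ?s"
      unfolding inner_fun_commute[of f ?p] pf by (rule complex_cnj_complex_of_real)
    then show ?thesis unfolding right[OF f] right[OF p] pf pp by simp
  qed
  finally have eq: "inner_fun (f - ?p) (f - ?p) = inner_fun f f - of_real ?s" .
  have "Re (inner_fun (f - ?p) (f - ?p)) = (L2_norm f)\<^sup>2 - ?s"
    unfolding eq L2_norm_sq by (simp only: minus_complex.sel Re_complex_of_real)
  then show ?thesis
    using L2_norm_sq[of "f - ?p"] zero_le_power2[of "L2_norm (f - ?p)"] by linarith
qed

subsection \<open>The Hardy space as a space of sequences\<close>

definition toE :: "circfun \<Rightarrow> ell2" where
  "toE f = Abs_ell2 (\<lambda>k. fourier f (int k))"

lemma coef_toE:
  assumes "f \<in> L2" shows "coef (toE f) k = fourier f (int k)"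
proof -
  have "summable (\<lambda>k. (cmod (fourier f (int k)))\<^sup>2)"
  proof (rule bounded_imp_summable)
    show "(\<Sum>k\<le>n. (cmod (fourier f (int k)))\<^sup>2) \<le> (L2_norm f)\<^sup>2" for n
      using bessel[OF assms, of "Suc n"] by (simp only: lessThan_Suc_atMost)
  qed simp
  then show ?thesis by (simp add: toE_def Abs_ell2_inverse)
qed

lemma norm_toE_le:
  assumes "f \<in> L2" shows "norm (toE f) \<le> L2_norm f"
proof -
  have "(norm (toE f))\<^sup>2 \<le> (L2_norm f)\<^sup>2"
    unfolding norm_ell2_sq by (rule suminf_le_const[OF summable_coef]) (simp add: coef_toE assms bessel)
  then show ?thesis by (rule power2_le_imp_le) (rule L2_norm_nonneg)
qed

lemma L2_plus_L2: "f \<in> L2_plus \<Longrightarrow> f \<in> L2"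
  by (simp add: L2_plus_def)

lemma toE_inject:
  assumes "f \<in> L2_plus" "g \<in> L2_plus" "toE f = toE g" shows "f = g"
proof (rule fourier_inject)
  show f: "f \<in> L2" and g: "g \<in> L2" using assms by (auto simp: L2_plus_def)
  fix n :: int
  show "fourier f n = fourier g n"
  proof (cases "0 \<le> n")
    case True
    then show ?thesis using coef_toE[OF f, of "nat n"] coef_toE[OF g, of "nat n"] assms(3) by simp
  next
    case False
    then show ?thesis using assms by (simp add: L2_plus_def)
  qed
qed

text \<open>The norm bound is the half of Parseval's identity that Bessel's inequality does not
  provide.\<close>

lemma toE_surj: "\<exists>f\<in>L2_plus. toE f = x \<and> L2_norm f \<le> norm x"
proof -
  obtain g where g: "g \<in> borel_measurable circ_measure" "integrable circ_measure (\<lambda>x. (cmod (g x))\<^sup>2)"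
    "integral\<^sup>L circ_measure (\<lambda>x. (cmod (g x))\<^sup>2) \<le> 2 * pi * (norm x)\<^sup>2"
    "\<And>n. integral\<^sup>L circ_measure (\<lambda>x. g x * expc (- n) x) = 2 * pi * (if 0 \<le> n then coef x (nat n) else 0)"
    using riesz_fischer[OF summable_coef[of x]] unfolding norm_ell2_sq by blast
  have L: "fun_class g \<in> L2" by (simp add: fun_class_L2_iff g)
  have c: "fourier (fun_class g) n = (if 0 \<le> n then coef x (nat n) else 0)" for n
    by (simp add: fourier_fun_class g)
  have "fun_class g \<in> L2_plus" using L by (simp add: L2_plus_def c)
  moreover have "toE (fun_class g) = x" by (rule ell2_eqI) (simp add: coef_toE[OF L] c)
  moreover have "L2_norm (fun_class g) \<le> norm x"
  proof (rule power2_le_imp_le)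
    show "(L2_norm (fun_class g))\<^sup>2 \<le> (norm x)\<^sup>2"
    proof -
      have "a / (2 * pi) \<le> b" if "a \<le> 2 * pi * b" for a b :: real using that by (simp add: field_simps)
      from this[OF g(3)] show ?thesis by (simp only: L2_norm_fun_class[OF g(1)])
    qed
  qed simp
  ultimately show ?thesis by blast
qed

definition fromE :: "ell2 \<Rightarrow> circfun" where
  "fromE x = (THE f. f \<in> L2_plus \<and> toE f = x)"

lemma fromE: "fromE x \<in> L2_plus" "toE (fromE x) = x"
proof -
  have "\<exists>!f. f \<in> L2_plus \<and> toE f = x" using toE_surj toE_inject by metis
  from theI'[OF this] show "fromE x \<in> L2_plus" "toE (fromE x) = x" by (auto simp: fromE_def)
qed

lemma fromE_toE: "f \<in> L2_plus \<Longrightarrow> fromE (toE f) = f"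
  using fromE toE_inject by metis

lemma fromE_eq_iff: "f \<in> L2_plus \<Longrightarrow> fromE x = f \<longleftrightarrow> x = toE f"
  using fromE fromE_toE by metis

lemma fourier_fromE: "fourier (fromE x) n = (if 0 \<le> n then coef x (nat n) else 0)"
proof (cases "0 \<le> n")
  case True
  then show ?thesis using coef_toE[OF L2_plus_L2[OF fromE(1)], of x "nat n"] by (simp add: fromE(2))
next
  case False
  then show ?thesis using fromE(1)[of x] by (simp add: L2_plus_def)
qed

text \<open>Parseval: by injectivity f is the preimage constructed by Riesz and Fischer, which obeys
  the inequality opposite to Bessel's.\<close>

lemma L2_norm_eq: "f \<in> L2_plus \<Longrightarrow> L2_norm f = norm (toE f)"
  using toE_surj[of "toE f"] toE_inject norm_toE_le[OF L2_plus_L2] by (metis order_antisym)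

lemma L2_plus_ops:
  assumes "f \<in> L2_plus" "g \<in> L2_plus"
  shows "f + g \<in> L2_plus" "f - g \<in> L2_plus" "const_fun c * f \<in> L2_plus"
  using assms by (simp_all add: L2_plus_def add_L2 diff_L2 const_mult_L2 fourier_add fourier_diff fourier_const)

lemma toE_add: "f \<in> L2 \<Longrightarrow> g \<in> L2 \<Longrightarrow> toE (f + g) = toE f + toE g"
  by (rule ell2_eqI) (simp add: coef_toE add_L2 fourier_add)

lemma toE_diff: "f \<in> L2 \<Longrightarrow> g \<in> L2 \<Longrightarrow> toE (f - g) = toE f - toE g"
  by (rule ell2_eqI) (simp add: coef_toE diff_L2 fourier_diff)

lemma toE_const: "f \<in> L2 \<Longrightarrow> toE (const_fun c * f) = cop c \<rhd> toE f"
  by (rule ell2_eqI) (simp add: coef_toE const_mult_L2 fourier_const coef_cop)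

lemma fromE_add: "fromE (x + y) = fromE x + fromE y"
  by (simp add: fromE_eq_iff L2_plus_ops fromE toE_add L2_plus_L2)

lemma fromE_cop: "fromE (cop c \<rhd> x) = const_fun c * fromE x"
  using L2_plus_ops(3)[OF fromE(1) fromE(1), of c x]
  by (simp add: fromE_eq_iff fromE toE_const L2_plus_L2)

text \<open>Polarization gives the real part. The product is conjugate linear in the second factor,
  so its imaginary part is the real part of the product of f with i g.\<close>

lemma inner_fun_toE:
  assumes f: "f \<in> L2_plus" and g: "g \<in> L2_plus"
  shows "inner_fun f g = Complex (inner (toE f) (toE g)) (inner (toE f) (jop \<rhd> toE g))"
proof -
  have re: "Re (inner_fun f g) = inner (toE f) (toE g)" if f: "f \<in> L2_plus" and g: "g \<in> L2_plus" for f g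
  proof -
    note L = L2_plus_L2[OF f] L2_plus_L2[OF g]
    have "inner_fun (f + g) (f + g) = inner_fun f (f + g) + inner_fun g (f + g)"
      by (intro inner_fun_add_left add_L2 L)
    also have "\<dots> = cnj (inner_fun (f + g) f) + cnj (inner_fun (f + g) g)"
      by (simp only: inner_fun_commute[of _ "f + g"])
    also have "\<dots> = inner_fun f f + cnj (inner_fun g f) + (cnj (inner_fun f g) + inner_fun g g)"
      by (simp add: inner_fun_add_left L inner_fun_commute[of f f, symmetric] inner_fun_commute[of g g, symmetric])
    finally have "Re (inner_fun (f + g) (f + g)) = Re (inner_fun f f) + 2 * Re (inner_fun f g) + Re (inner_fun g g)"
      by (simp add: inner_fun_commute[of g f])
    then have "(norm (toE f + toE g))\<^sup>2 = (norm (toE f))\<^sup>2 + 2 * Re (inner_fun f g) + (norm (toE g))\<^sup>2"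
      by (simp add: L2_norm_sq[symmetric] L2_norm_eq L2_plus_ops f g toE_add L)
    then show ?thesis
      by (simp add: power2_norm_eq_inner inner_add_left inner_add_right inner_commute)
  qed
  have "inner_fun f (const_fun \<i> * g) = - \<i> * inner_fun f g"
    unfolding inner_fun_commute[of f] by (simp add: inner_fun_const_left)
  then have "Im (inner_fun f g) = Re (inner_fun f (const_fun \<i> * g))" by simp
  also have "\<dots> = inner (toE f) (jop \<rhd> toE g)"
    by (simp add: re[OF f L2_plus_ops(3)[OF g g]] toE_const L2_plus_L2[OF g])
  finally show ?thesis by (simp add: re[OF f g] complex_eq_iff)
qed

subsection \<open>Products with absolutely convergent Fourier series\<close>

text \<open>The map d lists the frequencies: k for u and - k for its conjugate, so that both
  products are treated at once.\<close>

definition ser :: "(nat \<Rightarrow> complex) \<Rightarrow> (nat \<Rightarrow> int) \<Rightarrow> real \<Rightarrow> complex" where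
  "ser c d x = (\<Sum>k. c k * expc (d k) x)"

context
  fixes c :: "nat \<Rightarrow> complex"
  assumes c: "summable (\<lambda>k. cmod (c k))"
begin

lemma summable_ser: "summable (\<lambda>k. norm (c k * expc (d k) x))"
  using c by (simp add: norm_mult expc_simps)

lemma measurable_ser: "ser c d \<in> borel_measurable circ_measure"
proof -
  have "(\<lambda>x. \<Sum>k. c k * expc (d k) x) \<in> borel_measurable circ_measure"
    by (intro borel_measurable_suminf borel_measurable_times borel_measurable_const measurable_expc)
  then show ?thesis by (simp add: ser_def[abs_def])
qed

lemma cmod_ser_le: "cmod (ser c d x) \<le> (\<Sum>k. cmod (c k))"
  unfolding ser_def
  by (rule order_trans[OF summable_norm[OF summable_ser]]) (simp add: norm_mult expc_simps)

text \<open>The series is dominated by its absolute sum times |g|, which permits integration term by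
  term.\<close>

lemma ser_mult:
  assumes f: "f \<in> L2"
  shows "fun_class (ser c d) * f \<in> L2"
    "(\<lambda>k. c k * fourier f (n - d k)) sums fourier (fun_class (ser c d) * f) n"
proof -
  show "fun_class (ser c d) * f \<in> L2" by (rule bounded_mult_L2[OF measurable_ser cmod_ser_le f])
  obtain g where g: "g \<in> borel_measurable circ_measure" "integrable circ_measure (\<lambda>x. (cmod (g x))\<^sup>2)" "f = fun_class g"
    using L2_cases[OF f] .
  interpret finite_measure circ_measure by (rule finite_measure_circ)
  have "integrable circ_measure (\<lambda>x. g x * 1)" by (rule integrable_mult_sq) (use g in auto)
  then have gi: "integrable circ_measure g" by simp
  let ?F = "\<lambda>k x. c k * (g x * expc (- (n - d k)) x)"
  have Fi: "integrable circ_measure (?F k)" for k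
    by (intro integrable_mult_right integrable_bounded_mult[OF gi measurable_expc, of _ 1]) (simp add: expc_simps)
  have nF: "norm (?F k x) = cmod (c k) * cmod (g x)" for k x by (simp add: norm_mult expc_simps)
  have "(\<lambda>k. integral\<^sup>L circ_measure (?F k)) sums integral\<^sup>L circ_measure (\<lambda>x. \<Sum>k. ?F k x)"
  proof (rule sums_integral[OF Fi])
    show "AE x in circ_measure. summable (\<lambda>k. norm (?F k x))"
      unfolding nF by (intro AE_I2 summable_mult2 c)
    show "summable (\<lambda>k. integral\<^sup>L circ_measure (\<lambda>x. norm (?F k x)))"
      unfolding nF by (simp add: summable_mult2 c)
  qed
  moreover have "(\<Sum>k. ?F k x) = ser c d x * g x * expc (- n) x" for x
  proof -
    have "?F k x = c k * expc (d k) x * (g x * expc (- n) x)" for k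
      by (simp add: mult_ac expc_simps)
    then have "(\<Sum>k. ?F k x) = ser c d x * (g x * expc (- n) x)"
      unfolding ser_def by (simp only: suminf_mult2[OF summable_norm_cancel[OF summable_ser]])
    then show ?thesis by (simp only: mult.assoc)
  qed
  ultimately have "(\<lambda>k. c k * (integral\<^sup>L circ_measure (\<lambda>x. g x * expc (- (n - d k)) x)))
      sums integral\<^sup>L circ_measure (\<lambda>x. ser c d x * g x * expc (- n) x)" by simp
  from sums_divide[OF this, of "2 * pi"]
  have "(\<lambda>k. c k * (integral\<^sup>L circ_measure (\<lambda>x. g x * expc (- (n - d k)) x) / (2 * pi)))
      sums (integral\<^sup>L circ_measure (\<lambda>x. ser c d x * g x * expc (- n) x) / (2 * pi))" by simp
  then show "(\<lambda>k. c k * fourier f (n - d k)) sums fourier (fun_class (ser c d) * f) n"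
    using borel_measurable_times[OF measurable_ser[of d] g(1)]
    by (simp only: g(3) fourier_fun_class fun_class_ops measurable_ser g(1))
qed

end

definition hat :: "circfun \<Rightarrow> nat \<Rightarrow> complex" where
  "hat u k = fourier u (int k)"

lemma one_L2: "1 \<in> L2" using exp_fun_L2[of 0] by (simp add: exp_fun_zero)

text \<open>Multiplying the series by the constant 1 computes its Fourier coefficients, and these
  determine it.\<close>

lemma abs_conv_eq_ser:
  assumes u: "u \<in> L2_plus" and s: "summable (\<lambda>k. cmod (hat u k))"
  shows "u = fun_class (ser (hat u) int)"
proof (rule fourier_inject[OF L2_plus_L2[OF u]])
  have "fun_class (ser (hat u) int) * 1 \<in> L2" by (rule ser_mult(1)[OF s one_L2])
  then show "fun_class (ser (hat u) int) \<in> L2" by simp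
  fix n
  have "(\<lambda>k. hat u k * fourier 1 (n - int k)) sums fourier (fun_class (ser (hat u) int)) n"
    using ser_mult(2)[OF s one_L2, where d = int and n = n] by simp
  moreover have "(\<lambda>k. hat u k * fourier 1 (n - int k)) sums fourier u n"
  proof -
    have "(\<lambda>k. hat u k * fourier 1 (n - int k)) sums (\<Sum>k\<in>(if 0 \<le> n then {nat n} else {}). hat u k * fourier 1 (n - int k))"
      by (rule sums_finite) (auto simp: fourier_one)
    then show ?thesis using u by (auto simp: fourier_one hat_def L2_plus_def split: if_splits)
  qed
  ultimately show "fourier u n = fourier (fun_class (ser (hat u) int)) n" using sums_unique2 by blast
qed

lemma mult_abs_conv:
  assumes u: "u \<in> L2_plus" and s: "summable (\<lambda>k. cmod (hat u k))" and f: "f \<in> L2"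
  shows "u * f \<in> L2" "(\<lambda>k. hat u k * fourier f (n - int k)) sums fourier (u * f) n"
    "cnj_fun u * f \<in> L2" "(\<lambda>k. cnj (hat u k) * fourier f (n + int k)) sums fourier (cnj_fun u * f) n"
proof -
  note eq = abs_conv_eq_ser[OF u s]
  show "u * f \<in> L2" "(\<lambda>k. hat u k * fourier f (n - int k)) sums fourier (u * f) n"
    using ser_mult[OF s f, where d = int] by (simp_all only: eq[symmetric])
  have s': "summable (\<lambda>k. cmod (cnj (hat u k)))" using s by simp
  have cs: "cnj (ser (hat u) int x) = ser (\<lambda>k. cnj (hat u k)) (\<lambda>k. - int k) x" for x
  proof -
    have "(\<lambda>k. hat u k * expc (int k) x) sums ser (hat u) int x"
      unfolding ser_def by (rule summable_sums[OF summable_norm_cancel[OF summable_ser[OF s]]])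
    from bounded_linear.sums[OF bounded_linear_cnj this]
    have "(\<lambda>k. cnj (hat u k) * expc (- int k) x) sums cnj (ser (hat u) int x)" by (simp add: expc_simps)
    then show ?thesis unfolding ser_def by (rule sums_unique)
  qed
  have "cnj_fun (fun_class (ser (hat u) int)) = fun_class (ser (\<lambda>k. cnj (hat u k)) (\<lambda>k. - int k))"
    by (simp only: fun_class_ops(4)[OF measurable_ser[OF s]] cs)
  then have eq': "cnj_fun u = fun_class (ser (\<lambda>k. cnj (hat u k)) (\<lambda>k. - int k))"
    by (simp only: eq[symmetric])
  show "cnj_fun u * f \<in> L2" "(\<lambda>k. cnj (hat u k) * fourier f (n + int k)) sums fourier (cnj_fun u * f) n"
    using ser_mult[OF s' f, where d = "\<lambda>k. - int k"] by (simp_all add: eq')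
qed

section \<open>The operators of the statement, on sequences\<close>

lemma szego_eq:
  assumes "f \<in> L2" shows "szego f = fromE (toE f)"
  unfolding szego_def
proof (rule the_equality)
  show "fromE (toE f) \<in> L2 \<and> (\<forall>n. fourier (fromE (toE f)) n = (if 0 \<le> n then fourier f n else 0))"
    by (simp add: L2_plus_L2 fromE fourier_fromE coef_toE assms)
  fix g assume g: "g \<in> L2 \<and> (\<forall>n. fourier g n = (if 0 \<le> n then fourier f n else 0))"
  then show "g = fromE (toE f)"
    by (intro fourier_inject) (auto simp: L2_plus_L2 fromE fourier_fromE coef_toE assms)
qed

lemma toeplitz_eq:
  assumes u: "u \<in> L2_plus" and s: "summable (\<lambda>k. cmod (hat u k))" and f: "f \<in> L2_plus"
  shows "toeplitz u f = fromE (toep (hat u) \<rhd> toE f)"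
    "toeplitz (cnj_fun u) f = fromE (toep_adj (hat u) \<rhd> toE f)"
proof -
  note m = mult_abs_conv[OF u s L2_plus_L2[OF f]]
  have "toE (u * f) = toep (hat u) \<rhd> toE f"
  proof (rule ell2_eqI)
    fix n
    have "(\<lambda>k. hat u k * fourier f (int n - int k)) sums (\<Sum>k\<le>n. hat u k * fourier f (int n - int k))"
      by (rule sums_finite) (use f in \<open>auto simp: L2_plus_def\<close>)
    from sums_unique2[OF m(2) this]
    show "coef (toE (u * f)) n = coef (toep (hat u) \<rhd> toE f) n"
      by (simp add: coef_toE m(1) coef_toep[OF s] L2_plus_L2[OF f] of_nat_diff)
  qed
  then show "toeplitz u f = fromE (toep (hat u) \<rhd> toE f)"
    by (simp add: toeplitz_def szego_eq m)
  have "toE (cnj_fun u * f) = toep_adj (hat u) \<rhd> toE f"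
  proof (rule ell2_eqI)
    fix n
    show "coef (toE (cnj_fun u * f)) n = coef (toep_adj (hat u) \<rhd> toE f) n"
      using sums_unique2[OF m(4)[of "int n"]] coef_toep_adj[OF s, of "toE f" n]
      by (simp add: coef_toE m(3) L2_plus_L2[OF f])
  qed
  then show "toeplitz (cnj_fun u) f = fromE (toep_adj (hat u) \<rhd> toE f)"
    by (simp add: toeplitz_def szego_eq m)
qed

lemma S_star_eq:
  assumes "f \<in> L2_plus" shows "S_star f = fromE (bshift \<rhd> toE f)"
proof -
  have L: "exp_fun (- 1) * f \<in> L2" by (intro exp_mult_L2 L2_plus_L2 assms)
  have "toE (exp_fun (- 1) * f) = bshift \<rhd> toE f"
    by (rule ell2_eqI) (simp add: coef_toE[OF L] coef_bshift coef_toE L2_plus_L2 assms fourier_exp_mult add.commute)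
  then show ?thesis by (simp add: S_star_def szego_eq[OF L])
qed

lemma D_op_eq:
  assumes f: "f \<in> L2_plus" and d: "toE f \<in> dom1"
  shows "D_op f = fromE (dfull (toE f))"
  unfolding D_op_def
proof (rule the_equality)
  have c: "fourier (fromE (dfull (toE f))) n = of_int n * fourier f n" for n
  proof (cases "0 \<le> n")
    case True
    then show ?thesis by (simp add: fourier_fromE coef_dfull[OF d] coef_toE[OF L2_plus_L2[OF f]])
  next
    case False
    then show ?thesis using f by (simp add: fourier_fromE L2_plus_def)
  qed
  then show "fromE (dfull (toE f)) \<in> L2 \<and> (\<forall>n. fourier (fromE (dfull (toE f))) n = of_int n * fourier f n)"
    by (simp add: L2_plus_L2 fromE)
  fix g assume "g \<in> L2 \<and> (\<forall>n. fourier g n = of_int n * fourier f n)"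
  then show "g = fromE (dfull (toE f))"
    by (intro fourier_inject) (simp_all add: c L2_plus_L2 fromE)
qed

lemma weighted_sum_L2_plus:
  fixes w :: "int \<Rightarrow> real"
  assumes f: "f \<in> L2_plus" and w: "\<And>n. 0 \<le> w n"
  shows "(\<lambda>n. w n * (cmod (fourier f n))\<^sup>2) summable_on UNIV \<longleftrightarrow> summable (\<lambda>k. w (int k) * (cmod (hat f k))\<^sup>2)"
    "(\<lambda>n. w n * (cmod (fourier f n))\<^sup>2) summable_on UNIV \<Longrightarrow>
      (\<Sum>\<^sub>\<infinity>n. w n * (cmod (fourier f n))\<^sup>2) = (\<Sum>k. w (int k) * (cmod (hat f k))\<^sup>2)"
proof -
  let ?F = "\<lambda>n. w n * (cmod (fourier f n))\<^sup>2"
  have zero: "?F n = 0" if "n \<notin> range int" for n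
  proof -
    have "\<not> 0 \<le> n"
    proof
      assume "0 \<le> n"
      then have "n = int (nat n)" by simp
      then show False using that by blast
    qed
    then show ?thesis using f by (simp add: L2_plus_def)
  qed
  have 1: "?F summable_on UNIV \<longleftrightarrow> ?F summable_on range int"
    by (rule summable_on_cong_neutral) (use zero in auto)
  have i1: "infsum ?F UNIV = infsum ?F (range int)"
    by (rule infsum_cong_neutral) (use zero in auto)
  have 2: "?F summable_on range int \<longleftrightarrow> (?F \<circ> int) summable_on UNIV"
    by (rule summable_on_reindex) simp
  have i2: "infsum ?F (range int) = infsum (?F \<circ> int) UNIV"
    by (rule infsum_reindex) simp
  have c: "?F \<circ> int = (\<lambda>k. w (int k) * (cmod (hat f k))\<^sup>2)" by (simp add: fun_eq_iff hat_def)
  show "?F summable_on UNIV \<longleftrightarrow> summable (\<lambda>k. w (int k) * (cmod (hat f k))\<^sup>2)"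
    unfolding 1 2 c by (rule summable_on_UNIV_nonneg_real_iff) (simp add: w)
  assume "?F summable_on UNIV"
  then have "(\<lambda>k. w (int k) * (cmod (hat f k))\<^sup>2) summable_on UNIV" unfolding 1 2 c .
  then have "(\<lambda>k. w (int k) * (cmod (hat f k))\<^sup>2) sums infsum (\<lambda>k. w (int k) * (cmod (hat f k))\<^sup>2) UNIV"
    by (intro has_sum_imp_sums has_sum_infsum)
  then show "infsum ?F UNIV = (\<Sum>k. w (int k) * (cmod (hat f k))\<^sup>2)"
    unfolding i1 i2 c by (rule sums_unique)
qed

lemma Hs_plus_1_iff: "f \<in> Hs_plus 1 \<longleftrightarrow> f \<in> L2_plus \<and> toE f \<in> dom1"
proof (cases "f \<in> L2_plus")
  case True
  have "f \<in> Hs_plus 1 \<longleftrightarrow> summable (\<lambda>k. (1 + (real k)\<^sup>2) * (cmod (hat f k))\<^sup>2)"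
    using weighted_sum_L2_plus(1)[OF True, of "\<lambda>n. (1 + (real_of_int n)\<^sup>2) powr 1"] True
    by (simp add: Hs_plus_def Hs_def L2_plus_L2 add_nonneg_nonneg)
  also have "\<dots> \<longleftrightarrow> summable (\<lambda>k. (cmod (of_nat k * coef (toE f) k))\<^sup>2)"
  proof -
    have s: "summable (\<lambda>k. (cmod (hat f k))\<^sup>2)"
      using summable_coef[of "toE f"] by (simp add: coef_toE L2_plus_L2 True hat_def)
    have e: "(cmod (of_nat k * coef (toE f) k))\<^sup>2 = (1 + (real k)\<^sup>2) * (cmod (hat f k))\<^sup>2 - (cmod (hat f k))\<^sup>2" for k
      by (simp add: coef_toE L2_plus_L2 True hat_def norm_mult power_mult_distrib algebra_simps)
    show ?thesis
      unfolding e using summable_diff[OF _ s] summable_add[OF _ s] by fastforce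
  qed
  finally show ?thesis using True by (simp add: dom1_def)
qed (simp add: Hs_plus_def)

lemma Lax_op_eq:
  assumes u: "u \<in> L2_plus" and s: "summable (\<lambda>k. cmod (hat u k))" and f: "f \<in> Hs_plus 1"
  shows "Lax_op u f = fromE (laxfull (hat u) (toE f))"
proof -
  have f': "f \<in> L2_plus" "toE f \<in> dom1" using f by (auto simp: Hs_plus_1_iff)
  have "Lax_op u f = fromE (dfull (toE f)) - fromE (toep (hat u) \<rhd> toep_adj (hat u) \<rhd> toE f)"
    by (simp add: Lax_op_def D_op_eq f' toeplitz_eq[OF u s] fromE)
  moreover have "fromE x - fromE y = fromE (x - y)" for x y
    using fromE_add[of "x - y" y] by simp
  ultimately show ?thesis by (simp add: laxfull_def)
qed

section \<open>The unitary group on the Hardy space\<close>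

lemma L2_norm_quotient:
  assumes a: "a \<in> L2_plus" and f: "f \<in> L2_plus" and g: "g \<in> L2_plus"
  shows "L2_norm (const_fun (1 / complex_of_real h) * (a - f) - const_fun \<i> * g)
    = norm ((1 / h) *\<^sub>R (toE a - toE f) - jop \<rhd> toE g)"
proof -
  have "cop (1 / complex_of_real h) \<rhd> x = (1 / h) *\<^sub>R x" for x
    using cop_of_real[of "1 / h"] by (simp add: app.scaleR_left)
  moreover note L2_plus_ops[OF a f] L2_plus_ops(3)[OF g g]
  ultimately show ?thesis
    using a f g
    by (simp add: L2_norm_eq L2_plus_ops toE_diff toE_const L2_plus_L2 const_mult_L2 diff_L2)
qed

text \<open>The operator e^{-it} e^{-2it L} S* built from u; for the initial datum this is the
  uncompressed K(0).\<close>

definition kfull :: "circfun \<Rightarrow> real \<Rightarrow> ell2 \<Rightarrow> ell2" where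
  "kfull u t x = cop (exp (- \<i> * of_real t)) \<rhd> lim_group (hat u) (- 2 * t) (bshift \<rhd> x)"

context
  fixes u :: circfun and M :: real
  assumes u: "u \<in> L2_plus" and bnd: "wbound M (hat u)"
begin

text \<open>Transport of \<open>lax_group_lim_group\<close> along the isometry \<open>toE\<close>,
  under which H^1 corresponds to \<open>dom1\<close> exactly.\<close>

lemma unitary_group_lim_group:
  "unitary_group_generated_by (Lax_op u) (Hs_plus 1) (\<lambda>t f. fromE (lim_group (hat u) t (toE f)))"
proof -
  let ?V = "lim_group (hat u)"
  let ?U = "\<lambda>t f. fromE (?V t (toE f))"
  note s = wbound_summable(1)[OF bnd]
  have inv: "?V (- t) (?V t x) = x" "?V t (?V (- t) x) = x" for t x
    using lim_group_plus[OF bnd, of "- t" t x] lim_group_plus[OF bnd, of t "- t" x]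
    by (simp_all add: lim_group_zero[OF bnd])
  have bij: "bij_betw (?U t) L2_plus L2_plus" for t
    by (rule bij_betw_byWitness[where f' = "?U (- t)"]) (auto simp: fromE inv fromE_toE)
  have inn: "inner_fun (?U t f) (?U t g) = inner_fun f g" if fg: "f \<in> L2_plus" "g \<in> L2_plus" for t f g
    by (simp add: inner_fun_toE fromE fg inner_lim_group[OF bnd] lim_group_cop[OF bnd, symmetric] inv)
  have cont: "((\<lambda>r. L2_norm (?U r f - ?U t f)) \<longlongrightarrow> 0) (at t)" for t f
  proof -
    have "L2_norm (?U r f - ?U t f) = norm (?V r (toE f) - ?V t (toE f))" for r
      by (simp add: L2_norm_eq L2_plus_ops fromE toE_diff L2_plus_L2)
    then show ?thesis
      using tendsto_norm_zero[OF LIM_zero[OF lim_group_continuous[OF bnd, of "toE f" t]]] by simp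
  qed
  have gen: "(f \<in> Hs_plus 1 \<and> Lax_op u f = g) \<longleftrightarrow>
      ((\<lambda>h. L2_norm (const_fun (1 / complex_of_real h) * (?U h f - f) - const_fun \<i> * g)) \<longlongrightarrow> 0) (at 0)"
    if f: "f \<in> L2_plus" and g: "g \<in> L2_plus" for f g
  proof -
    have "(f \<in> Hs_plus 1 \<and> Lax_op u f = g) \<longleftrightarrow> (toE f \<in> dom1 \<and> laxfull (hat u) (toE f) = toE g)"
      using Lax_op_eq[OF u s, of f] f g by (auto simp: Hs_plus_1_iff fromE_eq_iff fromE(2))
    also have "\<dots> \<longleftrightarrow> ((\<lambda>h. (1 / h) *\<^sub>R (?V h (toE f) - toE f)) \<longlongrightarrow> jop \<rhd> toE g) (at 0)"
      using lax_group_lim_group[OF bnd] unfolding lax_group_def by blast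
    also have "\<dots> \<longleftrightarrow> ((\<lambda>h. (1 / h) *\<^sub>R (?V h (toE f) - toE f) - jop \<rhd> toE g) \<longlongrightarrow> 0) (at 0)"
      by (rule LIM_zero_iff[symmetric])
    also have "\<dots> \<longleftrightarrow> ((\<lambda>h. norm ((1 / h) *\<^sub>R (?V h (toE f) - toE f) - jop \<rhd> toE g)) \<longlongrightarrow> 0) (at 0)"
      by (rule tendsto_norm_zero_iff[symmetric])
    also have "(\<lambda>h. norm ((1 / h) *\<^sub>R (?V h (toE f) - toE f) - jop \<rhd> toE g))
        = (\<lambda>h. L2_norm (const_fun (1 / complex_of_real h) * (?U h f - f) - const_fun \<i> * g))"
      by (simp only: L2_norm_quotient[OF fromE(1) f g] fromE(2))
    finally show ?thesis .
  qed
  show ?thesis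
    unfolding unitary_group_generated_by_def
    using bij inn cont gen
    by (simp add: toE_add toE_const L2_plus_L2 lim_group_add[OF bnd] lim_group_cop[OF bnd] fromE_add fromE_cop
        lim_group_zero[OF bnd] fromE_toE lim_group_plus[OF bnd] fromE)
qed

text \<open>Any such U, read on sequences, is a \<open>lax_group\<close>, to which
  \<open>lax_group_unique\<close> applies.\<close>

lemma unitary_group_unique:
  assumes U: "unitary_group_generated_by (Lax_op u) (Hs_plus 1) U" and f: "f \<in> L2_plus"
  shows "U t f = fromE (lim_group (hat u) t (toE f))"
proof -
  note s = wbound_summable(1)[OF bnd]
  define W where "W t x = toE (U t (fromE x))" for t x
  have mem: "U t f \<in> L2_plus" if "f \<in> L2_plus" for t f
    using U that unfolding unitary_group_generated_by_def by (meson bij_betwE)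
  have add: "U t (f + g) = U t f + U t g" and cn: "U t (const_fun c * f) = const_fun c * U t f"
    and inn: "inner_fun (U t f) (U t g) = inner_fun f g" and zero: "U 0 f = f"
    and plus: "U (t + r) f = U t (U r f)"
    and gen: "(f \<in> Hs_plus 1 \<and> Lax_op u f = g) \<longleftrightarrow>
        ((\<lambda>h. L2_norm (const_fun (1 / complex_of_real h) * (U h f - f) - const_fun \<i> * g)) \<longlongrightarrow> 0) (at 0)"
    if "f \<in> L2_plus" "g \<in> L2_plus" for f g t r c
    using U that unfolding unitary_group_generated_by_def by blast+
  have "lax_group (hat u) W"
    unfolding lax_group_def
  proof (intro conjI allI)
    show "W t (x + y) = W t x + W t y" for t x y
      by (simp add: W_def fromE_add add fromE toE_add mem L2_plus_L2)
    show "W t (cop c \<rhd> x) = cop c \<rhd> W t x" for t c x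
      using cn[OF fromE(1) fromE(1)] by (simp add: W_def fromE_cop fromE toE_const mem L2_plus_L2)
    show "norm (W t x) = norm x" for t x
    proof -
      have "L2_norm (U t (fromE x)) = L2_norm (fromE x)"
        by (simp add: L2_norm_def inn fromE)
      then show ?thesis by (simp add: W_def L2_norm_eq mem fromE)
    qed
    show "W 0 x = x" for x using zero[OF fromE(1) fromE(1)] by (simp add: W_def fromE)
    show "W (s + t) x = W s (W t x)" for s t x
      using plus[OF fromE(1) fromE(1)] by (simp add: W_def fromE_toE mem fromE)
    show "(x \<in> dom1 \<and> laxfull (hat u) x = g) \<longleftrightarrow> ((\<lambda>h. (1 / h) *\<^sub>R (W h x - x)) \<longlongrightarrow> jop \<rhd> g) (at 0)" for x g
    proof -
      have "(x \<in> dom1 \<and> laxfull (hat u) x = g) \<longleftrightarrow> (fromE x \<in> Hs_plus 1 \<and> Lax_op u (fromE x) = fromE g)"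
        using Lax_op_eq[OF u s, of "fromE x"] by (auto simp: Hs_plus_1_iff fromE fromE_eq_iff)
      also have "\<dots> \<longleftrightarrow> ((\<lambda>h. L2_norm (const_fun (1 / complex_of_real h) * (U h (fromE x) - fromE x) - const_fun \<i> * fromE g)) \<longlongrightarrow> 0) (at 0)"
        by (rule gen[OF fromE(1) fromE(1)])
      also have "\<dots> \<longleftrightarrow> ((\<lambda>h. norm ((1 / h) *\<^sub>R (W h x - x) - jop \<rhd> g)) \<longlongrightarrow> 0) (at 0)"
        unfolding L2_norm_quotient[OF mem[OF fromE(1)] fromE(1) fromE(1)] by (simp only: fromE(2) W_def)
      finally show ?thesis by (simp only: tendsto_norm_zero_iff LIM_zero_iff)
    qed
  qed
  from lax_group_unique[OF bnd this, of t "toE f"]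
  have "toE (U t f) = lim_group (hat u) t (toE f)" by (simp add: W_def fromE_toE f)
  then show ?thesis using fromE_toE[OF mem[OF f]] by metis
qed

text \<open>Existence and uniqueness of the group make the description in \<open>exp_i_op\<close>
  definite.\<close>

lemma exp_i_op_eq:
  assumes f: "f \<in> L2_plus"
  shows "exp_i_op t (Lax_op u) (Hs_plus 1) f = fromE (lim_group (hat u) t (toE f))"
  unfolding exp_i_op_def
proof (rule the_equality)
  show "\<exists>U. unitary_group_generated_by (Lax_op u) (Hs_plus 1) U \<and> fromE (lim_group (hat u) t (toE f)) = U t f"
    using unitary_group_lim_group by blast
  show "g = fromE (lim_group (hat u) t (toE f))"
    if "\<exists>U. unitary_group_generated_by (Lax_op u) (Hs_plus 1) U \<and> g = U t f" for g
    using that unitary_group_unique[OF _ f] by blast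
qed

lemma norm_kfull: "norm (kfull u t x) \<le> norm x"
  using norm_app_le[OF norm_bshift, of x]
  by (simp add: kfull_def norm_cop_app norm_exp_eq_Re norm_lim_group[OF bnd])

lemma bounded_linear_kfull: "bounded_linear (kfull u t)"
proof (rule bounded_linear_intro[of _ 1])
  show "kfull u t (x + y) = kfull u t x + kfull u t y" for x y
    by (simp add: kfull_def app.add_right lim_group_add[OF bnd])
  show "kfull u t (r *\<^sub>R x) = r *\<^sub>R kfull u t x" for r x
    by (simp add: kfull_def app.scaleR_right lim_group_scaleR[OF bnd])
qed (simp add: norm_kfull)

text \<open>K is a contraction and |z| < 1, so the Neumann series of the z^n K^n u converges and
  solves the equation; pairing with 1 takes the coefficient 0 term by term.\<close>

lemma resolvent_series:
  assumes z: "cmod z < 1"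
  shows "inner_fun (op_inverse (\<lambda>h. h - const_fun (z * exp (- \<i> * complex_of_real t))
      * exp_i_op (- 2 * t) (Lax_op u) (Hs_plus 1) (S_star h)) u) 1
    = (\<Sum>n. coef ((kfull u t ^^ n) (toE u)) 0 * z ^ n)"
proof -
  let ?K = "kfull u t"
  let ?T = "\<lambda>h. h - const_fun (z * exp (- \<i> * complex_of_real t))
      * exp_i_op (- 2 * t) (Lax_op u) (Hs_plus 1) (S_star h)"
  interpret K: bounded_linear ?K by (rule bounded_linear_kfull)
  have T: "?T h = fromE (toE h - cop z \<rhd> ?K (toE h))" if h: "h \<in> L2_plus" for h
  proof -
    let ?g = "fromE (lim_group (hat u) (- 2 * t) (bshift \<rhd> toE h))"
    have e: "exp_i_op (- 2 * t) (Lax_op u) (Hs_plus 1) (S_star h) = ?g"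
      using exp_i_op_eq[OF fromE(1), of "- 2 * t" "bshift \<rhd> toE h"]
      by (simp only: S_star_eq[OF h] fromE(2))
    have "toE (h - const_fun (z * exp (- \<i> * complex_of_real t)) * ?g) = toE h - cop z \<rhd> ?K (toE h)"
      by (simp add: toE_diff toE_const const_mult_L2 L2_plus_L2 h fromE cop_mult kfull_def)
    moreover have "h - const_fun (z * exp (- \<i> * complex_of_real t)) * ?g \<in> L2_plus"
      by (intro L2_plus_ops(2) h L2_plus_ops(3)[OF fromE(1) fromE(1)])
    ultimately show ?thesis unfolding e using fromE_toE by metis
  qed
  \<comment> \<open>\<open>op_inverse\<close> picks some preimage in the Hardy space; injectivity
    identifies it with the sum of the series. The difference y of two solutions satisfies |y| <= |z|
    |y|.\<close>
  have inj: "inj_on ?T L2_plus"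
  proof (rule inj_onI)
    fix g h assume gh: "g \<in> L2_plus" "h \<in> L2_plus" "?T g = ?T h"
    then have "toE (fromE (toE g - cop z \<rhd> ?K (toE g))) = toE (fromE (toE h - cop z \<rhd> ?K (toE h)))"
      by (simp only: T)
    then have "toE g - toE h = cop z \<rhd> ?K (toE g - toE h)"
      unfolding fromE(2) by (simp add: K.diff app.diff_right algebra_simps)
    then have "norm (toE g - toE h) = cmod z * norm (?K (toE g - toE h))"
      using norm_cop_app by metis
    also have "\<dots> \<le> cmod z * norm (toE g - toE h)" by (intro mult_left_mono norm_kfull) simp
    finally have "(1 - cmod z) * norm (toE g - toE h) \<le> 0" by (simp add: algebra_simps)
    then have "norm (toE g - toE h) \<le> 0" using z by (simp add: mult_le_0_iff)
    then show "g = h" using toE_inject gh by simp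
  qed
  let ?s = "\<lambda>n. cop (z ^ n) \<rhd> (?K ^^ n) (toE u)"
  have Kn: "norm ((?K ^^ n) x) \<le> norm x" for n x
    by (induction n) (auto intro: order_trans[OF norm_kfull])
  have sn: "norm (?s n) \<le> cmod z ^ n * norm (toE u)" for n
    by (simp add: norm_cop_app norm_power mult_left_mono Kn)
  have summ: "summable ?s"
    by (rule summable_comparison_test'[OF _ sn]) (use z in \<open>intro summable_mult2 summable_geometric, simp\<close>)
  define x where "x = (\<Sum>n. ?s n)"
  have xs: "?s sums x" unfolding x_def by (rule summable_sums[OF summ])
  have "(\<lambda>n. cop z \<rhd> ?K (?s n)) sums (cop z \<rhd> ?K x)"
    by (intro bounded_linear.sums[OF app.bounded_linear_right] bounded_linear.sums[OF bounded_linear_kfull] xs)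
  \<comment> \<open>Complex linearity of K, inherited from the shift and from the group, lets the
    powers of z be collected.\<close>
  moreover have "cop z \<rhd> ?K (?s n) = ?s (Suc n)" for n
  proof -
    have "?K (cop c \<rhd> y) = cop c \<rhd> ?K y" for c y
    proof -
      have "bshift \<rhd> cop c \<rhd> y = cop c \<rhd> bshift \<rhd> y" by (metis app_mult cop_commute_bshift)
      then show ?thesis
        unfolding kfull_def by (simp add: lim_group_cop[OF bnd]) (metis app_mult cop_mult mult.commute)
    qed
    then show ?thesis by (simp add: cop_mult)
  qed
  ultimately have "(\<lambda>n. ?s (Suc n)) sums (cop z \<rhd> ?K x)" by simp
  moreover have "(\<lambda>n. ?s (Suc n)) sums (x - ?s 0)" using xs by (subst sums_Suc_iff) simp
  ultimately have "cop z \<rhd> ?K x = x - toE u" using sums_unique2 by (fastforce simp: cop_one)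
  then have "fromE (toE (fromE x) - cop z \<rhd> ?K (toE (fromE x))) = u"
    by (simp add: fromE(2) fromE_toE u)
  then have "?T (fromE x) = u" unfolding T[OF fromE(1)] .
  then have "op_inverse ?T u = fromE x"
    unfolding op_inverse_def using inv_into_f_f[OF inj fromE(1), of x] by simp
  then have "inner_fun (op_inverse ?T u) 1 = fourier (fromE x) 0"
    by (simp add: fourier_def exp_fun_zero)
  also have "\<dots> = coef x 0" by (simp add: fourier_fromE)
  also have "\<dots> = (\<Sum>n. coef ((?K ^^ n) (toE u)) 0 * z ^ n)"
    using sums_unique[OF bounded_linear.sums[OF bounded_linear_coef xs, of 0]]
    by (simp add: coef_cop mult.commute)
  finally show ?thesis .
qed

end

section \<open>Solutions of the equation in Fourier variables\<close>

lemma vec_deriv_expc: "(vec_deriv ^^ k) (expc n) = (\<lambda>x. (\<i> * of_int n) ^ k * expc n x)"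
  and expc_differentiable: "((vec_deriv ^^ k) (expc n)) differentiable (at x)"
proof -
  have d: "((\<lambda>x. c * expc n x) has_vector_derivative \<i> * of_int n * (c * expc n x)) (at x)" for c x
  proof -
    have "((\<lambda>z. c * exp (\<i> * of_int n * z)) has_field_derivative \<i> * of_int n * (c * exp (\<i> * of_int n * of_real x))) (at (of_real x))"
      by (auto intro!: derivative_eq_intros)
    from has_vector_derivative_real_field[OF this, of UNIV] show ?thesis by (simp add: expc_def)
  qed
  show *: "(vec_deriv ^^ k) (expc n) = (\<lambda>x. (\<i> * of_int n) ^ k * expc n x)" for k
  proof (induction k)
    case (Suc k)
    have "vec_deriv (\<lambda>x. (\<i> * of_int n) ^ k * expc n x) = (\<lambda>x. \<i> * of_int n * ((\<i> * of_int n) ^ k * expc n x))"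
      unfolding vec_deriv_def by (rule ext) (rule vector_derivative_at[OF d])
    then show ?case by (simp add: Suc mult.assoc)
  qed simp
  show "((vec_deriv ^^ k) (expc n)) differentiable (at x)"
    unfolding * using d by (rule differentiableI_vector)
qed

text \<open>Testing with exponentials turns the distributional equation into one equation for each
  Fourier coefficient.\<close>

lemma test_function_expc: "test_function (expc n)"
proof -
  have "expc n (x + 2 * pi) = expc n x" for x
  proof -
    have "expc n (x + 2 * pi) = expc n x * expc n (2 * pi)"
      by (simp add: expc_def distrib_left exp_add)
    then show ?thesis by (simp add: expc_2pi)
  qed
  then show ?thesis unfolding test_function_def using expc_differentiable by blast
qed

text \<open>The weighted bound passes to the correlation by \<open>sum_cmod_autocorr_le\<close>, so
  the projection of |u|^2 lies in H^1, where \<open>D_op\<close> is definite. The product with u is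
  then a finite convolution, as both factors are analytic.\<close>

lemma fourier_nonlinearity:
  assumes u: "u \<in> L2_plus" and bnd: "wbound M (hat u)"
  shows "fourier (2 * D_plus (u * cnj_fun u) * u) (int n)
    = 2 * (\<Sum>j\<le>n. hat u j * (of_nat (n - j) * autocorr (hat u) (n - j)))"
proof -
  note s = wbound_summable(1)[OF bnd]
  note m = mult_abs_conv[OF u s L2_plus_L2[OF u]]
  let ?b = "toE (cnj_fun u * u)"
  have cb: "coef ?b k = autocorr (hat u) k" for k
  proof -
    have "(\<lambda>j. cnj (hat u j) * hat u (j + k)) sums fourier (cnj_fun u * u) (int k)"
      using m(4)[of "int k"] by (simp add: hat_def add.commute)
    then show ?thesis unfolding autocorr_def coef_toE[OF m(3)] by (rule sums_unique)
  qed
  have wk: "summable (\<lambda>k. real k * cmod (hat u k))"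
    using wbound_summable(2)[OF bnd] by (simp add: norm_mult)
  have sb: "summable (\<lambda>k. cmod (of_nat k * coef ?b k))"
    unfolding cb using sum_cmod_autocorr_le(1)[OF s wk] by (simp add: norm_mult)
  have d: "?b \<in> dom1"
  proof -
    have "summable (\<lambda>k. (cmod (of_nat k * coef ?b k))\<^sup>2)"
    proof (rule summable_comparison_test')
      let ?C = "\<Sum>k. cmod (of_nat k * coef ?b k)"
      show "summable (\<lambda>k. ?C * cmod (of_nat k * coef ?b k))" by (rule summable_mult[OF sb])
      fix k
      have "cmod (of_nat k * coef ?b k) \<le> ?C"
        using sum_le_suminf[OF sb, of "{k}"] by simp
      then show "norm ((cmod (of_nat k * coef ?b k))\<^sup>2) \<le> ?C * cmod (of_nat k * coef ?b k)"
        by (simp only: power2_eq_square real_norm_def abs_mult abs_norm_cancel) (rule mult_right_mono, auto)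
    qed
    then show ?thesis by (simp add: dom1_def)
  qed
  have D: "D_plus (u * cnj_fun u) = fromE (dfull ?b)"
    unfolding D_plus_def mult.commute[of u] szego_eq[OF m(3)]
    using D_op_eq[OF fromE(1)[of ?b]] d by (simp add: fromE)
  let ?F = "fromE (dfull ?b)"
  have F: "?F \<in> L2" by (rule L2_plus_L2[OF fromE(1)])
  have "(\<lambda>k. hat u k * fourier ?F (int n - int k)) sums (\<Sum>k\<le>n. hat u k * fourier ?F (int n - int k))"
    by (rule sums_finite) (auto simp: fourier_fromE)
  from sums_unique2[OF mult_abs_conv(2)[OF u s F, of "int n"] this]
  have "fourier (u * ?F) (int n) = (\<Sum>k\<le>n. hat u k * (of_nat (n - k) * autocorr (hat u) (n - k)))"
    by (simp add: fourier_fromE coef_dfull[OF d] cb of_nat_diff[symmetric] del: of_nat_diff)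
  moreover have two: "2 * ?F * u = u * ?F + u * ?F" by (simp add: algebra_simps)
  moreover have "u * ?F \<in> L2" by (rule mult_abs_conv(1)[OF u s F])
  ultimately show ?thesis unfolding D two by (simp only: fourier_add mult_2)
qed

text \<open>Cauchy-Schwarz with 1 + k = p_k (1 + k^2)^(s/2). The squares of p_k behave like k^(2 - 2
  s), summable exactly for s > 3/2.\<close>

lemma Hs_plus_weighted_bound:
  assumes s: "s > 3 / 2"
  shows "\<exists>C\<ge>0. \<forall>f\<in>Hs_plus s. summable (\<lambda>k. (1 + real k) * cmod (hat f k)) \<and>
    (\<Sum>k. (1 + real k) * cmod (hat f k)) \<le> C * Hs_norm s f"
proof -
  have powr_half: "(x powr (r / 2))\<^sup>2 = x powr r" for x r :: real
    by (simp add: power2_eq_square powr_add[symmetric])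
  define p where "p k = (1 + real k) * (1 + (real k)\<^sup>2) powr (- s / 2)" for k
  have "summable (\<lambda>k. (p k)\<^sup>2)"
  proof (rule summable_comparison_test_ev)
    show "summable (\<lambda>k. 4 * real k powr (2 - 2 * s))"
      using s by (intro summable_mult) (simp add: summable_real_powr_iff)
    show "\<forall>\<^sub>F k in sequentially. norm ((p k)\<^sup>2) \<le> 4 * real k powr (2 - 2 * s)"
      using eventually_gt_at_top[of 0]
    proof eventually_elim
      case (elim k)
      have k: "1 \<le> real k" using elim by simp
      have "(p k)\<^sup>2 = (1 + real k)\<^sup>2 * (1 + (real k)\<^sup>2) powr (- s)"
        by (simp only: p_def power_mult_distrib powr_half)
      also have "\<dots> \<le> (2 * real k)\<^sup>2 * ((real k)\<^sup>2) powr (- s)"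
        using k s by (intro mult_mono power_mono powr_mono2') auto
      also have "\<dots> = 4 * real k powr (2 - 2 * s)"
        using k by (simp add: power_mult_distrib powr_powr powr_diff powr_minus field_simps flip: powr_numeral)
      finally show ?case by simp
    qed
  qed
  note sp = this
  \<comment> \<open>Both factors are made elements of \<open>ell2\<close>, so that its
    Cauchy-Schwarz inequality applies.\<close>
  define P where "P = Abs_ell2 (\<lambda>k. of_real (p k))"
  have cP: "coef P k = of_real (p k)" for k
    unfolding P_def using sp by (subst Abs_ell2_inverse) auto
  show ?thesis
  proof (intro exI[of _ "norm P"] conjI ballI)
    fix f assume f: "f \<in> Hs_plus s"
    then have fL: "f \<in> L2_plus" and fs: "(\<lambda>n::int. (1 + (real_of_int n)\<^sup>2) powr s * (cmod (fourier f n))\<^sup>2) summable_on UNIV"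
      by (auto simp: Hs_plus_def Hs_def)
    let ?w = "\<lambda>n::int. (1 + (real_of_int n)\<^sup>2) powr s"
    have w0: "0 \<le> ?w n" for n by simp
    note W = weighted_sum_L2_plus[where w = ?w, OF fL w0]
    have sq: "summable (\<lambda>k. ?w (int k) * (cmod (hat f k))\<^sup>2)" using W(1) fs by blast
    define q where "q k = (1 + (real k)\<^sup>2) powr (s / 2) * cmod (hat f k)" for k
    have q2: "(q k)\<^sup>2 = ?w (int k) * (cmod (hat f k))\<^sup>2" for k
      by (simp add: q_def power_mult_distrib powr_half)
    have sq': "summable (\<lambda>k. (q k)\<^sup>2)" unfolding q2 by (rule sq)
    define Q where "Q = Abs_ell2 (\<lambda>k. of_real (q k))"
    have cQ: "coef Q k = of_real (q k)" for k
      unfolding Q_def using sq' by (subst Abs_ell2_inverse) auto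
    have nQ: "norm Q = Hs_norm s f"
    proof -
      have "(norm Q)\<^sup>2 = (\<Sum>k. ?w (int k) * (cmod (hat f k))\<^sup>2)"
        by (simp add: norm_ell2_sq cQ q2)
      then have "norm Q = sqrt (\<Sum>k. ?w (int k) * (cmod (hat f k))\<^sup>2)"
        by (metis norm_ge_zero real_sqrt_unique)
      then show ?thesis by (simp add: Hs_norm_def W(2)[OF fs])
    qed
    have pq: "inner (coef P k) (coef Q k) = (1 + real k) * cmod (hat f k)" for k
    proof -
      have pos: "0 < 1 + (real k)\<^sup>2" by (simp add: add_pos_nonneg)
      have "(1 + (real k)\<^sup>2) powr (- s / 2) * (1 + (real k)\<^sup>2) powr (s / 2) = 1"
        using pos by (simp add: powr_add[symmetric])
      then show ?thesis by (simp add: cP cQ inner_complex_def p_def q_def mult_ac)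
    qed
    have ss: "(\<lambda>k. (1 + real k) * cmod (hat f k)) sums inner P Q"
      using inner_sums[of P Q] by (simp add: pq)
    show "summable (\<lambda>k. (1 + real k) * cmod (hat f k))" by (rule sums_summable[OF ss])
    have "inner P Q \<le> norm P * norm Q" by (rule norm_cauchy_schwarz)
    then show "(\<Sum>k. (1 + real k) * cmod (hat f k)) \<le> norm P * Hs_norm s f"
      by (simp add: sums_unique[OF ss, symmetric] nQ)
  qed simp
qed

lemma hat_diff: "f \<in> L2 \<Longrightarrow> g \<in> L2 \<Longrightarrow> hat (f - g) k = hat f k - hat g k"
  by (simp add: hat_def fourier_diff)

lemma Hs_plus_diff:
  assumes f: "f \<in> Hs_plus s" and g: "g \<in> Hs_plus s" shows "f - g \<in> Hs_plus s"
proof -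
  have L: "f \<in> L2_plus" "g \<in> L2_plus" using assms by (auto simp: Hs_plus_def)
  let ?w = "\<lambda>n::int. (1 + (real_of_int n)\<^sup>2) powr s"
  have w0: "0 \<le> ?w n" for n by simp
  have "summable (\<lambda>k. ?w (int k) * (cmod (hat f k))\<^sup>2)" "summable (\<lambda>k. ?w (int k) * (cmod (hat g k))\<^sup>2)"
    using assms weighted_sum_L2_plus(1)[where w = ?w, OF L(1) w0] weighted_sum_L2_plus(1)[where w = ?w, OF L(2) w0]
    by (auto simp: Hs_plus_def Hs_def)
  then have sm: "summable (\<lambda>k. 2 * (?w (int k) * (cmod (hat f k))\<^sup>2) + 2 * (?w (int k) * (cmod (hat g k))\<^sup>2))"
    by (intro summable_add summable_mult)
  have "summable (\<lambda>k. ?w (int k) * (cmod (hat (f - g) k))\<^sup>2)"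
  proof (rule summable_comparison_test'[OF sm])
    fix k
    have "(cmod (hat f k - hat g k))\<^sup>2 \<le> 2 * (cmod (hat f k))\<^sup>2 + 2 * (cmod (hat g k))\<^sup>2"
      using cmod_add_sq_le[of "hat f k" "- hat g k"] by simp
    then have "?w (int k) * (cmod (hat f k - hat g k))\<^sup>2 \<le> ?w (int k) * (2 * (cmod (hat f k))\<^sup>2 + 2 * (cmod (hat g k))\<^sup>2)"
      by (rule mult_left_mono) simp
    then show "norm (?w (int k) * (cmod (hat (f - g) k))\<^sup>2)
        \<le> 2 * (?w (int k) * (cmod (hat f k))\<^sup>2) + 2 * (?w (int k) * (cmod (hat g k))\<^sup>2)"
      by (simp add: hat_diff L2_plus_L2 L algebra_simps)
  qed
  then show ?thesis
    using weighted_sum_L2_plus(1)[where w = ?w, OF L2_plus_ops(2)[OF L] w0] L2_plus_ops(2)[OF L]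
    by (simp add: Hs_plus_def Hs_def L2_plus_L2)
qed

text \<open>The weighted sum is Lipschitz with respect to the H^s norm, hence continuous along the
  solution and bounded on compact sets of times.\<close>

lemma solution_wbound:
  assumes s: "s > 3 / 2" and sol: "CS_solution_on s u0 I u" and S: "compact S" "S \<subseteq> I"
  shows "\<exists>M. \<forall>r\<in>S. wbound M (hat (u r))"
proof -
  obtain C where "0 \<le> C" and C_all: "\<forall>f\<in>Hs_plus s. summable (\<lambda>k. (1 + real k) * cmod (hat f k)) \<and>
      (\<Sum>k. (1 + real k) * cmod (hat f k)) \<le> C * Hs_norm s f"
    using Hs_plus_weighted_bound[OF s] by blast
  then have C: "0 \<le> C" "\<And>f. f \<in> Hs_plus s \<Longrightarrow> summable (\<lambda>k. (1 + real k) * cmod (hat f k))"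
    "\<And>f. f \<in> Hs_plus s \<Longrightarrow> (\<Sum>k. (1 + real k) * cmod (hat f k)) \<le> C * Hs_norm s f"
    by simp_all
  have H: "u r \<in> Hs_plus s" if "r \<in> I" for r using sol that by (simp add: CS_solution_on_def)
  define m where "m r = (\<Sum>k. (1 + real k) * cmod (hat (u r) k))" for r
  have diff: "\<bar>m r - m t\<bar> \<le> C * Hs_norm s (u r - u t)" if rt: "r \<in> I" "t \<in> I" for r t
  proof -
    note Hd = Hs_plus_diff[OF H[OF rt(1)] H[OF rt(2)]]
    have L: "u r \<in> L2" "u t \<in> L2" using H rt by (auto simp: Hs_plus_def L2_plus_def)
    have "m r - m t = (\<Sum>k. (1 + real k) * cmod (hat (u r) k) - (1 + real k) * cmod (hat (u t) k))"
      unfolding m_def by (intro suminf_diff C(2) H rt)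
    also have "\<bar>\<dots>\<bar> \<le> (\<Sum>k. (1 + real k) * cmod (hat (u r - u t) k))"
    proof -
      have "norm (\<Sum>k. (1 + real k) * cmod (hat (u r) k) - (1 + real k) * cmod (hat (u t) k))
          \<le> (\<Sum>k. (1 + real k) * cmod (hat (u r - u t) k))"
      proof (rule norm_suminf_le[OF _ C(2)[OF Hd]])
        fix k
        have "\<bar>cmod (hat (u r) k) - cmod (hat (u t) k)\<bar> \<le> cmod (hat (u r - u t) k)"
          unfolding hat_diff[OF L] by (rule norm_triangle_ineq3)
        then have "(1 + real k) * \<bar>cmod (hat (u r) k) - cmod (hat (u t) k)\<bar> \<le> (1 + real k) * cmod (hat (u r - u t) k)"
          by (rule mult_left_mono) simp
        then show "norm ((1 + real k) * cmod (hat (u r) k) - (1 + real k) * cmod (hat (u t) k))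
            \<le> (1 + real k) * cmod (hat (u r - u t) k)"
          by (simp add: right_diff_distrib[symmetric] abs_mult)
      qed
      then show ?thesis by simp
    qed
    also have "\<dots> \<le> C * Hs_norm s (u r - u t)" by (rule C(3)[OF Hd])
    finally show ?thesis .
  qed
  have "continuous_on S m"
  proof (intro continuous_at_imp_continuous_on ballI)
    fix t assume "t \<in> S"
    then have t: "t \<in> I" using S by blast
    have oI: "open I" using sol by (simp add: CS_solution_on_def)
    have "((\<lambda>r. C * Hs_norm s (u r - u t)) \<longlongrightarrow> C * 0) (at t)"
      using sol t by (intro tendsto_mult tendsto_const) (auto simp: CS_solution_on_def)
    then have "((\<lambda>r. C * Hs_norm s (u r - u t)) \<longlongrightarrow> 0) (at t)" by simp
    then have "((\<lambda>r. m r - m t) \<longlongrightarrow> 0) (at t)"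
    proof (rule Lim_null_comparison[rotated])
      show "\<forall>\<^sub>F r in at t. norm (m r - m t) \<le> C * Hs_norm s (u r - u t)"
        using eventually_at_in_open'[OF oI t] by eventually_elim (use diff t in simp)
    qed
    then show "isCont m t" unfolding isCont_def by (rule LIM_zero_cancel)
  qed
  from compact_continuous_image[OF this S(1)] have "bounded (m ` S)" by (rule compact_imp_bounded)
  then obtain M where "\<And>r. r \<in> S \<Longrightarrow> \<bar>m r\<bar> \<le> M" by (auto simp: bounded_iff)
  then have "\<forall>r\<in>S. wbound M (hat (u r))"
    using C(2)[OF H] S(2) unfolding wbound_def m_def by (auto dest: abs_le_D1)
  then show ?thesis by blast
qed

text \<open>The equation is tested with e^{inx}; its second derivative contributes the real factor -
  n^2, which conjugation in the second argument leaves alone.\<close>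

lemma solution_derivative:
  assumes sol: "CS_solution_on s u0 I u" and t: "t \<in> I" and bnd: "wbound M (hat (u t))"
  shows "((\<lambda>r. hat (u r) n) has_vector_derivative cs_field (hat (u t)) n) (at t)"
proof -
  have L: "u t \<in> L2_plus" using sol t by (simp add: CS_solution_on_def Hs_plus_def)
  obtain w where w: "((\<lambda>r. inner_fun (u r) (fun_class (expc (int n)))) has_vector_derivative w) (at t)"
    and eq: "\<i> * w + inner_fun (u t) (fun_class ((vec_deriv ^^ 2) (expc (int n))))
       + inner_fun (2 * D_plus (u t * cnj_fun (u t)) * u t) (fun_class (expc (int n))) = 0"
    using sol t test_function_expc[of "int n"] unfolding CS_solution_on_def by blast
  have h: "inner_fun f (fun_class (expc (int n))) = fourier f (int n)" for f
    by (simp add: fourier_def exp_fun_eq)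
  have "fun_class ((vec_deriv ^^ 2) (expc (int n))) = const_fun (- (of_nat n)\<^sup>2) * exp_fun (int n)"
    unfolding vec_deriv_expc const_fun_def exp_fun_eq
    by (subst fun_class_ops(3)) (simp_all add: measurable_expc power_mult_distrib)
  then have "inner_fun (u t) (fun_class ((vec_deriv ^^ 2) (expc (int n)))) = - (of_nat n)\<^sup>2 * hat (u t) n"
    by (simp add: inner_fun_commute[of "u t"] inner_fun_const_left hat_def fourier_def)
  with eq have "\<i> * w = of_nat n * (of_nat n * hat (u t) n)
      - 2 * (\<Sum>j\<le>n. hat (u t) j * (of_nat (n - j) * autocorr (hat (u t)) (n - j)))"
    by (simp only: h fourier_nonlinearity[OF L bnd]) (simp add: algebra_simps power2_eq_square)
  then have "- \<i> * (\<i> * w) = cs_field (hat (u t)) n"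
    unfolding cs_field_def by (simp only:) (simp add: algebra_simps)
  then have "w = cs_field (hat (u t)) n" by (simp add: mult.assoc[symmetric])
  then show ?thesis using w by (simp add: h hat_def)
qed

theorem proposition2p5:
  fixes s :: real and u0 :: circfun and I :: "real set" and u :: "real \<Rightarrow> circfun"
  assumes "s > 3 / 2"
    and "u0 \<in> Hs_plus s"
    and "CS_maximal_solution s u0 I u"
  shows "\<forall>t\<in>I. \<forall>z\<in>ball 0 1.
    holo_ext (u t) z =
      inner_fun
        (op_inverse
           (\<lambda>h. h - const_fun (z * exp (- \<i> * complex_of_real t))
                      * exp_i_op (- 2 * t) (Lax_op u0) (Hs_plus 1) (S_star h))
           u0)
        1"
proof (intro ballI)
  fix t z assume t: "t \<in> I" and z: "z \<in> ball (0 :: complex) 1"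
  have sol: "CS_solution_on s u0 I u" using assms(3) by (simp add: CS_maximal_solution_def)
  then have I: "is_interval I" "0 \<in> I" "u 0 = u0" by (auto simp: CS_solution_on_def)
  \<comment> \<open>The solution is followed between 0 and t in either direction; this compact
    interval lies in I and yields one constant M.\<close>
  let ?S = "{min 0 t..max 0 t}"
  have "?S \<subseteq> I"
  proof
    fix r assume "r \<in> ?S"
    then show "r \<in> I"
      using mem_is_interval_1_I[OF I(1) I(2) t, of r] mem_is_interval_1_I[OF I(1) t I(2), of r]
      by (cases "0 \<le> t") auto
  qed
  note S = this
  obtain M where M: "\<forall>r\<in>?S. wbound M (hat (u r))"
    using solution_wbound[OF assms(1) sol compact_Icc S] by blast
  have zero: "0 \<in> ?S" by auto
  have u0: "u0 \<in> L2_plus" using assms(2) by (simp add: Hs_plus_def)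
  have b0: "wbound M (hat u0)" using M zero I(3) by metis
  have "hat (u t) n = coef ((kfull u0 t ^^ n) (toE u0)) 0" for n
  proof -
    have "hat (u t) n = coef (((\<lambda>x. cop (exp (- \<i> * of_real t)) \<rhd> lim_group (hat (u 0)) (- 2 * t) (bshift \<rhd> x)) ^^ n)
        (toep (hat (u 0)) \<rhd> unit_vec 0 1)) 0"
    proof (rule explicit_formula_coeff)
      show "wbound M (hat (u q))" if "q \<in> ?S" for q using M that by blast
      show "((\<lambda>q. hat (u q) k) has_vector_derivative cs_field (hat (u q)) k) (at q within ?S)" if q: "q \<in> ?S" for q k
        using solution_derivative[OF sol] M q S by (blast intro: has_vector_derivative_at_within)
    qed
    \<comment> \<open>The identity u0 = T_{u0} 1 identifies the starting vector of the
      iteration.\<close>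
    moreover have "toep (hat u0) \<rhd> unit_vec 0 1 = toE u0"
      by (rule ell2_eqI) (simp add: coef_toep_unit[OF wbound_summable(1)[OF b0]] coef_toE L2_plus_L2 u0 hat_def)
    ultimately show ?thesis by (simp only: I(3) kfull_def[abs_def])
  qed
  then have "holo_ext (u t) z = (\<Sum>n. coef ((kfull u0 t ^^ n) (toE u0)) 0 * z ^ n)"
    by (simp add: holo_ext_def hat_def)
  then show "holo_ext (u t) z = inner_fun (op_inverse
      (\<lambda>h. h - const_fun (z * exp (- \<i> * complex_of_real t))
         * exp_i_op (- 2 * t) (Lax_op u0) (Hs_plus 1) (S_star h)) u0) 1"
    using resolvent_series[OF u0 b0, of z t] z by simp
qed

end
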